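(* Let $\mathcal{H}=\{H_\theta:\theta\in\Theta_0\}$ be a transformation group of maps $H_\theta:D\to S$, with functions $T,U_1,U_2$, as described in the context. Let $\mathcal{F}(\mathcal{H})$ and $\mathcal{G}(\mathcal{H})$ be two $\mathcal{H}$-based equivalence classes and let their respective representatives $f$ and $g$ be two continuously differentiable densities with common full support $S$. Let $\varphi_f^{\mathcal{H}}(x):=U_2(x)+U_1(x)f'(x)/f(x)$ be the $\mathcal{H}$-score function of $f$. If $\varphi_f^{\mathcal{H}}$ is invertible over $S$, then there exists $N\in\mathbb{N}$ such that, for any $n\ge N$, we have $\hat\theta^{(n)}_f=\hat\theta^{(n)}_g$ for all samples of size $n$ if and only if there exist constants $c,d\in\mathbb{R}_0^+=(0,\infty)$ such that $$g(x)=c\,\exp\Bigl((d-1)\int^x \frac{U_2(y)}{U_1(y)}\,dy\Bigr)(f(x))^d\quad\text{for all }x\in S$$ (with $c=d=1$ if there exists $x_0\in S$ such that $U_1(x_0)=0$), that is, if and only if $\mathcal{F}(\mathcal{H})=\mathcal{G}(\mathcal{H})$. The smallest integer for which this holds (the minimal necessary sample size) is $\mathrm{MNSS}=\max\{N_f,3\}$, with $N_f$ the minimal covering sample size defined in the context.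
   Context: Group families. The parameter space $\Theta\subset\mathbb{R}$ contains an open set $\Theta_0$ of which the true parameter is an interior point. $\mathcal{H}=\{H_\theta:\theta\in\Theta_0\}$ is a transformation group (closed under composition and inversion) of monotone increasing, everywhere differentiable functions $H_\theta:D\subseteq\mathbb{R}\to S$ depending on a single real parameter $\theta$; the sets $D$ and $S$ do not depend on $\theta$. If $X$ is a random variable with density $f$ (with respect to Lebesgue measure) with support $S$, then $H_\theta^{-1}(X)$ has density on $D$ $$f_{\mathcal{H}}(x;\theta)=H_\theta'(x)\,f(H_\theta(x)),$$ where $H_\theta'$ is the derivative of $x\mapsto H_\theta(x)$. Distinct values of $\theta$ give distinct distributions. The maps $\theta\mapsto H_\theta(x)$ and $\theta\mapsto H'_\theta(x)$ are assumed differentiable, and it is assumed that there are real-valued functions $T,U_1,U_2$ with $$\partial_\theta H_\theta(x)=T(\theta)\,U_1(H_\theta(x)),\qquad \frac{\partial_\theta H_\theta'(x)}{H_\theta'(x)}=T(\theta)\,U_2(H_\theta(x)).$$ Maximum likelihood estimator. Observations are sampled independently from $f_{\mathcal{H}}(\cdot;\theta)$. For $n\ge1$, $\hat\theta_f^{(n)}:D^n\to\Theta_0$ is (if it exists) the measurable function such that $\prod_{i=1}^n f_{\mathcal{H}}(x_i;\hat\theta_f^{(n)}(\mathbf{x}^{(n)}))\ge\prod_{i=1}^n f_{\mathcal{H}}(x_i;\theta)$ for all $\theta\in\Theta_0$ and all samples $\mathbf{x}^{(n)}=(x_1,\dots,x_n)\in D^n$. The statement "$\hat\theta^{(n)}_f=\hat\theta^{(n)}_g$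 for all samples of size $n$" means that the MLE for $f$ is also the MLE for $g$: $\sum_{i=1}^n\log g_{\mathcal{H}}(x_i;\hat\theta^{(n)}_f(\mathbf{x}^{(n)}))\ge\sum_{i=1}^n\log g_{\mathcal{H}}(x_i;\theta)$ for all $\theta\in\Theta_0$ and all $\mathbf{x}^{(n)}\in D^n$. $\mathcal{H}$-based equivalence classes. Two densities $f,g$ on $S$ belong to the same $\mathcal{H}$-based equivalence class if $g(x)=c\exp\bigl((d-1)\int^x U_2(y)/U_1(y)\,dy\bigr)(f(x))^d$ on $S$ for some $d>0$ (such that $g$ is integrable) and $c$ a normalizing constant, where $\int^x$ denotes an antiderivative; if there exists $x_0\in S$ with $U_1(x_0)=0$, then $c=d=1$ and the classes are singletons $\{f\}$. Minimal covering sample size. Writing the image of the (strictly monotone) score function $\varphi_f^{\mathcal{H}}$ as $(-P_f^-,P_f^+)$ with $P_f^-,P_f^+$ positive and possibly infinite, the minimal covering sample size (MCSS) is defined by $$N_f=\begin{cases}2 & \text{if } P^-_f=P^+_f,\\ \left\lceil \dfrac{\max(P^+_f,P^-_f)}{\min(P^+_f,P^-_f)}+1\right\rceil & \text{if } P^-_f\ne P^+_f \text{ and } P^-_f,P^+_f<+\infty,\\ \infty & \text{otherwise.}\end{cases}$$ *)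

theory Defs
  imports "HOL-Analysis.Analysis" "HOL-Algebra.Bij" "HOL-Library.Extended_Nat"
begin

text \<open>
  A function \<open>H\<close> stands for the family \<open>\<theta> \<mapsto> H \<theta>\<close>; only its values on \<open>D\<close> matter.
  Closure under composition and inversion is stated by saying that the restrictions
  of the \<open>H \<theta>\<close> to \<open>D\<close> form a subgroup of the group of all bijections of \<open>D\<close>; since every
  \<open>H \<theta>\<close> also maps \<open>D\<close> onto \<open>S\<close>, this forces \<open>D = S\<close>.  The quotient in the last
  condition is a genuine one: \<open>deriv (H \<theta>) x \<noteq> 0\<close> because the inverse of \<open>H \<theta>\<close> is again
  a differentiable member of the family.
\<close>

locale group_family =
  fixes \<Theta>0 D S :: "real set"
    and H :: "real \<Rightarrow> real \<Rightarrow> real"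
    and T U1 U2 :: "real \<Rightarrow> real"
  assumes open_params: "open \<Theta>0"
    and open_support: "open S"
    and bij: "\<theta> \<in> \<Theta>0 \<Longrightarrow> bij_betw (H \<theta>) D S"
    and transformation_group: "subgroup ((\<lambda>\<theta>. restrict (H \<theta>) D) ` \<Theta>0) (BijGroup D)"
    and increasing: "\<theta> \<in> \<Theta>0 \<Longrightarrow> mono_on D (H \<theta>)"
    and differentiable: "\<theta> \<in> \<Theta>0 \<Longrightarrow> x \<in> D \<Longrightarrow> H \<theta> differentiable at x"
    and param_differentiable:
      "\<theta> \<in> \<Theta>0 \<Longrightarrow> x \<in> D \<Longrightarrow> (\<lambda>t. H t x) differentiable at \<theta>"
    and param_differentiable_deriv:
      "\<theta> \<in> \<Theta>0 \<Longrightarrow> x \<in> D \<Longrightarrow> (\<lambda>t. deriv (H t) x) differentiable at \<theta>"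
    and param_deriv:
      "\<theta> \<in> \<Theta>0 \<Longrightarrow> x \<in> D \<Longrightarrow> deriv (\<lambda>t. H t x) \<theta> = T \<theta> * U1 (H \<theta> x)"
    and param_deriv_deriv:
      "\<theta> \<in> \<Theta>0 \<Longrightarrow> x \<in> D \<Longrightarrow>
        deriv (\<lambda>t. deriv (H t) x) \<theta> / deriv (H \<theta>) x = T \<theta> * U2 (H \<theta> x)"

definition density_with_support :: "real set \<Rightarrow> (real \<Rightarrow> real) \<Rightarrow> bool" where
  "density_with_support S f \<longleftrightarrow>
     f \<in> borel_measurable borel \<and>
     (\<forall>x\<in>S. 0 < f x) \<and> (\<forall>x. x \<notin> S \<longrightarrow> f x = 0) \<and>
     (\<integral>\<^sup>+x. ennreal (f x) \<partial>lborel) = 1"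

definition family_density ::
  "real set \<Rightarrow> (real \<Rightarrow> real \<Rightarrow> real) \<Rightarrow> (real \<Rightarrow> real) \<Rightarrow> real \<Rightarrow> real \<Rightarrow> real" where
  "family_density D H f \<theta> x = (if x \<in> D then deriv (H \<theta>) x * f (H \<theta> x) else 0)"

definition identifiable ::
  "real set \<Rightarrow> real set \<Rightarrow> (real \<Rightarrow> real \<Rightarrow> real) \<Rightarrow> (real \<Rightarrow> real) \<Rightarrow> bool" where
  "identifiable \<Theta>0 D H f \<longleftrightarrow>
     inj_on (\<lambda>\<theta>. density lborel (\<lambda>x. ennreal (family_density D H f \<theta> x))) \<Theta>0"

text \<open>
  A sample of size \<open>n\<close> is an element of \<open>{..<n} \<rightarrow>\<^sub>E D\<close>, the space of the product
  measurable space below; measurability into \<open>restrict_space borel \<Theta>0\<close> includes that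
  the estimator takes its values in \<open>\<Theta>0\<close>.
\<close>

definition is_mle ::
  "real set \<Rightarrow> real set \<Rightarrow> (real \<Rightarrow> real \<Rightarrow> real) \<Rightarrow> nat \<Rightarrow> (real \<Rightarrow> real)
    \<Rightarrow> ((nat \<Rightarrow> real) \<Rightarrow> real) \<Rightarrow> bool" where
  "is_mle \<Theta>0 D H n f est \<longleftrightarrow>
     est \<in> measurable (Pi\<^sub>M {..<n} (\<lambda>_. restrict_space borel D)) (restrict_space borel \<Theta>0) \<and>
     (\<forall>x \<in> {..<n} \<rightarrow>\<^sub>E D. \<forall>\<theta>\<in>\<Theta>0.
        (\<Prod>i<n. family_density D H f \<theta> (x i)) \<le> (\<Prod>i<n. family_density D H f (est x) (x i)))"

definition mle_coincide ::
  "real set \<Rightarrow> real set \<Rightarrow> (real \<Rightarrow> real \<Rightarrow> real) \<Rightarrow> nat \<Rightarrow> (real \<Rightarrow> real) \<Rightarrow> (real \<Rightarrow> real) \<Rightarrow> bool" where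
  "mle_coincide \<Theta>0 D H n f g \<longleftrightarrow>
     (\<forall>est. is_mle \<Theta>0 D H n f est \<longrightarrow>
       (\<forall>x \<in> {..<n} \<rightarrow>\<^sub>E D. \<forall>\<theta>\<in>\<Theta>0.
          (\<Sum>i<n. ln (family_density D H g \<theta> (x i)))
            \<le> (\<Sum>i<n. ln (family_density D H g (est x) (x i)))))"

definition score :: "(real \<Rightarrow> real) \<Rightarrow> (real \<Rightarrow> real) \<Rightarrow> (real \<Rightarrow> real) \<Rightarrow> real \<Rightarrow> real" where
  "score U1 U2 f x = U2 x + U1 x * deriv f x / f x"

text \<open>
  \<open>A\<close> plays the role of \<open>\<integral>\<^sup>x U2 y / U1 y dy\<close>.  If \<open>U1\<close> vanishes somewhere on \<open>S\<close>, no
  antiderivative is required, and \<open>c = d = 1\<close> makes the value of \<open>A\<close> irrelevant.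
\<close>

definition H_related ::
  "real set \<Rightarrow> (real \<Rightarrow> real) \<Rightarrow> (real \<Rightarrow> real) \<Rightarrow> (real \<Rightarrow> real) \<Rightarrow> (real \<Rightarrow> real) \<Rightarrow> bool" where
  "H_related S U1 U2 f g \<longleftrightarrow>
     (\<exists>c>0. \<exists>d>0. \<exists>A.
        (if \<exists>x0\<in>S. U1 x0 = 0 then c = 1 \<and> d = 1
         else \<forall>x\<in>S. (A has_real_derivative U2 x / U1 x) (at x)) \<and>
        (\<forall>x\<in>S. g x = c * exp ((d - 1) * A x) * f x powr d))"

definition H_class ::
  "real set \<Rightarrow> (real \<Rightarrow> real) \<Rightarrow> (real \<Rightarrow> real) \<Rightarrow> (real \<Rightarrow> real) \<Rightarrow> (real \<Rightarrow> real) set" where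
  "H_class S U1 U2 f = {g. density_with_support S g \<and> H_related S U1 U2 f g}"

text \<open>The image of an invertible score function on \<open>S\<close> is the open interval from
  \<open>- score_minus\<close> to \<open>score_plus\<close>.\<close>

definition score_plus ::
  "real set \<Rightarrow> (real \<Rightarrow> real) \<Rightarrow> (real \<Rightarrow> real) \<Rightarrow> (real \<Rightarrow> real) \<Rightarrow> ereal" where
  "score_plus S U1 U2 f = (SUP x\<in>S. ereal (score U1 U2 f x))"

definition score_minus ::
  "real set \<Rightarrow> (real \<Rightarrow> real) \<Rightarrow> (real \<Rightarrow> real) \<Rightarrow> (real \<Rightarrow> real) \<Rightarrow> ereal" where
  "score_minus S U1 U2 f = - (INF x\<in>S. ereal (score U1 U2 f x))"

definition mcss ::
  "real set \<Rightarrow> (real \<Rightarrow> real) \<Rightarrow> (real \<Rightarrow> real) \<Rightarrow> (real \<Rightarrow> real) \<Rightarrow> enat" where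
  "mcss S U1 U2 f =
     (let P = score_plus S U1 U2 f; M = score_minus S U1 U2 f in
      if M = P then 2
      else if M < \<infinity> \<and> P < \<infinity>
        then enat (nat \<lceil>real_of_ereal (max P M) / real_of_ereal (min P M) + 1\<rceil>)
      else \<infinity>)"

text \<open>
  The minimal necessary sample size is a quantity attached to \<open>f\<close> alone: a bound \<open>N\<close>
  counts only if it works for every competitor \<open>h\<close>.  It is \<open>\<infinity>\<close> (the infimum of the
  empty set) if there is no such uniform bound.
\<close>

definition mnss ::
  "real set \<Rightarrow> real set \<Rightarrow> real set \<Rightarrow> (real \<Rightarrow> real \<Rightarrow> real) \<Rightarrow> (real \<Rightarrow> real) \<Rightarrow> (real \<Rightarrow> real)
    \<Rightarrow> (real \<Rightarrow> real) \<Rightarrow> enat" where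
  "mnss \<Theta>0 D S H U1 U2 f =
     Inf (enat ` {N. 1 \<le> N \<and>
       (\<forall>h. density_with_support S h \<and> h C1_differentiable_on S \<longrightarrow>
         (\<forall>n\<ge>N. mle_coincide \<Theta>0 D H n f h \<longleftrightarrow> H_related S U1 U2 f h))})"

end

theory Submission
  imports Defs
begin

text \<open>
  Existence of the MLE for samples of size one makes the group transitive on \<open>S\<close> (every orbit
  must meet the unique zero of the score) and makes stabilizers have slope \<open>1\<close>, so there is an
  invariant density \<open>w\<close>.  It is continuous where \<open>U1 \<noteq> 0\<close>; this forces the action on each component of
  \<open>S\<close> to be free, hence, by Hoelder's theorem on Archimedean groups, abelian.  Differentiating the
  commutation relation shows that \<open>U1\<close> is equivariant, thus proportional to \<open>1 / w\<close> and nowhere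
  zero, and \<open>s = \<integral> 1 / U1\<close> turns the component into the line on which the group acts by all translations.
  There the score is the derivative of \<open>ln (f / w)\<close>; being injective it is strictly monotone and
  continuous.  A second component would carry an unbounded likelihood, so \<open>S\<close> is connected and one is
  left with a location family whose log-density is strictly concave.

  For such a family the estimators for \<open>f\<close> and \<open>g\<close> coincide at size \<open>n\<close> only if \<open>F\<close>, the score
  of \<open>g\<close> as a function of the score of \<open>f\<close>, maps tuples with sum zero to tuples with sum zero.  For
  \<open>n \<ge> 3\<close> this makes \<open>F\<close> additive and therefore linear at all \<open>a\<close> for which \<open>- a / (n - 1)\<close> is again
  a score; these \<open>a\<close> exhaust the range exactly when \<open>n\<close> reaches the MCSS.  Conversely, adding to the
  score a small bump at values that no vanishing sum of \<open>n\<close> scores can contain, or an odd bump if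
  \<open>n = 2\<close>, produces an unrelated density with the same estimators.
\<close>

subsection \<open>Real functions with injective derivatives\<close>

text \<open>The obstacle is missing regularity: \<open>T\<close>, \<open>U1\<close> and
  \<open>U2\<close> are arbitrary functions, slopes are not known to be continuous in
  \<open>x\<close>, and nothing is assumed jointly in \<theta> and \<open>x\<close>, so Lie theory
  does not apply. The parameter is the only usable direction, and \<open>T\<close> may vanish at
  many parameters; identifiability supplies one \<open>t0\<close> with
  \<open>T t0 \<noteq> 0\<close>. Moving \<open>x\<close> by \<open>H t\<close> after the inverse of
  \<open>H t0\<close> turns differentiability in the parameter into differentiability in
  \<open>x\<close> wherever \<open>U1 x \<noteq> 0\<close>; this is why \<open>w\<close> is at first
  known to be continuous only there. Continuity of \<open>w\<close> makes the action free: if an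
  element fixes one point and moves another, its iterates or those of its inverse converge inside
  the component and shrink an interval to nothing, while near a point of continuity of
  \<open>w\<close> iterates change lengths only by a bounded factor. The score, too, is known merely
  to be a derivative, so its monotonicity and continuity come from Darboux's theorem. The number 3
  enters because two scores with sum zero only test whether \<open>F\<close> is odd; additivity
  takes three.\<close>

lemma curve_covers_nbhd:
  fixes \<gamma> :: "real \<Rightarrow> real"
  assumes der: "(\<gamma> has_real_derivative a) (at t0)" and a: "a \<noteq> 0"
    and cont: "\<forall>\<^sub>F t in nhds t0. isCont \<gamma> t" and e: "e > 0"
  shows "\<forall>\<^sub>F y in nhds (\<gamma> t0). \<exists>t. \<bar>t - t0\<bar> < e \<and> \<gamma> t = y"
proof -
  from cont obtain d0 where d0: "d0 > 0" "\<And>t. dist t t0 < d0 \<Longrightarrow> isCont \<gamma> t"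
    unfolding eventually_nhds_metric by blast
  \<comment> \<open>The derivative is known at \<open>t0\<close> only: it puts
    \<open>\<gamma>\<close> strictly on opposite sides of \<open>\<gamma> t0\<close> before and
    after \<open>t0\<close>, and continuity nearby does the rest by intermediate values.\<close>
  obtain d1 where d1: "d1 > 0" "\<And>h. 0 < h \<Longrightarrow> h < d1 \<Longrightarrow>
      (\<gamma> (t0 - h) < \<gamma> t0 \<and> \<gamma> t0 < \<gamma> (t0 + h)) \<or> (\<gamma> (t0 - h) > \<gamma> t0 \<and> \<gamma> t0 > \<gamma> (t0 + h))"
  proof (cases "a > 0")
    case True
    from DERIV_pos_inc_left[OF der True] DERIV_pos_inc_right[OF der True]
    obtain p q where "p > 0" "q > 0" "\<forall>h>0. h < p \<longrightarrow> \<gamma> (t0 - h) < \<gamma> t0" "\<forall>h>0. h < q \<longrightarrow> \<gamma> t0 < \<gamma> (t0 + h)"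
      by auto
    then show ?thesis by (intro that[of "min p q"]) auto
  next
    case False
    then have "a < 0" using a by simp
    from DERIV_neg_dec_left[OF der this] DERIV_neg_dec_right[OF der this]
    obtain p q where "p > 0" "q > 0" "\<forall>h>0. h < p \<longrightarrow> \<gamma> (t0 - h) > \<gamma> t0" "\<forall>h>0. h < q \<longrightarrow> \<gamma> t0 > \<gamma> (t0 + h)"
      by auto
    then show ?thesis by (intro that[of "min p q"]) auto
  qed
  define h where "h = Min {d0, d1, e} / 2"
  have h: "0 < h" "h < d0" "h < d1" "h < e" using d0 d1 e by (auto simp: h_def)
  have conn: "connected (\<gamma> ` {t0 - h..t0 + h})"
    by (intro connected_continuous_image continuous_at_imp_continuous_on ballI d0(2))
      (use h in \<open>auto simp: dist_real_def\<close>)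
  define l where "l = min (\<gamma> (t0 - h)) (\<gamma> (t0 + h))"
  define u where "u = max (\<gamma> (t0 - h)) (\<gamma> (t0 + h))"
  have lu: "l < \<gamma> t0" "\<gamma> t0 < u" using d1(2)[of h] h by (auto simp: l_def u_def)
  have "{l..u} \<subseteq> \<gamma> ` {t0 - h..t0 + h}"
    by (rule connected_contains_Icc[OF conn]) (use h in \<open>auto simp: l_def u_def min_def max_def\<close>)
  moreover have "\<forall>\<^sub>F y in nhds (\<gamma> t0). y \<in> {l<..<u}"
    by (rule eventually_nhds_in_open) (use lu in auto)
  ultimately have sub: "\<forall>\<^sub>F y in nhds (\<gamma> t0). y \<in> \<gamma> ` {t0 - h..t0 + h}"
    by (elim eventually_mono) (auto simp: subset_iff)
  show ?thesis
    using sub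
  proof (rule eventually_mono)
    fix y assume "y \<in> \<gamma> ` {t0 - h..t0 + h}"
    then obtain t where "t \<in> {t0 - h..t0 + h}" "\<gamma> t = y" by auto
    then show "\<exists>t. \<bar>t - t0\<bar> < e \<and> \<gamma> t = y" using h by (intro exI[of _ t]) auto
  qed
qed

text \<open>Stands in for an inverse function theorem: \<open>\<gamma>\<close> may fail to be
  injective near \<open>t0\<close>, but every \<open>y\<close> near \<open>\<gamma> t0\<close> is
  \<open>\<gamma> t\<close> for some \<open>t\<close> near \<open>t0\<close>, so a bound on the
  quotient for all such \<open>t\<close> bounds it at \<open>y\<close>.\<close>

lemma derivative_along_curve:
  fixes \<gamma> u :: "real \<Rightarrow> real"
  assumes der: "(\<gamma> has_real_derivative a) (at t0)" and a: "a \<noteq> 0"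
    and cont: "\<forall>\<^sub>F t in nhds t0. isCont \<gamma> t"
    and du: "((\<lambda>t. u (\<gamma> t)) has_real_derivative b) (at t0)"
  shows "(u has_real_derivative b / a) (at (\<gamma> t0))"
proof -
  have l1: "((\<lambda>t. (\<gamma> t - \<gamma> t0) / (t - t0)) \<longlongrightarrow> a) (at t0)"
    using der by (simp add: has_field_derivative_iff)
  have l2: "((\<lambda>t. (u (\<gamma> t) - u (\<gamma> t0)) / (t - t0)) \<longlongrightarrow> b) (at t0)"
    using du by (simp add: has_field_derivative_iff)
  have "((\<lambda>t. ((u (\<gamma> t) - u (\<gamma> t0)) / (t - t0)) / ((\<gamma> t - \<gamma> t0) / (t - t0))) \<longlongrightarrow> b / a) (at t0)"
    by (intro tendsto_divide l1 l2 a)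
  then have l3: "((\<lambda>t. (u (\<gamma> t) - u (\<gamma> t0)) / (\<gamma> t - \<gamma> t0)) \<longlongrightarrow> b / a) (at t0)"
    by (rule Lim_transform_eventually) (auto simp: eventually_at_filter)
  show ?thesis
    unfolding has_field_derivative_iff
  proof (rule tendstoI)
    fix e :: real assume "e > 0"
    from tendstoD[OF l3 this] obtain d where d: "d > 0"
      "\<And>t. t \<noteq> t0 \<Longrightarrow> \<bar>t - t0\<bar> < d \<Longrightarrow> dist ((u (\<gamma> t) - u (\<gamma> t0)) / (\<gamma> t - \<gamma> t0)) (b / a) < e"
      unfolding eventually_at by (auto simp: dist_real_def)
    have "\<forall>\<^sub>F y in nhds (\<gamma> t0). \<exists>t. \<bar>t - t0\<bar> < d \<and> \<gamma> t = y"
      by (rule curve_covers_nbhd[OF der a cont d(1)])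
    then show "\<forall>\<^sub>F y in at (\<gamma> t0). dist ((u y - u (\<gamma> t0)) / (y - \<gamma> t0)) (b / a) < e"
      unfolding eventually_at_filter
    proof (rule eventually_mono, intro impI)
      fix y assume "\<exists>t. \<bar>t - t0\<bar> < d \<and> \<gamma> t = y" "y \<noteq> \<gamma> t0"
      then obtain t where "\<bar>t - t0\<bar> < d" "\<gamma> t = y" "t \<noteq> t0" by auto
      with d(2)[of t] show "dist ((u y - u (\<gamma> t0)) / (y - \<gamma> t0)) (b / a) < e" by simp
    qed
  qed
qed

text \<open>The minimum of \<open>P x - l * x\<close> on the closed interval cannot sit at an end,
  and at an interior minimum \<open>p\<close> equals \<open>l\<close>.\<close>

lemma darboux_less:
  fixes P p :: "real \<Rightarrow> real"
  assumes "a < b" and der: "\<And>x. (P has_real_derivative p x) (at x)"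
    and "p a < l" "l < p b"
  shows "\<exists>c. a < c \<and> c < b \<and> p c = l"
proof -
  let ?Q = "\<lambda>x. P x - l * x"
  have dQ: "(?Q has_real_derivative p x - l) (at x)" for x
    by (auto intro!: derivative_eq_intros der)
  have "continuous_on {a..b} ?Q"
    using DERIV_isCont[OF dQ] by (intro continuous_at_imp_continuous_on) auto
  then obtain c where c: "c \<in> {a..b}" "\<And>x. x \<in> {a..b} \<Longrightarrow> ?Q c \<le> ?Q x"
    using continuous_attains_inf[of "{a..b}" ?Q] \<open>a < b\<close> by (auto simp: less_imp_le)
  have "c \<noteq> a"
  proof
    assume "c = a"
    obtain d where d: "d > 0" "\<And>h. 0 < h \<Longrightarrow> h < d \<Longrightarrow> ?Q a > ?Q (a + h)"
      using DERIV_neg_dec_right[OF dQ[of a]] assms(3) by auto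
    define h where "h = min d (b - a) / 2"
    have "0 < h" "h < d" "a + h \<in> {a..b}" using d(1) \<open>a < b\<close> by (auto simp: h_def min_def field_simps)
    with d(2)[of h] c(2)[of "a + h"] \<open>c = a\<close> show False by auto
  qed
  moreover have "c \<noteq> b"
  proof
    assume "c = b"
    obtain d where d: "d > 0" "\<And>h. 0 < h \<Longrightarrow> h < d \<Longrightarrow> ?Q (b - h) < ?Q b"
      using DERIV_pos_inc_left[OF dQ[of b]] assms(4) by auto
    define h where "h = min d (b - a) / 2"
    have "0 < h" "h < d" "b - h \<in> {a..b}" using d(1) \<open>a < b\<close> by (auto simp: h_def min_def field_simps)
    with d(2)[of h] c(2)[of "b - h"] \<open>c = b\<close> show False by auto
  qed
  ultimately have "a < c" "c < b" using c(1) by auto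
  have "p c - l = 0"
    by (rule DERIV_local_min[OF dQ[of c], of "min (c - a) (b - c)"])
      (use \<open>a < c\<close> \<open>c < b\<close> c(2) in \<open>auto simp: abs_real_def split: if_splits\<close>)
  then show ?thesis using \<open>a < c\<close> \<open>c < b\<close> by auto
qed

lemma darboux:
  fixes P p :: "real \<Rightarrow> real"
  assumes "a < b" and der: "\<And>x. (P has_real_derivative p x) (at x)"
    and "p a < l \<and> l < p b \<or> p b < l \<and> l < p a"
  shows "\<exists>c. a < c \<and> c < b \<and> p c = l"
  using assms(3)
proof
  assume "p b < l \<and> l < p a"
  moreover have "((\<lambda>x. - P x) has_real_derivative - p x) (at x)" for x
    by (auto intro!: derivative_eq_intros der)
  ultimately show ?thesis using darboux_less[of a b "\<lambda>x. - P x" "\<lambda>x. - p x" "- l"] assms(1) by auto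
qed (use darboux_less[of a b P p l] assms in auto)

text \<open>If \<open>p\<close> turned at \<open>b\<close>, a level just short of \<open>p b\<close>
  would be attained on both sides of \<open>b\<close>, against injectivity. So \<open>p\<close> is
  monotone on every triple.\<close>

lemma inj_derivative_strict_mono:
  fixes P p :: "real \<Rightarrow> real"
  assumes der: "\<And>x. (P has_real_derivative p x) (at x)" and inj: "inj p"
  shows "strict_mono p \<or> (\<forall>x y. x < y \<longrightarrow> p y < p x)"
proof -
  have ne: "p x \<noteq> p y" if "x < y" for x y using inj that by (auto dest: injD)
  have between: "p a < p b \<and> p b < p c \<or> p c < p b \<and> p b < p a" if "a < b" "b < c" for a b c
  proof (rule ccontr)
    assume "\<not> ?thesis"
    moreover have "p a \<noteq> p b" "p b \<noteq> p c" using ne that by auto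
    ultimately consider "p b > max (p a) (p c)" | "p b < min (p a) (p c)"
      by linarith
    then have "\<exists>l. (p a < l \<and> l < p b \<or> p b < l \<and> l < p a) \<and> (p b < l \<and> l < p c \<or> p c < l \<and> l < p b)"
    proof cases
      case 1
      then show ?thesis using dense[of "max (p a) (p c)" "p b"] by auto
    next
      case 2
      then show ?thesis using dense[of "p b" "min (p a) (p c)"] by auto
    qed
    then obtain l where "p a < l \<and> l < p b \<or> p b < l \<and> l < p a" "p b < l \<and> l < p c \<or> p c < l \<and> l < p b"
      by blast
    from darboux[OF that(1) der this(1)] darboux[OF that(2) der this(2)]
    obtain u v where "u < b" "b < v" "p u = p v" by auto
    then show False using ne[of u v] by auto
  qed
  have eq1: "(p a < p b) = (p a < p c)" and eq2: "(p b < p c) = (p a < p c)" if "a < b" "b < c" for a b c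
    using between[OF that] by auto
  \<comment> \<open>Any pair is compared with the pair \<open>0\<close>, \<open>1\<close> by
    enlarging both to the interval from \<open>A\<close> to \<open>B\<close>.\<close>
  have key: "(p x < p y) = (p 0 < p 1)" if xy: "x < y" for x y
  proof -
    define A where "A = min x 0 - 1"
    define B where "B = max y 1 + 1"
    have AB: "A < x" "y < B" "A < 0" "1 < B" "x < B" "0 < B" using xy by (auto simp: A_def B_def)
    have "(p x < p y) = (p x < p B)" by (rule eq1[OF xy AB(2)])
    also have "\<dots> = (p A < p B)" by (rule eq2[OF AB(1) AB(5)])
    also have "\<dots> = (p 0 < p B)" by (rule eq2[OF AB(3) AB(6), symmetric])
    also have "\<dots> = (p 0 < p 1)" by (rule eq1[OF _ AB(4), symmetric]) simp
    finally show ?thesis .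
  qed
  show ?thesis
  proof (cases "p 0 < p 1")
    case True
    have "p x < p y" if "x < y" for x y using key[OF that] True by blast
    then show ?thesis by (auto simp: strict_mono_def)
  next
    case False
    have "p y < p x" if "x < y" for x y using key[OF that] False ne[OF that] by linarith
    then show ?thesis by blast
  qed
qed

text \<open>The intermediate value property fills the gap between \<open>p (x - 1)\<close> and
  \<open>p (x + 1)\<close>, and a monotone function with open image has no jumps.\<close>

lemma strict_mono_derivative_range_open:
  fixes P p :: "real \<Rightarrow> real"
  assumes der: "\<And>x. (P has_real_derivative p x) (at x)" and "strict_mono p"
  shows "open (range p)" "continuous_on UNIV p"
proof -
  show op: "open (range p)"
  proof (subst open_subopen, safe)
    fix x
    have lt: "p (x - 1) < p x" "p x < p (x + 1)" using assms(2) by (auto intro: strict_monoD)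
    have "{p (x - 1)<..<p (x + 1)} \<subseteq> range p"
      using darboux[of "x - 1" "x + 1" P p] der by fastforce
    then show "\<exists>T. open T \<and> p x \<in> T \<and> T \<subseteq> range p"
      using lt by (intro exI[of _ "{p (x - 1)<..<p (x + 1)}"]) auto
  qed
  show "continuous_on UNIV p"
    by (rule continuous_onI_mono) (use op assms(2) in \<open>auto dest: strict_mono_leD\<close>)
qed

lemma inj_derivative_range_open:
  fixes P p :: "real \<Rightarrow> real"
  assumes der: "\<And>x. (P has_real_derivative p x) (at x)" and inj: "inj p"
  shows "open (range p)" "continuous_on UNIV p"
proof -
  have "open (range p) \<and> continuous_on UNIV p"
    using inj_derivative_strict_mono[OF assms]
  proof
    assume "strict_mono p"
    then show ?thesis using strict_mono_derivative_range_open[OF der] by blast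
  next
    assume "\<forall>x y. x < y \<longrightarrow> p y < p x"
    then have sm: "strict_mono (\<lambda>x. - p x)" by (auto simp: strict_mono_def)
    have d: "((\<lambda>x. - P x) has_real_derivative - p x) (at x)" for x
      by (auto intro!: derivative_eq_intros der)
    have "open (uminus ` range (\<lambda>x. - p x))"
      using strict_mono_derivative_range_open(1)[OF d sm] by (rule open_negations)
    moreover have "uminus ` range (\<lambda>x. - p x) = range p" by (auto simp: image_image)
    moreover have "continuous_on UNIV (\<lambda>x. - (- p x))"
      using strict_mono_derivative_range_open(2)[OF d sm] by (rule continuous_on_minus)
    ultimately show ?thesis by simp
  qed
  then show "open (range p)" "continuous_on UNIV p" by auto
qed

subsection \<open>Differentiable groups acting transitively on an interval\<close>

text \<open>Elements of \<open>G\<close> are total functions of which only the values on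
  \<open>C\<close> matter, hence the pointwise inverses. Continuity of \<open>w\<close> is asked for
  at a single point; transitivity carries its consequences elsewhere.\<close>

locale line_group =
  fixes C :: "real set" and G :: "(real \<Rightarrow> real) set" and w :: "real \<Rightarrow> real" and y1 :: real
  assumes open_C: "open C" and connected_C: "connected C"
    and maps: "\<And>h x. h \<in> G \<Longrightarrow> x \<in> C \<Longrightarrow> h x \<in> C"
    and id_mem: "id \<in> G"
    and comp_mem: "\<And>h k. h \<in> G \<Longrightarrow> k \<in> G \<Longrightarrow> h \<circ> k \<in> G"
    and inverse_ex: "\<And>h. h \<in> G \<Longrightarrow> \<exists>k\<in>G. \<forall>x\<in>C. k (h x) = x \<and> h (k x) = x"
    and strict_increasing: "\<And>h x y. h \<in> G \<Longrightarrow> x \<in> C \<Longrightarrow> y \<in> C \<Longrightarrow> x < y \<Longrightarrow> h x < h y"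
    and diff: "\<And>h x. h \<in> G \<Longrightarrow> x \<in> C \<Longrightarrow> h differentiable at x"
    and transitive: "\<And>x y. x \<in> C \<Longrightarrow> y \<in> C \<Longrightarrow> \<exists>h\<in>G. h x = y"
    and w_pos: "\<And>x. x \<in> C \<Longrightarrow> w x > 0"
    and w_invariant: "\<And>h x. h \<in> G \<Longrightarrow> x \<in> C \<Longrightarrow> w (h x) * deriv h x = w x"
    and y1: "y1 \<in> C" "isCont w y1"
begin

lemma pow_mem: "h \<in> G \<Longrightarrow> h ^^ n \<in> G"
  by (induction n) (auto simp: id_mem comp_mem)

lemma pow_maps: "h \<in> G \<Longrightarrow> x \<in> C \<Longrightarrow> (h ^^ n) x \<in> C"
  using maps pow_mem by blast

lemma less_iff: "h \<in> G \<Longrightarrow> x \<in> C \<Longrightarrow> y \<in> C \<Longrightarrow> h x < h y \<longleftrightarrow> x < y"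
  using strict_increasing by (metis less_asym linorder_neqE)

lemma le_iff: "h \<in> G \<Longrightarrow> x \<in> C \<Longrightarrow> y \<in> C \<Longrightarrow> h x \<le> h y \<longleftrightarrow> x \<le> y"
  using less_iff by (meson not_less)

lemma eq_iff': "h \<in> G \<Longrightarrow> x \<in> C \<Longrightarrow> y \<in> C \<Longrightarrow> h x = h y \<longleftrightarrow> x = y"
  using less_iff by (metis less_irrefl linorder_neqE)

lemma DERIV_mem: "h \<in> G \<Longrightarrow> x \<in> C \<Longrightarrow> (h has_real_derivative deriv h x) (at x)"
  using diff DERIV_deriv_iff_real_differentiable by blast

lemma cont_mem: "h \<in> G \<Longrightarrow> x \<in> C \<Longrightarrow> isCont h x"
  using DERIV_mem DERIV_isCont by blast

text \<open>Near \<open>y1\<close> the invariant density stays within a factor \<open>2\<close> of \<open>w y1\<close>, so the iterates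
  of a group element have slope at least \<open>1/4\<close> there and cannot contract to \<open>y1\<close>.\<close>

lemma iterates_not_convergent_to_y1:
  assumes k: "k \<in> G" and y: "y \<in> C" and lim: "(\<lambda>n. (k ^^ n) y) \<longlonglongrightarrow> y1"
  shows "k y = y"
proof (rule ccontr)
  assume ne: "k y \<noteq> y"
  have "\<forall>\<^sub>F x in nhds y1. x \<in> C \<and> w y1 / 2 < w x \<and> w x < 2 * w y1"
  proof (intro eventually_conj)
    show "\<forall>\<^sub>F x in nhds y1. x \<in> C" using y1(1) open_C by (rule eventually_nhds_in_open[rotated])
    have "filterlim w (nhds (w y1)) (nhds y1)"
      using y1(2) by (simp add: isCont_def tendsto_at_iff_tendsto_nhds)
    note lims = order_tendstoD[OF this]
    show "\<forall>\<^sub>F x in nhds y1. w y1 / 2 < w x" by (rule lims(1)) (use w_pos[OF y1(1)] in simp)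
    show "\<forall>\<^sub>F x in nhds y1. w x < 2 * w y1" by (rule lims(2)) (use w_pos[OF y1(1)] in simp)
  qed
  then obtain d where d: "d > 0" "\<And>x. dist x y1 < d \<Longrightarrow> x \<in> C \<and> w y1 / 2 < w x \<and> w x < 2 * w y1"
    unfolding eventually_nhds_metric by blast
  obtain N where N: "\<And>n. n \<ge> N \<Longrightarrow> dist ((k ^^ n) y) y1 < d"
    using tendstoD[OF lim d(1)] unfolding eventually_sequentially by blast
  define z where "z = (k ^^ N) y"
  have iter: "(k ^^ n) z = (k ^^ (n + N)) y" "(k ^^ n) (k z) = (k ^^ (Suc n + N)) y" for n
    by (simp_all add: z_def funpow_add funpow_swap1)
  have zC: "z \<in> C" "k z \<in> C" using pow_maps maps k y by (auto simp: z_def)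
  have "(k ^^ N) (k y) \<noteq> (k ^^ N) y"
    using eq_iff'[OF pow_mem[OF k]] ne y maps k by blast
  then have kz: "k z \<noteq> z" by (simp add: z_def funpow_swap1)
  \<comment> \<open>\<open>l\<close> and \<open>u\<close> are consecutive iterates in increasing
    order. Both ends of their images tend to \<open>y1\<close>, while the mean value theorem keeps
    the gap at least a quarter of \<open>u - l\<close>.\<close>
  define l where "l = min z (k z)"
  define u where "u = max z (k z)"
  have lu: "l < u" "l \<in> C" "u \<in> C" using kz zC by (auto simp: l_def u_def min_def max_def)
  have dl: "dist ((k ^^ n) l) y1 < d" "dist ((k ^^ n) u) y1 < d" for n
    using N[of "n + N"] N[of "Suc n + N"] unfolding l_def u_def min_def max_def
    by (auto simp: iter)
  have est: "(u - l) / 4 \<le> (k ^^ n) u - (k ^^ n) l" for n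
  proof -
    have in_ball: "dist x y1 < d" if "l \<le> x" "x \<le> u" for x
      using dl[of 0] that by (auto simp: dist_real_def)
    have "\<exists>\<xi>. l < \<xi> \<and> \<xi> < u \<and> (k ^^ n) u - (k ^^ n) l = (u - l) * deriv (k ^^ n) \<xi>"
      using lu(1) in_ball d(2) DERIV_mem[OF pow_mem[OF k]] by (intro MVT2) auto
    then obtain \<xi> where x: "l < \<xi>" "\<xi> < u" "(k ^^ n) u - (k ^^ n) l = (u - l) * deriv (k ^^ n) \<xi>"
      by blast
    have xC: "\<xi> \<in> C" "w y1 / 2 < w \<xi>" using in_ball[of \<xi>] x d(2) by auto
    have "(k ^^ n) l < (k ^^ n) \<xi>" "(k ^^ n) \<xi> < (k ^^ n) u"
      using less_iff[OF pow_mem[OF k]] lu xC x by auto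
    then have "dist ((k ^^ n) \<xi>) y1 < d" using dl[of n] by (auto simp: dist_real_def)
    then have b: "w ((k ^^ n) \<xi>) < 2 * w y1" "w ((k ^^ n) \<xi>) > 0"
      using d(2) w_pos by blast+
    have inv: "w ((k ^^ n) \<xi>) * deriv (k ^^ n) \<xi> = w \<xi>"
      by (rule w_invariant[OF pow_mem[OF k] xC(1)])
    have "deriv (k ^^ n) \<xi> \<ge> 1 / 4"
    proof (rule ccontr)
      assume "\<not> ?thesis"
      then have "w ((k ^^ n) \<xi>) * deriv (k ^^ n) \<xi> \<le> w ((k ^^ n) \<xi>) * (1 / 4)"
        using b(2) by (intro mult_left_mono) auto
      then show False using inv b(1) xC(2) by linarith
    qed
    then have "(u - l) * (1 / 4) \<le> (u - l) * deriv (k ^^ n) \<xi>"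
      using lu(1) by (intro mult_left_mono) auto
    then show ?thesis using x(3) by simp
  qed
  have lims: "(\<lambda>n. (k ^^ (n + N)) y) \<longlonglongrightarrow> y1" "(\<lambda>n. (k ^^ (n + Suc N)) y) \<longlonglongrightarrow> y1"
    using lim by (rule LIMSEQ_ignore_initial_segment)+
  have "(\<lambda>n. \<bar>(k ^^ n) u - (k ^^ n) l\<bar>) \<longlonglongrightarrow> \<bar>y1 - y1\<bar>"
  proof (cases "z < k z")
    case True
    then show ?thesis using tendsto_rabs[OF tendsto_diff[OF lims(2,1)]]
      by (simp add: u_def l_def iter)
  next
    case False
    then show ?thesis using tendsto_rabs[OF tendsto_diff[OF lims]]
      by (simp add: u_def l_def iter)
  qed
  moreover have "\<exists>N. \<forall>n\<ge>N. (u - l) / 4 \<le> \<bar>(k ^^ n) u - (k ^^ n) l\<bar>"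
    using est by (meson abs_ge_self order_trans)
  ultimately have "(u - l) / 4 \<le> \<bar>y1 - y1\<bar>" by (rule LIMSEQ_le_const)
  then show False using lu(1) by simp
qed

text \<open>Conjugating \<open>h\<close> by an element that moves \<open>a\<close> to
  \<open>y1\<close> carries the orbit to one converging to \<open>y1\<close>.\<close>

lemma iterates_not_convergent:
  assumes h: "h \<in> G" and x: "x \<in> C" and a: "a \<in> C" and lim: "(\<lambda>n. (h ^^ n) x) \<longlonglongrightarrow> a"
  shows "h x = x"
proof -
  obtain c where c: "c \<in> G" "c a = y1" using transitive[OF a y1(1)] by blast
  obtain c' where c': "c' \<in> G" "\<And>x. x \<in> C \<Longrightarrow> c' (c x) = x \<and> c (c' x) = x"
    using inverse_ex[OF c(1)] by blast
  define k where "k = c \<circ> h \<circ> c'"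
  have k: "k \<in> G" unfolding k_def using c c' h comp_mem by blast
  have iter: "(k ^^ n) (c x) = c ((h ^^ n) x)" for n
    by (induction n) (use c'(2) pow_maps[OF h x] in \<open>auto simp: k_def\<close>)
  have "(\<lambda>n. c ((h ^^ n) x)) \<longlonglongrightarrow> c a"
    by (rule isCont_tendsto_compose[OF cont_mem[OF c(1) a] lim])
  then have "(\<lambda>n. (k ^^ n) (c x)) \<longlonglongrightarrow> y1" by (simp add: iter c)
  then have "k (c x) = c x" by (rule iterates_not_convergent_to_y1[OF k maps[OF c(1) x]])
  then have "c (h x) = c x" using c'(2)[OF x] by (simp add: k_def)
  then show ?thesis using eq_iff'[OF c(1) maps[OF h x] x] by simp
qed

lemma between_mem: "x \<in> C \<Longrightarrow> y \<in> C \<Longrightarrow> x \<le> z \<Longrightarrow> z \<le> y \<Longrightarrow> z \<in> C"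
  using connected_contains_Icc[OF connected_C] by fastforce

text \<open>This is the Archimedean property: increasing iterates bounded by \<open>b\<close> would
  converge to a point of the interval \<open>C\<close>.\<close>

lemma iterates_unbounded_above:
  assumes h: "h \<in> G" and x: "x \<in> C" "x < h x" and b: "b \<in> C"
  shows "\<exists>n. b < (h ^^ n) x"
proof (rule ccontr)
  assume "\<not> ?thesis"
  then have le: "(h ^^ n) x \<le> b" for n by (simp add: not_less)
  have step: "(h ^^ n) x < (h ^^ Suc n) x" for n
  proof (induction n)
    case (Suc n)
    show ?case using strict_increasing[OF h pow_maps[OF h x(1)] pow_maps[OF h x(1)] Suc] by simp
  qed (simp add: x)
  have inc: "incseq (\<lambda>n. (h ^^ n) x)" using step by (auto intro!: incseq_SucI less_imp_le)
  obtain a where a: "(\<lambda>n. (h ^^ n) x) \<longlonglongrightarrow> a" "\<forall>n. (h ^^ n) x \<le> a"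
    using incseq_convergent[OF inc] le by metis
  have "a \<le> b" using a(1) le by (intro LIMSEQ_le_const2) auto
  moreover have "x \<le> a" using a(2)[rule_format, of 0] by simp
  ultimately have "a \<in> C" using between_mem[OF x(1) b] by blast
  then show False using iterates_not_convergent[OF h x(1) _ a(1)] x(2) by simp
qed

lemma iterates_unbounded_below:
  assumes h: "h \<in> G" and x: "x \<in> C" "h x < x" and b: "b \<in> C"
  shows "\<exists>n. (h ^^ n) x < b"
proof (rule ccontr)
  assume "\<not> ?thesis"
  then have le: "b \<le> (h ^^ n) x" for n by (simp add: not_less)
  have step: "(h ^^ Suc n) x < (h ^^ n) x" for n
  proof (induction n)
    case (Suc n)
    show ?case using strict_increasing[OF h pow_maps[OF h x(1)] pow_maps[OF h x(1)] Suc] by simp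
  qed (simp add: x)
  have dec: "decseq (\<lambda>n. (h ^^ n) x)" using step by (auto intro!: decseq_SucI less_imp_le)
  obtain a where a: "(\<lambda>n. (h ^^ n) x) \<longlonglongrightarrow> a" "\<forall>n. a \<le> (h ^^ n) x"
    using decseq_convergent[OF dec] le by metis
  have "b \<le> a" using a(1) le by (intro LIMSEQ_le_const) auto
  moreover have "a \<le> x" using a(2)[rule_format, of 0] by simp
  ultimately have "a \<in> C" using between_mem[OF b x(1)] by blast
  then show False using iterates_not_convergent[OF h x(1) _ a(1)] x(2) by simp
qed

text \<open>The iterates of a moved point, under the element or its inverse, go towards
  \<open>z\<close>; being unbounded in \<open>C\<close> they must pass \<open>z\<close>, but powers
  preserve order and fix \<open>z\<close>.\<close>

lemma fixes_some_imp_fixes_all: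
  assumes h: "h \<in> G" and z: "z \<in> C" "h z = z" and y: "y \<in> C"
  shows "h y = y"
proof -
  have fixpow: "(k ^^ n) z = z" if "k z = z" for n and k :: "real \<Rightarrow> real"
    using that by (induction n) auto
  have no_up: "\<not> y < k y" if "k \<in> G" "k z = z" "y < z" for k
  proof
    assume "y < k y"
    from iterates_unbounded_above[OF that(1) y this z(1)] obtain n where "z < (k ^^ n) y" by blast
    moreover have "(k ^^ n) y < (k ^^ n) z"
      using strict_increasing[OF pow_mem[OF that(1)] y z(1) that(3)] .
    ultimately show False using fixpow[where k = k and n = n] that(2) by simp
  qed
  have no_down: "\<not> k y < y" if "k \<in> G" "k z = z" "z < y" for k
  proof
    assume "k y < y"
    from iterates_unbounded_below[OF that(1) y this z(1)] obtain n where "(k ^^ n) y < z" by blast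
    moreover have "(k ^^ n) z < (k ^^ n) y"
      using strict_increasing[OF pow_mem[OF that(1)] z(1) y that(3)] .
    ultimately show False using fixpow[where k = k and n = n] that(2) by simp
  qed
  obtain k where k: "k \<in> G" "\<And>x. x \<in> C \<Longrightarrow> k (h x) = x \<and> h (k x) = x"
    using inverse_ex[OF h] by blast
  have kz: "k z = z" using k(2)[OF z(1)] z(2) by simp
  have ky: "k y < y \<longleftrightarrow> y < h y" "y < k y \<longleftrightarrow> h y < y"
    using less_iff[OF h maps[OF k(1) y] y] less_iff[OF h y maps[OF k(1) y]] k(2)[OF y] by auto
  show ?thesis
    using no_up[OF h z(2)] no_up[OF k(1) kz] no_down[OF h z(2)] no_down[OF k(1) kz] ky z(2)
    by (metis linorder_neqE)
qed

text \<open>Otherwise \<open>h\<close> and \<open>k\<close> agree somewhere by intermediate values,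
  and the inverse of \<open>k\<close> after \<open>h\<close> fixes that point, hence every point. So
  comparison at any one point orders the group totally.\<close>

lemma less_somewhere_imp_everywhere:
  assumes h: "h \<in> G" and k: "k \<in> G" and x: "x \<in> C" "h x < k x" and y: "y \<in> C"
  shows "h y < k y"
proof (rule ccontr)
  assume "\<not> ?thesis"
  then have ge: "0 \<le> h y - k y" by simp
  have "connected ((\<lambda>z. h z - k z) ` C)"
    by (intro connected_continuous_image connected_C continuous_at_imp_continuous_on ballI
        continuous_diff cont_mem h k)
  then have "{h x - k x..h y - k y} \<subseteq> (\<lambda>z. h z - k z) ` C"
    by (rule connected_contains_Icc) (use x y in auto)
  then have "0 \<in> (\<lambda>z. h z - k z) ` C" using ge x(2) by auto
  then obtain z where z: "z \<in> C" "h z = k z" by auto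
  obtain k' where k': "k' \<in> G" "\<And>x. x \<in> C \<Longrightarrow> k' (k x) = x \<and> k (k' x) = x"
    using inverse_ex[OF k] by blast
  have "(k' \<circ> h) x = x"
    by (rule fixes_some_imp_fixes_all[OF comp_mem[OF k'(1) h] z(1) _ x(1)]) (simp add: z k')
  then have "k x = h x" using k'(2)[OF maps[OF h x(1)]] by simp
  then show False using x(2) by simp
qed

lemma le_somewhere_imp_everywhere:
  "h \<in> G \<Longrightarrow> k \<in> G \<Longrightarrow> x \<in> C \<Longrightarrow> h x \<le> k x \<Longrightarrow> y \<in> C \<Longrightarrow> h y \<le> k y"
  using less_somewhere_imp_everywhere[of k h y x] by (meson not_less)

text \<open>Hoelder: an Archimedean, densely ordered group is abelian.  If \<open>a b\<close> exceeded
  \<open>b a\<close>, some \<open>d > 1\<close> would satisfy \<open>d^2 b a \<le> a b\<close>; enclosing \<open>a\<close> and \<open>b\<close> between consecutive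
  powers of \<open>d\<close> contradicts this.\<close>

lemma positive_commute_le:
  assumes a: "a \<in> G" and b: "b \<in> G" and x: "x \<in> C" and pos: "x \<le> a x" "x \<le> b x"
  shows "a (b x) \<le> b (a x)"
proof (rule ccontr)
  assume "\<not> ?thesis"
  then have lt: "b (a x) < a (b x)" by simp
  define u where "u = b (a x)"
  define v where "v = a (b x)"
  have uv: "u \<in> C" "v \<in> C" "u < v" using a b x maps lt by (auto simp: u_def v_def)
  define m where "m = (u + v) / 2"
  have m: "u < m" "m < v" "m \<in> C" using uv between_mem[of u v m] by (auto simp: m_def)
  \<comment> \<open>One element takes \<open>u\<close> to the midpoint \<open>m\<close>, another
    takes \<open>m\<close> to \<open>v\<close>; the smaller of the two, applied twice, does not
    overshoot \<open>v\<close>.\<close>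
  obtain d where d: "d \<in> G" "u < d u" "d (d u) \<le> v"
  proof -
    obtain d1 where d1: "d1 \<in> G" "d1 u = m" using transitive[OF uv(1) m(3)] by blast
    obtain d2 where d2: "d2 \<in> G" "d2 m = v" using transitive[OF m(3) uv(2)] by blast
    show ?thesis
    proof (cases "d1 m \<le> v")
      case True
      then show ?thesis using that[of d1] d1 m by simp
    next
      case False
      then have "d2 u < d1 u" using less_somewhere_imp_everywhere[OF d2(1) d1(1) m(3) _ uv(1)] d2 by simp
      then have "d2 (d2 u) \<le> v" using less_iff[OF d2(1) maps[OF d2(1) uv(1)] m(3)] d1 d2 by auto
      moreover have "u < d2 u"
        using less_somewhere_imp_everywhere[OF id_mem d2(1) m(3) _ uv(1)] d2 m by simp
      ultimately show ?thesis using that[of d2] d2 by blast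
    qed
  qed
  have enclose: "\<exists>n. \<forall>y\<in>C. (d ^^ n) y \<le> c y \<and> c y < (d ^^ Suc n) y" if c: "c \<in> G" "x \<le> c x" for c
  proof -
    have "x < d x" using less_somewhere_imp_everywhere[OF id_mem d(1) uv(1) _ x] d by simp
    then have ex: "\<exists>n. c x < (d ^^ n) x"
      using iterates_unbounded_above[OF d(1) x _ maps[OF c(1) x]] by blast
    define N where "N = (LEAST n. c x < (d ^^ n) x)"
    have N: "c x < (d ^^ N) x" unfolding N_def using ex by (rule LeastI_ex)
    then have "N \<noteq> 0" using c(2) by (intro notI) auto
    then obtain n where n: "N = Suc n" by (cases N) auto
    have "\<not> c x < (d ^^ n) x" using not_less_Least[of n "\<lambda>n. c x < (d ^^ n) x"] n by (simp add: N_def)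
    then have "(d ^^ n) x \<le> c x" by simp
    then have "(d ^^ n) y \<le> c y \<and> c y < (d ^^ Suc n) y" if "y \<in> C" for y
      using le_somewhere_imp_everywhere[OF pow_mem[OF d(1)] c(1) x _ that]
        less_somewhere_imp_everywhere[OF c(1) pow_mem[OF d(1)] x _ that] N n by blast
    then show ?thesis by blast
  qed
  obtain i where i: "\<And>y. y \<in> C \<Longrightarrow> (d ^^ i) y \<le> a y \<and> a y < (d ^^ Suc i) y"
    using enclose[OF a pos(1)] by blast
  obtain j where j: "\<And>y. y \<in> C \<Longrightarrow> (d ^^ j) y \<le> b y \<and> b y < (d ^^ Suc j) y"
    using enclose[OF b pos(2)] by blast
  have le_pow: "(d ^^ n) y \<le> (d ^^ n) z" if "y \<in> C" "z \<in> C" "y \<le> z" for n y z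
    using le_iff[OF pow_mem[OF d(1)] that(1,2)] that(3) by blast
  \<comment> \<open>\<open>a b\<close> lies below \<open>d^(i+1) d^(j+1)\<close>, which as a power
    of \<open>d\<close> can be reordered to \<open>d^2 d^j d^i\<close> and so is at most
    \<open>d^2 b a\<close>.\<close>
  have "v < (d ^^ Suc i) (b x)" using i[OF maps[OF b x]] unfolding v_def by blast
  also have "\<dots> < (d ^^ Suc i) ((d ^^ Suc j) x)"
    using strict_increasing[OF pow_mem[OF d(1)] maps[OF b x] pow_maps[OF d(1) x]] j[OF x] by blast
  also have "\<dots> = d (d ((d ^^ j) ((d ^^ i) x)))"
  proof -
    have "(d ^^ Suc i) ((d ^^ Suc j) x) = (d ^^ (Suc i + Suc j)) x"
      unfolding funpow_add by simp
    also have "Suc i + Suc j = 1 + (1 + (j + i))" by simp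
    also have "(d ^^ (1 + (1 + (j + i)))) x = d (d ((d ^^ j) ((d ^^ i) x)))"
      unfolding funpow_add by simp
    finally show ?thesis .
  qed
  also have "\<dots> \<le> d (d ((d ^^ j) (a x)))"
    using i[OF x] le_pow[of "(d ^^ i) x" "a x" "Suc (Suc j)"] pow_maps[OF d(1) x] maps[OF a x] by simp
  also have "\<dots> \<le> d (d u)"
    using j[OF maps[OF a x]] le_pow[of "(d ^^ j) (a x)" "b (a x)" "Suc (Suc 0)"]
      pow_maps[OF d(1) maps[OF a x]] maps[OF b maps[OF a x]] by (simp add: u_def)
  also have "\<dots> \<le> v" by (rule d)
  finally show False by simp
qed

lemma commute_inverse:
  assumes "h \<in> G" "h' \<in> G" "k \<in> G" and inv: "\<And>x. x \<in> C \<Longrightarrow> h' (h x) = x \<and> h (h' x) = x"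
    and comm: "\<And>x. x \<in> C \<Longrightarrow> h' (k x) = k (h' x)" and x: "x \<in> C"
  shows "h (k x) = k (h x)"
proof -
  have "h (k x) = h (k (h' (h x)))" using inv[OF x] by simp
  also have "\<dots> = h (h' (k (h x)))" using comm[OF maps[OF assms(1) x]] by simp
  also have "\<dots> = k (h x)" using inv[OF maps[OF assms(3) maps[OF assms(1) x]]] by simp
  finally show ?thesis .
qed

text \<open>\<open>positive_commute_le\<close> with the roles exchanged settles elements that move
  \<open>x\<close> up; the others are replaced by their inverses, one factor at a time.\<close>

lemma commute:
  assumes h: "h \<in> G" and k: "k \<in> G" and x: "x \<in> C"
  shows "h (k x) = k (h x)"
proof -
  have pos: "a (b y) = b (a y)"
    if "a \<in> G" "b \<in> G" "x \<le> a x" "x \<le> b x" "y \<in> C" for a b y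
  proof -
    have "y \<le> a y" "y \<le> b y"
      using le_somewhere_imp_everywhere[OF id_mem that(1) x _ that(5)]
        le_somewhere_imp_everywhere[OF id_mem that(2) x _ that(5)] that by auto
    then show ?thesis using positive_commute_le that by (metis antisym)
  qed
  have inv: "\<exists>k\<in>G. (\<forall>x\<in>C. k (h x) = x \<and> h (k x) = x) \<and> x \<le> k x" if h: "h \<in> G" "\<not> x \<le> h x" for h
  proof -
    obtain k where k: "k \<in> G" "\<forall>x\<in>C. k (h x) = x \<and> h (k x) = x" using inverse_ex[OF h(1)] by blast
    have "h (k x) = x" using k x by blast
    then have "x \<le> k x" using le_iff[OF h(1) x maps[OF k(1) x]] h(2) by auto
    then show ?thesis using k by blast
  qed
  have half: "a (b y) = b (a y)" if ab: "a \<in> G" "b \<in> G" "x \<le> a x" "y \<in> C" for a b y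
  proof (cases "x \<le> b x")
    case False
    then obtain b' where b': "b' \<in> G" "\<forall>x\<in>C. b' (b x) = x \<and> b (b' x) = x" "x \<le> b' x"
      using inv[OF ab(2)] by blast
    show ?thesis
      using commute_inverse[OF ab(2) b'(1) ab(1), of y] b' pos[OF b'(1) ab(1) b'(3) ab(3)] ab(4)
      by metis
  qed (use pos ab in blast)
  show ?thesis
  proof (cases "x \<le> h x")
    case False
    then obtain h' where h': "h' \<in> G" "\<forall>x\<in>C. h' (h x) = x \<and> h (h' x) = x" "x \<le> h' x"
      using inv[OF h] by blast
    show ?thesis
      using commute_inverse[OF h h'(1) k, of x] h' half[OF h'(1) k h'(3)] x by metis
  qed (use half h k x in blast)
qed

end

subsection \<open>The invariant density of the group\<close>

context group_family
begin

lemma ex_identity: "\<exists>e\<in>\<Theta>0. \<forall>x\<in>D. H e x = x"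
proof -
  have "\<one>\<^bsub>BijGroup D\<^esub> \<in> (\<lambda>\<theta>. restrict (H \<theta>) D) ` \<Theta>0"
    by (rule subgroup.one_closed[OF transformation_group])
  then obtain e where "e \<in> \<Theta>0" "restrict (H e) D = (\<lambda>x\<in>D. x)" by (auto simp: BijGroup_def)
  then show ?thesis by (metis restrict_apply')
qed

lemma D_eq_S: "D = S"
proof -
  obtain e where e: "e \<in> \<Theta>0" "\<forall>x\<in>D. H e x = x" using ex_identity by blast
  then have "H e ` D = D" by force
  then show ?thesis using bij[OF e(1)] by (simp add: bij_betw_def)
qed

lemma restrict_mult:
  assumes "a \<in> \<Theta>0" "b \<in> \<Theta>0"
  shows "restrict (H a) D \<otimes>\<^bsub>BijGroup D\<^esub> restrict (H b) D = (\<lambda>x\<in>D. H a (H b x))"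
proof -
  have "restrict (H c) D \<in> Bij D" if "c \<in> \<Theta>0" for c
    using subgroup.mem_carrier[OF transformation_group, of "restrict (H c) D"] that by (simp add: BijGroup_def)
  moreover have "H b x \<in> D" if "x \<in> D" for x
    using bij[OF assms(2)] that D_eq_S by (auto simp: bij_betw_def)
  ultimately show ?thesis using assms by (auto simp: BijGroup_def compose_def fun_eq_iff)
qed

lemma composition_closed:
  assumes "a \<in> \<Theta>0" "b \<in> \<Theta>0"
  shows "\<exists>c\<in>\<Theta>0. \<forall>x\<in>S. H c x = H a (H b x)"
proof -
  have "restrict (H a) D \<otimes>\<^bsub>BijGroup D\<^esub> restrict (H b) D \<in> (\<lambda>\<theta>. restrict (H \<theta>) D) ` \<Theta>0"
    by (rule subgroup.m_closed[OF transformation_group]) (use assms in auto)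
  then obtain c where "c \<in> \<Theta>0" "(\<lambda>x\<in>D. H a (H b x)) = restrict (H c) D"
    using restrict_mult[OF assms] by auto
  then show ?thesis using D_eq_S by (metis restrict_apply')
qed

lemma inverse_closed:
  assumes "a \<in> \<Theta>0"
  shows "\<exists>b\<in>\<Theta>0. \<forall>x\<in>S. H b (H a x) = x \<and> H a (H b x) = x"
proof -
  interpret B: group "BijGroup D" by (rule group_BijGroup)
  let ?r = "restrict (H a) D"
  have carr: "?r \<in> carrier (BijGroup D)"
    by (rule subgroup.mem_carrier[OF transformation_group]) (use assms in auto)
  have "inv\<^bsub>BijGroup D\<^esub> ?r \<in> (\<lambda>\<theta>. restrict (H \<theta>) D) ` \<Theta>0"
    by (rule subgroup.m_inv_closed[OF transformation_group]) (use assms in auto)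
  then obtain b where b: "b \<in> \<Theta>0" "inv\<^bsub>BijGroup D\<^esub> ?r = restrict (H b) D" by auto
  have "(\<lambda>x\<in>D. H b (H a x)) = (\<lambda>x\<in>D. x)" "(\<lambda>x\<in>D. H a (H b x)) = (\<lambda>x\<in>D. x)"
    using B.l_inv[OF carr] B.r_inv[OF carr]
    unfolding b(2) restrict_mult[OF b(1) assms] restrict_mult[OF assms b(1)] by (simp_all add: BijGroup_def)
  then show ?thesis using b(1) D_eq_S by (metis restrict_apply')
qed

text \<open>All functions that agree on \<open>S\<close> with a member, not just the members: values
  outside \<open>S\<close> are arbitrary, and this makes the set closed under plain composition and
  iteration.\<close>

definition maps :: "(real \<Rightarrow> real) set" where
  "maps = {h. \<exists>\<theta>\<in>\<Theta>0. \<forall>x\<in>S. h x = H \<theta> x}"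

lemma H_mem: "\<theta> \<in> \<Theta>0 \<Longrightarrow> H \<theta> \<in> maps"
  by (auto simp: maps_def)

lemma maps_into: "h \<in> maps \<Longrightarrow> x \<in> S \<Longrightarrow> h x \<in> S"
  using bij D_eq_S by (fastforce simp: maps_def bij_betw_def)

lemma id_mem: "id \<in> maps"
  using ex_identity by (auto simp: maps_def D_eq_S) metis

lemma comp_mem:
  assumes "h \<in> maps" "k \<in> maps" shows "h \<circ> k \<in> maps"
proof -
  obtain a b where ab: "a \<in> \<Theta>0" "b \<in> \<Theta>0" "\<And>x. x \<in> S \<Longrightarrow> h x = H a x" "\<And>x. x \<in> S \<Longrightarrow> k x = H b x"
    using assms by (auto simp: maps_def)
  obtain c where "c \<in> \<Theta>0" "\<And>x. x \<in> S \<Longrightarrow> H c x = H a (H b x)" using composition_closed ab by blast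
  then have "\<forall>x\<in>S. (h \<circ> k) x = H c x" "c \<in> \<Theta>0"
    using ab maps_into[OF assms(2)] maps_into[OF H_mem[OF ab(2)]] by auto
  then show ?thesis unfolding maps_def by blast
qed

lemma inverse_ex:
  assumes "h \<in> maps" shows "\<exists>k\<in>maps. \<forall>x\<in>S. k (h x) = x \<and> h (k x) = x"
proof -
  obtain a where a: "a \<in> \<Theta>0" "\<And>x. x \<in> S \<Longrightarrow> h x = H a x"
    using assms by (auto simp: maps_def)
  obtain b where b: "b \<in> \<Theta>0" "\<And>x. x \<in> S \<Longrightarrow> H b (H a x) = x \<and> H a (H b x) = x"
    using inverse_closed a by blast
  show ?thesis
    using a b maps_into[OF H_mem[OF b(1)]] by (intro bexI[of _ "H b"] H_mem) auto
qed

lemma strict_increasing: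
  assumes "h \<in> maps" "x \<in> S" "y \<in> S" "x < y" shows "h x < h y"
proof -
  obtain a where a: "a \<in> \<Theta>0" "\<And>x. x \<in> S \<Longrightarrow> h x = H a x"
    using assms by (auto simp: maps_def)
  have "h x \<le> h y" using mono_onD[OF increasing[OF a(1)], of x y] assms a(2) D_eq_S by auto
  moreover have "h x \<noteq> h y"
    using bij[OF a(1)] assms a(2) D_eq_S by (auto simp: bij_betw_def inj_on_def)
  ultimately show ?thesis by simp
qed

lemma DERIV_H: "\<theta> \<in> \<Theta>0 \<Longrightarrow> x \<in> S \<Longrightarrow> (H \<theta> has_real_derivative deriv (H \<theta>) x) (at x)"
  using differentiable[of \<theta> x] D_eq_S DERIV_deriv_iff_real_differentiable by blast

lemma eventually_in_S: "x \<in> S \<Longrightarrow> \<forall>\<^sub>F y in nhds x. y \<in> S"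
  using open_support by (rule eventually_nhds_in_open)

lemma DERIV_maps:
  assumes "h \<in> maps" "x \<in> S" shows "(h has_real_derivative deriv h x) (at x)"
proof -
  obtain a where a: "a \<in> \<Theta>0" "\<And>x. x \<in> S \<Longrightarrow> h x = H a x"
    using assms by (auto simp: maps_def)
  have "(h has_real_derivative deriv (H a) x) (at x)"
    using DERIV_H[OF a(1) assms(2)] eventually_in_S[OF assms(2)] a(2)
    by (subst DERIV_cong_ev[OF refl _ refl, where g = "H a"]) (auto elim: eventually_mono)
  then show ?thesis using DERIV_imp_deriv by metis
qed

lemma deriv_cong_maps:
  assumes "k \<in> maps" "x \<in> S" "\<And>y. y \<in> S \<Longrightarrow> h y = k y" shows "deriv h x = deriv k x"
  by (rule deriv_cong_ev) (use assms eventually_in_S[OF assms(2)] in \<open>auto elim: eventually_mono\<close>)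

lemma deriv_comp:
  assumes "h \<in> maps" "k \<in> maps" "x \<in> S"
  shows "deriv (h \<circ> k) x = deriv h (k x) * deriv k x"
  by (rule DERIV_imp_deriv, rule DERIV_chain) (use assms DERIV_maps maps_into in auto)

lemma deriv_inverse:
  assumes "h \<in> maps" "k \<in> maps" "\<And>x. x \<in> S \<Longrightarrow> k (h x) = x" "x \<in> S"
  shows "deriv k (h x) * deriv h x = 1"
proof -
  have "deriv (k \<circ> h) x = deriv id x"
    by (rule deriv_cong_maps) (use id_mem assms in auto)
  then show ?thesis using deriv_comp[OF assms(2,1,4)] by simp
qed

text \<open>Monotonicity gives a nonnegative slope, and the chain rule with the differentiable
  inverse excludes zero.\<close>

lemma deriv_pos:
  assumes "h \<in> maps" "x \<in> S" shows "deriv h x > 0"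
proof -
  have "mono_on S h"
    using strict_increasing[OF assms(1)] by (auto simp: mono_on_def le_less)
  then have "deriv h x \<ge> 0"
    by (rule mono_on_imp_deriv_nonneg[OF _ DERIV_maps[OF assms]])
      (use assms open_support in \<open>auto simp: interior_open\<close>)
  moreover obtain k where "k \<in> maps" "\<And>x. x \<in> S \<Longrightarrow> k (h x) = x" using inverse_ex[OF assms(1)] by blast
  then have "deriv h x \<noteq> 0" using deriv_inverse[OF assms(1) _ _ assms(2)] by force
  ultimately show ?thesis by simp
qed

lemma pow_mem: "h \<in> maps \<Longrightarrow> h ^^ n \<in> maps"
  by (induction n) (auto simp: id_mem comp_mem)

lemma DERIV_param:
  assumes "\<theta> \<in> \<Theta>0" "x \<in> S"
  shows "((\<lambda>t. H t x) has_real_derivative T \<theta> * U1 (H \<theta> x)) (at \<theta>)"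
  using param_differentiable[OF assms(1), of x] param_deriv[OF assms(1), of x] assms(2) D_eq_S
    DERIV_deriv_iff_real_differentiable by metis

lemma DERIV_param_deriv:
  assumes "\<theta> \<in> \<Theta>0" "x \<in> S"
  shows "((\<lambda>t. deriv (H t) x) has_real_derivative T \<theta> * U2 (H \<theta> x) * deriv (H \<theta>) x) (at \<theta>)"
proof -
  have "deriv (\<lambda>t. deriv (H t) x) \<theta> = T \<theta> * U2 (H \<theta> x) * deriv (H \<theta>) x"
    using param_deriv_deriv[OF assms(1), of x] assms(2) D_eq_S deriv_pos[OF H_mem[OF assms(1)] assms(2)]
    by (simp add: field_simps)
  then show ?thesis
    using param_differentiable_deriv[OF assms(1), of x] assms(2) D_eq_S
      DERIV_deriv_iff_real_differentiable by metis
qed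

end

section \<open>The likelihood of a single observation and the invariant density\<close>

locale regular_family = group_family +
  fixes f :: "real \<Rightarrow> real"
  assumes f_density: "density_with_support S f"
    and f_C1: "f C1_differentiable_on S"
    and f_identifiable: "identifiable \<Theta>0 D H f"
    and mle_1: "\<exists>est. is_mle \<Theta>0 D H 1 f est"
    and score_inj: "inj_on (score U1 U2 f) S"
begin

lemma f_pos: "x \<in> S \<Longrightarrow> 0 < f x"
  using f_density by (auto simp: density_with_support_def)

lemma S_nonempty: "S \<noteq> {}"
  using f_density by (auto simp: density_with_support_def)

lemma DERIV_f: "x \<in> S \<Longrightarrow> (f has_real_derivative deriv f x) (at x)"
  using f_C1 unfolding C1_differentiable_on_def DERIV_deriv_iff_real_differentiable
  by (auto simp: has_vector_derivative_def intro: differentiableI)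

definition likelihood :: "(real \<Rightarrow> real) \<Rightarrow> real \<Rightarrow> real" where
  "likelihood h x = deriv h x * f (h x)"

lemma family_density_eq: "\<theta> \<in> \<Theta>0 \<Longrightarrow> x \<in> S \<Longrightarrow> family_density D H f \<theta> x = likelihood (H \<theta>) x"
  by (simp add: family_density_def likelihood_def D_eq_S)

lemma ex_max_likelihood:
  assumes "x \<in> S"
  shows "\<exists>h\<in>maps. \<forall>k\<in>maps. likelihood k x \<le> likelihood h x"
proof -
  obtain est where est: "is_mle \<Theta>0 D H 1 f est" using mle_1 by blast
  define y where "y = (\<lambda>i\<in>{..<1::nat}. x)"
  have y: "y \<in> {..<1} \<rightarrow>\<^sub>E D" using assms D_eq_S by (auto simp: y_def)
  have "y \<in> space (Pi\<^sub>M {..<1} (\<lambda>_. restrict_space borel D))"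
    using y by (simp add: space_PiM space_restrict_space)
  then have e: "est y \<in> \<Theta>0"
    using est measurable_space[of est] by (fastforce simp: is_mle_def space_restrict_space)
  have le: "likelihood (H \<theta>) x \<le> likelihood (H (est y)) x" if "\<theta> \<in> \<Theta>0" for \<theta>
    using est y that e assms family_density_eq unfolding is_mle_def by (fastforce simp: y_def)
  have "likelihood k x \<le> likelihood (H (est y)) x" if "k \<in> maps" for k
  proof -
    obtain \<theta> where t: "\<theta> \<in> \<Theta>0" "\<And>x. x \<in> S \<Longrightarrow> k x = H \<theta> x" using \<open>k \<in> maps\<close> by (auto simp: maps_def)
    have "likelihood k x = likelihood (H \<theta>) x"
      using deriv_cong_maps[OF H_mem[OF t(1)] assms t(2)] t(2)[OF assms] by (simp add: likelihood_def)
    then show ?thesis using le[OF t(1)] by simp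
  qed
  then show ?thesis using H_mem[OF e] by blast
qed

text \<open>If \<open>T\<close> vanished throughout, \<open>H t\<close> would not depend on
  \<open>t\<close> near the identity parameter \<open>e\<close>, and two distinct parameters would
  share a density.\<close>

lemma ex_T_nonzero: "\<exists>t\<in>\<Theta>0. T t \<noteq> 0"
proof (rule ccontr)
  assume "\<not> ?thesis"
  then have T0: "\<And>t. t \<in> \<Theta>0 \<Longrightarrow> T t = 0" by blast
  obtain e where e: "e \<in> \<Theta>0" using ex_identity by blast
  obtain d where d: "d > 0" "ball e d \<subseteq> \<Theta>0" using open_params e open_contains_ball by blast
  have const: "H t x = H e x" if "t \<in> ball e d" "x \<in> S" for t x
  proof (rule has_field_derivative_zero_constant[of "ball e d" "\<lambda>t. H t x", THEN exE])
    show "((\<lambda>t. H t x) has_real_derivative 0) (at t within ball e d)" if "t \<in> ball e d" for t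
    proof -
      have "t \<in> \<Theta>0" using that d(2) by auto
      then show ?thesis
        using DERIV_param[of t x] T0[of t] \<open>x \<in> S\<close> by (auto intro: has_field_derivative_at_within)
    qed
  next
    fix c assume "\<forall>t\<in>ball e d. H t x = c"
    then show ?thesis using that d(1) by auto
  qed auto
  define t where "t = e + d / 2"
  have t: "t \<in> ball e d" "t \<noteq> e" using d(1) by (auto simp: t_def dist_real_def)
  then have tT: "t \<in> \<Theta>0" using d by auto
  have "family_density D H f t x = family_density D H f e x" for x
    using const[OF t(1)] deriv_cong_maps[OF H_mem[OF e], of x "H t"] D_eq_S
    by (auto simp: family_density_def)
  then have "family_density D H f t = family_density D H f e" by (simp add: fun_eq_iff)
  then show False
    using f_identifiable e tT t(2) by (auto simp: identifiable_def inj_on_def)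
qed

definition t0 :: real where "t0 = (SOME t. t \<in> \<Theta>0 \<and> T t \<noteq> 0)"

lemma t0: "t0 \<in> \<Theta>0" "T t0 \<noteq> 0"
  using someI_ex[of "\<lambda>t. t \<in> \<Theta>0 \<and> T t \<noteq> 0"] ex_T_nonzero unfolding t0_def by blast+

definition base_inverse :: "real \<Rightarrow> real" where
  "base_inverse = (SOME k. k \<in> maps \<and> (\<forall>x\<in>S. k (H t0 x) = x \<and> H t0 (k x) = x))"

lemma base_inverse: "base_inverse \<in> maps" "x \<in> S \<Longrightarrow> H t0 (base_inverse x) = x"
  using someI_ex[of "\<lambda>k. k \<in> maps \<and> (\<forall>x\<in>S. k (H t0 x) = x \<and> H t0 (k x) = x)"]
    inverse_ex[OF H_mem[OF t0(1)]] unfolding base_inverse_def by blast+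

text \<open>The family recentred at \<open>t0\<close>: a curve through the identity on
  \<open>S\<close> with velocity \<open>T t0 * U1 x\<close>. The parameter of the identity itself
  would not do, since \<open>T\<close> might vanish there.\<close>

definition K :: "real \<Rightarrow> real \<Rightarrow> real" where "K t = H t \<circ> base_inverse"

lemma K_mem: "t \<in> \<Theta>0 \<Longrightarrow> K t \<in> maps"
  unfolding K_def using comp_mem H_mem base_inverse by blast

lemma K_t0: "x \<in> S \<Longrightarrow> K t0 x = x"
  using base_inverse by (simp add: K_def)

lemma DERIV_K:
  assumes "t \<in> \<Theta>0" "x \<in> S"
  shows "((\<lambda>t. K t x) has_real_derivative T t * U1 (K t x)) (at t)"
  using DERIV_param[OF assms(1) maps_into[OF base_inverse(1) assms(2)]] by (simp add: K_def)

lemma DERIV_K_t0: "x \<in> S \<Longrightarrow> ((\<lambda>t. K t x) has_real_derivative T t0 * U1 x) (at t0)"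
  using DERIV_K[OF t0(1), of x] K_t0 by simp

lemma eventually_params: "\<forall>\<^sub>F t in nhds t0. t \<in> \<Theta>0"
  using open_params t0(1) by (rule eventually_nhds_in_open)

lemma cont_K: "x \<in> S \<Longrightarrow> \<forall>\<^sub>F t in nhds t0. isCont (\<lambda>t. K t x) t"
  using eventually_params by eventually_elim (use DERIV_K DERIV_isCont in blast)

lemma deriv_K_t0: "x \<in> S \<Longrightarrow> deriv (K t0) x = 1"
  using deriv_cong_maps[OF id_mem, of x "K t0"] K_t0 by simp

lemma DERIV_deriv_K:
  assumes "x \<in> S"
  shows "((\<lambda>t. deriv (K t) x) has_real_derivative T t0 * U2 x) (at t0)"
proof -
  let ?z = "base_inverse x"
  have z: "?z \<in> S" using maps_into[OF base_inverse(1) assms] .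
  have eq: "deriv (K t) x = deriv (H t) ?z * deriv base_inverse x" if "t \<in> \<Theta>0" for t
    unfolding K_def by (rule deriv_comp[OF H_mem[OF that] base_inverse(1) assms])
  have "((\<lambda>t. deriv (H t) ?z * deriv base_inverse x) has_real_derivative
      T t0 * U2 (H t0 ?z) * deriv (H t0) ?z * deriv base_inverse x) (at t0)"
    by (rule DERIV_cmult_right[OF DERIV_param_deriv[OF t0(1) z]])
  moreover have "T t0 * U2 (H t0 ?z) * deriv (H t0) ?z * deriv base_inverse x = T t0 * U2 x"
    using eq[OF t0(1)] deriv_K_t0[OF assms] base_inverse(2)[OF assms] by simp
  ultimately have "((\<lambda>t. deriv (H t) ?z * deriv base_inverse x) has_real_derivative T t0 * U2 x) (at t0)"
    by simp
  then show ?thesis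
    using eventually_params eq
    by (subst DERIV_cong_ev[OF refl _ refl, where g = "\<lambda>t. deriv (H t) ?z * deriv base_inverse x"])
      (auto elim: eventually_mono)
qed

text \<open>At \<open>t0\<close> the derivative of the likelihood along \<open>K\<close> is
  \<open>T t0 * f x\<close> times the score, and it vanishes at a maximum.\<close>

lemma score_zero_if_max_at_identity:
  assumes x: "x \<in> S" and max: "\<And>k. k \<in> maps \<Longrightarrow> likelihood k x \<le> f x"
  shows "score U1 U2 f x = 0"
proof -
  have f': "(f has_real_derivative deriv f x) (at (K t0 x))" using DERIV_f[OF x] K_t0[OF x] by simp
  have "((\<lambda>t. likelihood (K t) x) has_real_derivative
      T t0 * U2 x * f (K t0 x) + deriv f x * (T t0 * U1 x) * deriv (K t0) x) (at t0)"
    unfolding likelihood_def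
    by (rule DERIV_mult[OF DERIV_deriv_K[OF x] DERIV_chain2[OF f' DERIV_K_t0[OF x]]])
  then have der: "((\<lambda>t. likelihood (K t) x) has_real_derivative
      T t0 * (U2 x * f x + deriv f x * U1 x)) (at t0)"
    using K_t0[OF x] deriv_K_t0[OF x] by (simp add: algebra_simps)
  obtain d where d: "d > 0" "\<And>t. dist t t0 < d \<Longrightarrow> t \<in> \<Theta>0"
    using eventually_params unfolding eventually_nhds_metric by blast
  have "likelihood (K t) x \<le> likelihood (K t0) x" if "\<bar>t0 - t\<bar> < d" for t
    using max[OF K_mem[OF d(2)[of t]]] that K_t0[OF x] deriv_K_t0[OF x]
    by (simp add: likelihood_def dist_real_def abs_minus_commute)
  then have "T t0 * (U2 x * f x + deriv f x * U1 x) = 0"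
    using DERIV_local_max[OF der d(1)] by blast
  then have "U2 x * f x + deriv f x * U1 x = 0" using t0(2) by simp
  moreover have "score U1 U2 f x = (U2 x * f x + deriv f x * U1 x) / f x"
    using f_pos[OF x] by (simp add: score_def field_simps)
  ultimately show ?thesis by simp
qed

lemma likelihood_comp:
  "k \<in> maps \<Longrightarrow> h \<in> maps \<Longrightarrow> x \<in> S \<Longrightarrow> likelihood (k \<circ> h) x = likelihood k (h x) * deriv h x"
  by (simp add: likelihood_def deriv_comp)

text \<open>\<open>likelihood (k \<circ> h) x\<close> is \<open>likelihood k (h x)\<close> times the
  positive number \<open>deriv h x\<close>, so a maximum at \<open>h\<close> for \<open>x\<close> is
  a maximum at the identity for \<open>h x\<close>.\<close>

lemma score_zero_at_max:
  assumes h: "h \<in> maps" and x: "x \<in> S" and max: "\<And>k. k \<in> maps \<Longrightarrow> likelihood k x \<le> likelihood h x"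
  shows "score U1 U2 f (h x) = 0"
proof (rule score_zero_if_max_at_identity)
  fix k assume k: "k \<in> maps"
  have "likelihood (k \<circ> h) x \<le> f (h x) * deriv h x"
    using max[OF comp_mem[OF k h]] unfolding likelihood_def by (simp only: mult.commute)
  then have "likelihood k (h x) * deriv h x \<le> f (h x) * deriv h x"
    unfolding likelihood_comp[OF k h x] .
  then show "likelihood k (h x) \<le> f (h x)" using deriv_pos[OF h x] by simp
qed (use maps_into h x in auto)

text \<open>The point to which a maximising element sends its observation. That the score has a zero
  is shown inside the next lemma; uniqueness is injectivity of the score.\<close>

definition xstar :: real where "xstar = (SOME x. x \<in> S \<and> score U1 U2 f x = 0)"

lemma ex_max_to_xstar:
  assumes "x \<in> S"
  shows "\<exists>h\<in>maps. h x = xstar \<and> (\<forall>k\<in>maps. likelihood k x \<le> likelihood h x)"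
proof -
  obtain h where h: "h \<in> maps" "\<forall>k\<in>maps. likelihood k x \<le> likelihood h x"
    using ex_max_likelihood[OF assms] by blast
  have z: "h x \<in> S \<and> score U1 U2 f (h x) = 0" using score_zero_at_max h assms maps_into by blast
  then have "xstar \<in> S \<and> score U1 U2 f xstar = 0" unfolding xstar_def by (rule someI)
  then have "h x = xstar" using z score_inj by (auto simp: inj_on_def)
  then show ?thesis using h by blast
qed

lemma xstar: "xstar \<in> S"
  using ex_max_to_xstar S_nonempty maps_into by (metis ex_in_conv)

lemma transitive:
  assumes "x \<in> S" "y \<in> S" shows "\<exists>h\<in>maps. h x = y"
proof -
  obtain h k where hk: "h \<in> maps" "h x = xstar" "k \<in> maps" "k y = xstar" using ex_max_to_xstar assms by blast
  obtain k' where "k' \<in> maps" "\<forall>x\<in>S. k' (k x) = x \<and> k (k' x) = x" using inverse_ex[OF hk(3)] by blast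
  then have "k' \<circ> h \<in> maps" "(k' \<circ> h) x = y" using comp_mem hk assms by (blast, simp, metis)
  then show ?thesis by blast
qed

text \<open>The likelihood of \<open>k ^^ n\<close> at \<open>xstar\<close> is
  \<open>deriv k xstar ^ n * f xstar\<close>, which a slope above 1 would make unbounded although a
  maximum exists.\<close>

lemma stabilizer_deriv_le_1:
  assumes k: "k \<in> maps" and fx: "k xstar = xstar" shows "deriv k xstar \<le> 1"
proof (rule ccontr)
  assume gt: "\<not> ?thesis"
  have fixn: "(k ^^ n) xstar = xstar" for n by (induction n) (use fx in auto)
  have pow: "deriv (k ^^ n) xstar = deriv k xstar ^ n" for n
  proof (induction n)
    case (Suc n)
    show ?case
      using deriv_comp[OF k pow_mem[OF k] xstar, of n] unfolding funpow.simps fixn Suc power_Suc .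
  qed (simp add: id_def[symmetric])
  obtain h where h: "h \<in> maps" "\<forall>k\<in>maps. likelihood k xstar \<le> likelihood h xstar"
    using ex_max_to_xstar[OF xstar] by blast
  have "deriv k xstar ^ n * f xstar \<le> likelihood h xstar" for n
    using h(2) pow_mem[OF k, of n] pow[of n] fixn[of n] by (auto simp: likelihood_def)
  then have "deriv k xstar ^ n \<le> likelihood h xstar / f xstar" for n
    using f_pos[OF xstar] by (simp add: field_simps)
  moreover obtain n where "likelihood h xstar / f xstar < deriv k xstar ^ n"
    using real_arch_pow[of "deriv k xstar"] gt by auto
  ultimately show False by (meson not_less)
qed

lemma stabilizer_deriv:
  assumes k: "k \<in> maps" and fx: "k xstar = xstar" shows "deriv k xstar = 1"
proof -
  obtain k' where k': "k' \<in> maps" "\<And>x. x \<in> S \<Longrightarrow> k' (k x) = x" using inverse_ex[OF k] by blast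
  have "k' xstar = xstar" using k'(2)[OF xstar] fx by simp
  then have "deriv k' xstar \<le> 1" using stabilizer_deriv_le_1[OF k'(1)] by blast
  moreover have "deriv k' xstar * deriv k xstar = 1" using deriv_inverse[OF k k' xstar] fx by simp
  moreover have "deriv k' xstar * deriv k xstar \<le> 1 * deriv k xstar"
    using calculation(1) deriv_pos[OF k xstar] by (intro mult_right_mono) auto
  ultimately have "1 \<le> deriv k xstar" by simp
  then show ?thesis using stabilizer_deriv_le_1[OF assms] by simp
qed

text \<open>Because stabilizers have slope \<open>1\<close>, the slope at \<open>x\<close> of a group element moving \<open>x\<close> to
  \<open>xstar\<close> does not depend on that element; it is the density of a measure invariant under the group.\<close>

definition inv_density :: "real \<Rightarrow> real" where
  "inv_density x = deriv (SOME h. h \<in> maps \<and> h x = xstar) x"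

lemma inv_density_eq:
  assumes h: "h \<in> maps" "h x = xstar" and x: "x \<in> S"
  shows "inv_density x = deriv h x"
proof -
  define k where "k = (SOME h. h \<in> maps \<and> h x = xstar)"
  have k: "k \<in> maps" "k x = xstar"
    using someI[of "\<lambda>h. h \<in> maps \<and> h x = xstar" h] h unfolding k_def by blast+
  obtain h' where h': "h' \<in> maps" "\<And>x. x \<in> S \<Longrightarrow> h' (h x) = x" using inverse_ex[OF h(1)] by blast
  have "(k \<circ> h') xstar = xstar" using h'(2)[OF x] h k by simp
  then have "deriv (k \<circ> h') xstar = 1" by (rule stabilizer_deriv[OF comp_mem[OF k(1) h'(1)]])
  then have "deriv k x * deriv h' xstar = 1"
    using deriv_comp[OF k(1) h'(1) xstar] h'(2)[OF x] h(2) by simp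
  moreover have "deriv h' xstar * deriv h x = 1" using deriv_inverse[OF h(1) h' x] h(2) by simp
  ultimately have "deriv k x = deriv h x"
    by (metis mult.assoc mult.left_neutral mult.right_neutral)
  then show ?thesis by (simp add: inv_density_def k_def)
qed

lemma inv_density_pos: "x \<in> S \<Longrightarrow> 0 < inv_density x"
  using ex_max_to_xstar inv_density_eq deriv_pos by metis

lemma inv_density_invariant:
  assumes h: "h \<in> maps" and x: "x \<in> S"
  shows "inv_density (h x) * deriv h x = inv_density x"
proof -
  obtain k where k: "k \<in> maps" "k (h x) = xstar" using ex_max_to_xstar[OF maps_into[OF h x]] by blast
  show ?thesis
    using inv_density_eq[OF k maps_into[OF h x]] inv_density_eq[OF comp_mem[OF k(1) h] _ x]
      deriv_comp[OF k(1) h x] k(2) by simp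
qed

text \<open>Some maximiser sends \<open>x\<close> to \<open>xstar\<close>, so the maximal likelihood
  at \<open>x\<close> is the right-hand side; the left-hand side is the likelihood of the
  identity.\<close>

lemma f_le_inv_density: "x \<in> S \<Longrightarrow> f x \<le> f xstar * inv_density x"
proof -
  assume x: "x \<in> S"
  obtain h where h: "h \<in> maps" "h x = xstar" "\<forall>k\<in>maps. likelihood k x \<le> likelihood h x"
    using ex_max_to_xstar[OF x] by blast
  have "likelihood id x \<le> likelihood h x" using h(3) id_mem by blast
  then show ?thesis using inv_density_eq[OF h(1,2) x] h(2) by (simp add: likelihood_def mult.commute)
qed

text \<open>Invariance writes \<open>ln (inv_density (K t x))\<close> as a constant minus
  \<open>ln (deriv (K t) x)\<close>, which is differentiable in \<open>t\<close> at
  \<open>t0\<close>. The curve of the \<open>K t x\<close> has nonzero speed there and transfers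
  this to \<open>x\<close>.\<close>

lemma DERIV_ln_inv_density:
  assumes x: "x \<in> S" and "U1 x \<noteq> 0"
  shows "((\<lambda>x. ln (inv_density x)) has_real_derivative - U2 x / U1 x) (at x)"
proof -
  have eq: "ln (inv_density (K t x)) = ln (inv_density x) - ln (deriv (K t) x)" if "t \<in> \<Theta>0" for t
  proof -
    have "inv_density (K t x) = inv_density x / deriv (K t) x"
      using inv_density_invariant[OF K_mem[OF that] x] deriv_pos[OF K_mem[OF that] x] by (simp add: field_simps)
    then show ?thesis
      using inv_density_pos[OF x] deriv_pos[OF K_mem[OF that] x] by (simp add: ln_div)
  qed
  have "((\<lambda>t. ln (inv_density x) - ln (deriv (K t) x)) has_real_derivative - (T t0 * U2 x)) (at t0)"
    using deriv_K_t0[OF x] by (auto intro!: derivative_eq_intros DERIV_deriv_K x)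
  then have "((\<lambda>t. ln (inv_density (K t x))) has_real_derivative - (T t0 * U2 x)) (at t0)"
    using eventually_params eq
    by (subst DERIV_cong_ev[OF refl _ refl, where g = "\<lambda>t. ln (inv_density x) - ln (deriv (K t) x)"])
      (auto elim: eventually_mono)
  then have "((\<lambda>x. ln (inv_density x)) has_real_derivative - (T t0 * U2 x) / (T t0 * U1 x)) (at (K t0 x))"
    by (intro derivative_along_curve[OF DERIV_K_t0[OF x] _ cont_K[OF x]]) (use assms t0 in auto)
  then show ?thesis using t0(2) K_t0[OF x] by simp
qed

lemma cont_inv_density:
  assumes x: "x \<in> S" and "U1 x \<noteq> 0"
  shows "isCont inv_density x"
proof -
  have "isCont (\<lambda>x. exp (ln (inv_density x))) x"
    by (rule isCont_o2[OF DERIV_isCont[OF DERIV_ln_inv_density[OF assms]] isCont_exp])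
  moreover have "\<forall>\<^sub>F y in nhds x. exp (ln (inv_density y)) = inv_density y"
    using eventually_in_S[OF x] by eventually_elim (use inv_density_pos in auto)
  ultimately show ?thesis
    using isCont_cong[of "\<lambda>x. exp (ln (inv_density x))" inv_density x] by simp
qed

end

subsection \<open>Connected components of the support\<close>

lemma interval_antiderivative:
  fixes g :: "real \<Rightarrow> real"
  assumes C: "open C" "connected C" and cont: "continuous_on C g"
  shows "\<exists>F. \<forall>x\<in>C. (F has_real_derivative g x) (at x)"
proof (cases "C = {}")
  case False
  then obtain c where c: "c \<in> C" by blast
  define F where "F x = (LBINT y=c..x. g y)" for x :: real
  have "(F has_real_derivative g x) (at x)" if x: "x \<in> C" for x
  proof -
    obtain d where d: "d > 0" "cball x d \<subseteq> C" using C(1) x open_contains_cball by blast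
    define a where "a = min c (x - d)"
    define b where "b = max c (x + d)"
    have ab: "a \<in> C" "b \<in> C" "a < x" "x < b" "a \<le> c" "c \<le> b"
      using c d by (auto simp: a_def b_def min_def max_def subset_iff dist_real_def)
    have sub: "{a..b} \<subseteq> C" by (rule connected_contains_Icc[OF C(2) ab(1,2)])
    have "(F has_vector_derivative g x) (at x within {a..b})"
      unfolding F_def by (rule interval_integral_FTC2)
        (use ab sub cont continuous_on_subset in \<open>auto simp: less_imp_le\<close>)
    then show ?thesis
      using ab by (simp add: at_within_Icc_at has_real_derivative_iff_has_vector_derivative)
  qed
  then show ?thesis by blast
qed simp

context regular_family
begin

lemma K_tendsto:
  assumes "x \<in> S" shows "((\<lambda>t. K t x) \<longlongrightarrow> x) (nhds t0)"
proof -
  have "((\<lambda>t. K t x) \<longlongrightarrow> K t0 x) (nhds t0)"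
    using DERIV_isCont[OF DERIV_K_t0[OF assms]]
      tendsto_at_iff_tendsto_nhds[of "\<lambda>t. K t x" t0] by (simp add: isCont_def)
  then show ?thesis using K_t0[OF assms] by simp
qed

context
  fixes x0 assumes x0: "x0 \<in> S"
begin

definition component :: "real set" where "component = connected_component_set S x0"

text \<open>One point decides: by \<open>component_closed\<close> such an element maps the whole
  component into itself.\<close>

definition component_maps :: "(real \<Rightarrow> real) set" where "component_maps = {h \<in> maps. h x0 \<in> component}"

lemma component: "open component" "connected component" "component \<subseteq> S" "x0 \<in> component"
  using x0 open_support
  by (auto simp: component_def open_connected_component connected_component_subset connected_component_refl)

lemma component_closed:
  assumes h: "h \<in> maps" and x: "x \<in> component" "h x \<in> component" and y: "y \<in> component"
  shows "h y \<in> component"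
proof -
  have "continuous_on component h"
    using DERIV_maps[OF h] component(3) DERIV_isCont by (intro continuous_at_imp_continuous_on) blast
  then have "connected (h ` component)" by (rule connected_continuous_image[OF _ component(2)])
  moreover have "h ` component \<subseteq> S" using maps_into[OF h] component(3) by blast
  moreover have "connected_component_set S (h x) = component"
    using x(2) unfolding component_def by (metis connected_component_eq)
  ultimately have "h ` component \<subseteq> component" using connected_component_maximal[of "h x" "h ` component" S] x by blast
  then show ?thesis using y by blast
qed

lemma component_maps_into: "h \<in> component_maps \<Longrightarrow> x \<in> component \<Longrightarrow> h x \<in> component"
  using component_closed[of h x0 x] component(4) unfolding component_maps_def by blast

lemma component_maps_maps: "h \<in> component_maps \<Longrightarrow> h \<in> maps"
  by (simp add: component_maps_def)

lemma component_mapsI: "h \<in> maps \<Longrightarrow> x \<in> component \<Longrightarrow> h x \<in> component \<Longrightarrow> h \<in> component_maps"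
  using component_closed[of h x x0] component(4) unfolding component_maps_def by blast

lemma component_maps_transitive: "x \<in> component \<Longrightarrow> y \<in> component \<Longrightarrow> \<exists>h\<in>component_maps. h x = y"
  using transitive[of x y] component(3) component_mapsI by (metis subsetD)

text \<open>If \<open>U1\<close> vanished on the component, the curves \<open>K t y\<close> would
  stay in it with velocity zero, so \<open>K t\<close> would be the identity there for
  \<open>t\<close> near \<open>t0\<close>. Then \<open>U2\<close> vanishes as well and the score is
  zero on an open set, against injectivity.\<close>

lemma U1_nonzero_somewhere: "\<exists>y\<in>component. U1 y \<noteq> 0"
proof (rule ccontr)
  assume "\<not> ?thesis"
  then have U1: "\<And>y. y \<in> component \<Longrightarrow> U1 y = 0" by blast
  obtain d where d: "d > 0" "ball t0 d \<subseteq> \<Theta>0" using open_params t0(1) open_contains_ball by blast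
  have tT: "t \<in> \<Theta>0" if "t \<in> ball t0 d" for t using that d by auto
  have fixed: "K t y = y" if t: "t \<in> ball t0 d" and y: "y \<in> component" for t y
  proof -
    have yS: "y \<in> S" using y component(3) by blast
    have conn: "connected ((\<lambda>t. K t y) ` ball t0 d)"
      using DERIV_isCont[OF DERIV_K[OF tT yS]]
      by (intro connected_continuous_image continuous_at_imp_continuous_on) auto
    have "connected_component_set S y = component"
      using y unfolding component_def by (metis connected_component_eq)
    moreover have "y \<in> (\<lambda>t. K t y) ` ball t0 d"
      using K_t0[OF yS] d(1) by (intro image_eqI[of _ _ t0]) auto
    moreover have "(\<lambda>t. K t y) ` ball t0 d \<subseteq> S"
      using maps_into[OF K_mem[OF tT] yS] by blast
    ultimately have sub: "(\<lambda>t. K t y) ` ball t0 d \<subseteq> component"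
      using connected_component_maximal[OF _ conn] by metis
    have "\<exists>c. \<forall>t\<in>ball t0 d. K t y = c"
    proof (rule has_field_derivative_zero_constant)
      fix t assume t: "t \<in> ball t0 d"
      then have "U1 (K t y) = 0" using sub U1 by blast
      then show "((\<lambda>t. K t y) has_real_derivative 0) (at t within ball t0 d)"
        using DERIV_K[OF tT[OF t] yS] by (auto intro: has_field_derivative_at_within)
    qed auto
    then show ?thesis using t K_t0[OF yS] d(1) by (metis centre_in_ball)
  qed
  have "score U1 U2 f y = 0" if y: "y \<in> component" for y
  proof -
    have yS: "y \<in> S" using y component(3) by blast
    have "deriv (K t) y = 1" if t: "t \<in> ball t0 d" for t
    proof -
      have "\<forall>\<^sub>F z in nhds y. z \<in> component" using y component(1) by (rule eventually_nhds_in_open[rotated])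
      then have "\<forall>\<^sub>F z in nhds y. K t z = id z" by eventually_elim (use fixed[OF t] in auto)
      then have "deriv (K t) y = deriv id y" by (rule deriv_cong_ev) simp
      then show ?thesis by simp
    qed
    moreover have "\<forall>\<^sub>F t in nhds t0. t \<in> ball t0 d" using d(1) by (intro eventually_nhds_in_open) auto
    ultimately have "\<forall>\<^sub>F t in nhds t0. deriv (K t) y = 1" by (auto elim: eventually_mono)
    then have "((\<lambda>t. deriv (K t) y) has_real_derivative 0) (at t0)"
      by (subst DERIV_cong_ev[OF refl _ refl, where g = "\<lambda>_. 1"]) auto
    then have "T t0 * U2 y = 0" using DERIV_unique DERIV_deriv_K[OF yS] by blast
    then show ?thesis using U1[OF y] t0(2) by (simp add: score_def)
  qed
  moreover obtain e where e: "e > 0" "cball x0 e \<subseteq> component" using component(1,4) open_contains_cball by blast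
  then have "x0 + e \<in> component" by (auto simp: subset_iff dist_real_def)
  ultimately have "score U1 U2 f (x0 + e) = score U1 U2 f x0" using component(4) by simp
  then have "x0 + e = x0"
    using score_inj \<open>x0 + e \<in> component\<close> component(3,4) by (meson inj_onD subsetD)
  then show False using e(1) by simp
qed

lemma component_maps_commute:
  assumes "h \<in> component_maps" "k \<in> component_maps" "x \<in> component"
  shows "h (k x) = k (h x)"
proof -
  obtain y1 where y1: "y1 \<in> component" "U1 y1 \<noteq> 0" using U1_nonzero_somewhere by blast
  have inS: "\<And>x. x \<in> component \<Longrightarrow> x \<in> S" using component(3) by blast
  interpret L: line_group component component_maps inv_density y1
  proof
    show "\<exists>k\<in>component_maps. \<forall>x\<in>component. k (h x) = x \<and> h (k x) = x" if h: "h \<in> component_maps" for h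
    proof -
      obtain k where k: "k \<in> maps" "\<And>x. x \<in> S \<Longrightarrow> k (h x) = x \<and> h (k x) = x"
        using inverse_ex[OF component_maps_maps[OF h]] by blast
      have "k \<in> component_maps"
        by (rule component_mapsI[OF k(1) component_maps_into[OF h component(4)]]) (use k(2) inS component(4) in auto)
      then show ?thesis using k(2) inS by blast
    qed
    show "id \<in> component_maps" using id_mem component(4) by (simp add: component_maps_def)
    show "h \<circ> k \<in> component_maps" if "h \<in> component_maps" "k \<in> component_maps" for h k
      using comp_mem[of h k] that component_maps_into[OF that(1) component_maps_into[OF that(2) component(4)]]
      unfolding component_maps_def by simp
    show "h differentiable at x" if "h \<in> component_maps" "x \<in> component" for h x
      using DERIV_maps[OF component_maps_maps[OF that(1)] inS[OF that(2)]] real_differentiable_def by blast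
  qed (use component component_maps_into component_maps_maps strict_increasing component_maps_transitive inv_density_pos
      inv_density_invariant y1 cont_inv_density inS in auto)
  show ?thesis by (rule L.commute[OF assms])
qed

text \<open>Obtained by differentiating \<open>h (K t x) = K t (h x)\<close> at \<open>t0\<close>;
  the relation is available for \<open>t\<close> near \<open>t0\<close>, where \<open>K t x\<close>
  is still in the component.\<close>

lemma U1_equivariant:
  assumes h: "h \<in> component_maps" and x: "x \<in> component"
  shows "deriv h x * U1 x = U1 (h x)"
proof -
  have xS: "x \<in> S" "h x \<in> S" using x component(3) component_maps_into[OF h x] by auto
  have "\<forall>\<^sub>F t in nhds t0. K t x \<in> component"
    using topological_tendstoD[OF K_tendsto[OF xS(1)] component(1) x] .
  then have ev: "\<forall>\<^sub>F t in nhds t0. h (K t x) = K t (h x)"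
    using eventually_params by eventually_elim (use component_maps_commute[OF h component_mapsI[OF K_mem x] x] in auto)
  have "(h has_real_derivative deriv h x) (at (K t0 x))"
    using DERIV_maps[OF component_maps_maps[OF h] xS(1)] K_t0[OF xS(1)] by simp
  then have "((\<lambda>t. h (K t x)) has_real_derivative deriv h x * (T t0 * U1 x)) (at t0)"
    by (rule DERIV_chain2[OF _ DERIV_K_t0[OF xS(1)]])
  then have "((\<lambda>t. K t (h x)) has_real_derivative deriv h x * (T t0 * U1 x)) (at t0)"
    by (subst DERIV_cong_ev[OF refl _ refl, where g = "\<lambda>t. h (K t x)"]) (use ev in \<open>auto elim: eventually_mono\<close>)
  then have "deriv h x * (T t0 * U1 x) = T t0 * U1 (h x)"
    by (rule DERIV_unique[OF _ DERIV_K_t0[OF xS(2)]])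
  then show ?thesis using t0(2) by simp
qed

lemma U1_nonzero: assumes "x \<in> component" shows "U1 x \<noteq> 0"
proof -
  obtain y1 where y1: "y1 \<in> component" "U1 y1 \<noteq> 0" using U1_nonzero_somewhere by blast
  obtain h where "h \<in> component_maps" "h x = y1" using component_maps_transitive[OF assms y1(1)] by blast
  then show ?thesis using U1_equivariant[OF _ assms, of h] y1(2) by auto
qed

lemma U1_inv_density_const:
  assumes "x \<in> component" shows "inv_density x * U1 x = inv_density x0 * U1 x0"
proof -
  obtain h where h: "h \<in> component_maps" "h x0 = x" using component_maps_transitive[OF component(4) assms] by blast
  have "U1 x = deriv h x0 * U1 x0"
    using U1_equivariant[OF h(1) component(4)] h(2) by simp
  moreover have "inv_density x * deriv h x0 = inv_density x0"
    using inv_density_invariant[OF component_maps_maps[OF h(1)] x0] h(2) by simp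
  ultimately show ?thesis by (metis mult.assoc)
qed

lemma cont_U1: assumes "x \<in> component" shows "isCont U1 x"
proof -
  have xS: "x \<in> S" using assms component(3) by blast
  have eq: "U1 y = inv_density x0 * U1 x0 / inv_density y" if "y \<in> component" for y
    using U1_inv_density_const[OF that] inv_density_pos[of y] component(3) that by (force simp: field_simps)
  have "isCont (\<lambda>y. inv_density x0 * U1 x0 / inv_density y) x"
    using cont_inv_density[OF xS U1_nonzero[OF assms]] inv_density_pos[OF xS] by (intro continuous_intros) auto
  moreover have "\<forall>\<^sub>F y in nhds x. y \<in> component" by (rule eventually_nhds_in_open[OF component(1) assms])
  then have "\<forall>\<^sub>F y in nhds x. U1 y = inv_density x0 * U1 x0 / inv_density y"
    by eventually_elim (rule eq)
  ultimately show ?thesis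
    using isCont_cong[of U1 "\<lambda>y. inv_density x0 * U1 x0 / inv_density y" x] by simp
qed

text \<open>\<open>s\<close> is an antiderivative of \<open>1 / U1\<close>; by equivariance of
  \<open>U1\<close> the difference \<open>s (h x) - s x\<close> has derivative zero, so the group
  acts by translations. What remains is that \<open>s\<close> fills the whole line.\<close>

lemma coordinate:
  obtains s X :: "real \<Rightarrow> real" where
    "\<And>x. x \<in> component \<Longrightarrow> X (s x) = x" "\<And>t. X t \<in> component" "\<And>t. s (X t) = t"
    "\<And>x. x \<in> component \<Longrightarrow> (s has_real_derivative 1 / U1 x) (at x)"
    "\<And>t. (X has_real_derivative U1 (X t)) (at t)"
    "\<And>h. h \<in> component_maps \<Longrightarrow> \<exists>c. \<forall>x\<in>component. s (h x) = s x + c"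
proof -
  have "continuous_on component (\<lambda>x. 1 / U1 x)"
    using cont_U1 U1_nonzero by (intro continuous_at_imp_continuous_on ballI continuous_intros) auto
  then obtain s where s: "\<And>x. x \<in> component \<Longrightarrow> (s has_real_derivative 1 / U1 x) (at x)"
    using interval_antiderivative[OF component(1,2)] by blast
  have cvx: "convex component" using component(2) by (simp flip: is_interval_convex_1 add: is_interval_connected_1)
  have conts: "continuous_on component s"
    using s DERIV_isCont by (intro continuous_at_imp_continuous_on) blast
  have shift: "\<exists>c. \<forall>x\<in>component. s (h x) = s x + c" if h: "h \<in> component_maps" for h
  proof -
    have "\<exists>c. \<forall>x\<in>component. s (h x) - s x = c"
    proof (rule has_field_derivative_zero_constant[OF cvx])
      fix x assume x: "x \<in> component"
      have hx: "h x \<in> component" using component_maps_into[OF h x] .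
      have "((\<lambda>x. s (h x) - s x) has_real_derivative 1 / U1 (h x) * deriv h x - 1 / U1 x) (at x)"
        by (intro DERIV_diff DERIV_chain2[of s] s x hx DERIV_maps component_maps_maps h)
          (use x component(3) in auto)
      moreover have "1 / U1 (h x) * deriv h x - 1 / U1 x = 0"
        using U1_equivariant[OF h x] U1_nonzero[OF x] U1_nonzero[OF hx] by (simp add: field_simps)
      ultimately show "((\<lambda>x. s (h x) - s x) has_real_derivative 0) (at x within component)"
        by (metis has_field_derivative_at_within)
    qed
    then show ?thesis by (metis add.commute diff_add_cancel)
  qed
  have inj: "inj_on s component"
  proof (rule inj_onI, rule ccontr)
    fix x y assume xy: "x \<in> component" "y \<in> component" "s x = s y" "x \<noteq> y"
    have "\<exists>z. z \<in> component \<and> 1 / U1 z = 0"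
    proof -
      define l where "l = min x y"
      define u where "u = max x y"
      have lu: "l < u" "s l = s u" "l \<in> component" "u \<in> component" using xy by (auto simp: l_def u_def min_def max_def)
      have sub: "{l..u} \<subseteq> component" by (rule connected_contains_Icc[OF component(2) lu(3,4)])
      have "\<exists>z. l < z \<and> z < u \<and> s u - s l = (u - l) * (1 / U1 z)"
        by (rule MVT2[OF lu(1)]) (use s sub in auto)
      then obtain z where z: "l < z" "z < u" "s u - s l = (u - l) * (1 / U1 z)" by blast
      then show ?thesis using sub lu by (intro exI[of _ z]) auto
    qed
    then show False using U1_nonzero by auto
  qed
  have surj: "s ` component = UNIV"
  proof -
    obtain e where e: "e > 0" "cball x0 e \<subseteq> component" using component(1,4) open_contains_cball by blast
    then have x1: "x0 + e \<in> component" by (auto simp: subset_iff dist_real_def)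
    have ne: "s (x0 + e) \<noteq> s x0" using inj_onD[OF inj _ x1 component(4)] e(1) by auto
    \<comment> \<open>Translating by \<open>h\<close> and back by \<open>k\<close> in equal nonzero
      steps leads arbitrarily far in both directions; connectedness fills the gaps.\<close>
    have orbit: "(\<exists>y\<in>component. s y = s x0 + real n * (s (x0 + e) - s x0)) \<and>
      (\<exists>y\<in>component. s y = s x0 - real n * (s (x0 + e) - s x0))" for n
    proof -
      obtain h where h: "h \<in> component_maps" "h x0 = x0 + e" using component_maps_transitive[OF component(4) x1] by blast
      obtain k where k: "k \<in> component_maps" "k (x0 + e) = x0" using component_maps_transitive[OF x1 component(4)] by blast
      have hs: "s (h y) = s y + (s (x0 + e) - s x0)" if "y \<in> component" for y
        using shift[OF h(1)] component(4) h(2) that by fastforce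
      have ks: "s (k y) = s y - (s (x0 + e) - s x0)" if "y \<in> component" for y
        using shift[OF k(1)] x1 k(2) that by fastforce
      show ?thesis
      proof (induction n)
        case 0
        then show ?case using component(4) by auto
      next
        case (Suc n)
        obtain y where "y \<in> component" "s y = s x0 + real n * (s (x0 + e) - s x0)" using Suc by blast
        then have "h y \<in> component" "s (h y) = s x0 + real (Suc n) * (s (x0 + e) - s x0)"
          using hs[of y] component_maps_into[OF h(1)] by (auto simp: distrib_right)
        moreover obtain z where "z \<in> component" "s z = s x0 - real n * (s (x0 + e) - s x0)" using Suc by blast
        then have "k z \<in> component" "s (k z) = s x0 - real (Suc n) * (s (x0 + e) - s x0)"
          using ks[of z] component_maps_into[OF k(1)] by (auto simp: distrib_right)
        ultimately show ?case by blast
      qed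
    qed
    have conn: "connected (s ` component)" by (rule connected_continuous_image[OF conts component(2)])
    have "r \<in> s ` component" for r
    proof -
      obtain n where n: "\<bar>r - s x0\<bar> / \<bar>s (x0 + e) - s x0\<bar> < real n" using reals_Archimedean2 by blast
      define D where "D = real n * (s (x0 + e) - s x0)"
      have bnd: "\<bar>r - s x0\<bar> < \<bar>D\<bar>"
        using n ne unfolding D_def abs_mult by (simp add: divide_less_eq)
      have mem: "s x0 + D \<in> s ` component" "s x0 - D \<in> s ` component"
        using orbit[of n] unfolding D_def by (metis imageI)+
      then have "s x0 + \<bar>D\<bar> \<in> s ` component" "s x0 - \<bar>D\<bar> \<in> s ` component" by (auto simp: abs_real_def)
      then have "{s x0 - \<bar>D\<bar>..s x0 + \<bar>D\<bar>} \<subseteq> s ` component" by (intro connected_contains_Icc[OF conn])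
      moreover have "r \<in> {s x0 - \<bar>D\<bar>..s x0 + \<bar>D\<bar>}" using bnd unfolding atLeastAtMost_iff by linarith
      ultimately show ?thesis by blast
    qed
    then show ?thesis by blast
  qed
  define X where "X = inv_into component s"
  have X: "\<And>x. x \<in> component \<Longrightarrow> X (s x) = x" "\<And>t. X t \<in> component" "\<And>t. s (X t) = t"
    using inj surj by (auto simp: X_def inv_into_f_f inv_into_into f_inv_into_f)
  have dX: "(X has_real_derivative U1 (X t)) (at t)" for t
    unfolding has_field_derivative_def
  proof (rule has_derivative_inverse_strong_x[OF component(1) X(2) conts X(1)])
    show "(s has_derivative (*) (1 / U1 (X t))) (at (X t))"
      using s[OF X(2)] by (simp add: has_field_derivative_def)
    show "(*) (1 / U1 (X t)) \<circ> (*) (U1 (X t)) = id"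
      using U1_nonzero[OF X(2)] by (auto simp: fun_eq_iff)
  qed (use X in auto)
  show ?thesis by (rule that[OF X s dX shift])
qed

text \<open>\<open>P\<close> is \<open>ln (f / inv_density)\<close> read in the coordinate. Its
  bound \<open>ln (f xstar)\<close> is the same for every component, which later excludes a second
  one.\<close>

lemma profile:
  obtains X P :: "real \<Rightarrow> real" where
    "bij_betw X UNIV component"
    "\<And>t. (P has_real_derivative score U1 U2 f (X t)) (at t)"
    "\<And>t. P t \<le> ln (f xstar)"
proof -
  obtain s X where sX: "\<And>x. x \<in> component \<Longrightarrow> X (s x) = x" "\<And>t. X t \<in> component" "\<And>t. s (X t) = t"
    "\<And>t. (X has_real_derivative U1 (X t)) (at t)"
    using coordinate by metis
  define P where "P t = ln (f (X t) / inv_density (X t))" for t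
  have XS: "X t \<in> S" for t using sX(2) component(3) by blast
  have Peq: "P t = ln (f (X t)) - ln (inv_density (X t))" for t
    using f_pos[OF XS[of t]] inv_density_pos[OF XS[of t]] by (simp add: P_def ln_div)
  have "(P has_real_derivative score U1 U2 f (X t)) (at t)" for t
  proof -
    have "((\<lambda>t. ln (f (X t)) - ln (inv_density (X t))) has_real_derivative
       (1 / f (X t)) * (deriv f (X t) * U1 (X t)) - (- U2 (X t) / U1 (X t)) * U1 (X t)) (at t)"
      by (intro DERIV_diff DERIV_chain2[OF DERIV_ln_divide] DERIV_chain2[OF DERIV_f] sX(4)
          DERIV_chain2[OF DERIV_ln_inv_density] f_pos XS U1_nonzero sX(2))
    moreover have "(1 / f (X t)) * (deriv f (X t) * U1 (X t)) - (- U2 (X t) / U1 (X t)) * U1 (X t) =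
        score U1 U2 f (X t)"
      using U1_nonzero[OF sX(2)] by (simp add: score_def field_simps)
    ultimately show ?thesis unfolding Peq[abs_def] by metis
  qed
  moreover have "P t \<le> ln (f xstar)" for t
    unfolding P_def using f_le_inv_density[OF XS] f_pos[OF XS] f_pos[OF xstar] inv_density_pos[OF XS]
    by (subst ln_le_cancel_iff) (auto simp: field_simps)
  moreover have "bij_betw X UNIV component"
    by (rule bij_betwI[where g = s]) (use sX in auto)
  ultimately show ?thesis using that by blast
qed

end

lemma profile_inj:
  assumes "bij_betw X UNIV C" "C \<subseteq> S" shows "inj (\<lambda>t. score U1 U2 f (X t))"
proof (rule injI)
  fix a b assume "score U1 U2 f (X a) = score U1 U2 f (X b)"
  moreover have "X a \<in> S" "X b \<in> S" using assms by (auto simp: bij_betw_def)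
  ultimately have "X a = X b" using inj_onD[OF score_inj] by blast
  then show "a = b" using assms(1) by (auto simp: bij_betw_def inj_on_def)
qed

text \<open>The score covers a neighbourhood of \<open>0\<close> on the component of its zero, so on another
  component it would be bounded away from \<open>0\<close>, and the likelihood would be unbounded there.\<close>

lemma connected_S: "connected S"
proof -
  obtain X P where XP: "bij_betw X UNIV (component xstar)"
    "\<And>t. (P has_real_derivative score U1 U2 f (X t)) (at t)"
    using profile[OF xstar] by metis
  have star: "xstar \<in> S \<and> score U1 U2 f xstar = 0"
    using xstar score_zero_at_max ex_max_to_xstar by metis
  have C: "xstar \<in> component xstar" "component xstar \<subseteq> S" using component[OF xstar] by auto
  have "open (range (\<lambda>t. score U1 U2 f (X t)))"
    by (rule inj_derivative_range_open(1)[OF XP(2) profile_inj[OF XP(1) C(2)]])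
  moreover have range1: "range (\<lambda>t. score U1 U2 f (X t)) = score U1 U2 f ` component xstar"
    using XP(1) by (auto simp: bij_betw_def simp flip: image_image)
  moreover have "0 \<in> score U1 U2 f ` component xstar" using star C(1) by (metis imageI)
  ultimately obtain e where e: "e > 0" "ball 0 e \<subseteq> score U1 U2 f ` component xstar"
    by (metis open_contains_ball)
  have "y \<in> component xstar" if y: "y \<in> S" for y
  proof (rule ccontr)
    assume notin: "y \<notin> component xstar"
    have "component y \<inter> component xstar = {}"
      using notin unfolding component_def[OF y] component_def[OF xstar]
      by (metis connected_component_disjoint connected_component_eq_empty disjoint_iff y)
    obtain Y Q where YQ: "bij_betw Y UNIV (component y)"
      "\<And>t. (Q has_real_derivative score U1 U2 f (Y t)) (at t)" "\<And>t. Q t \<le> ln (f xstar)"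
      using profile[OF y] by metis
    let ?p = "\<lambda>t. score U1 U2 f (Y t)"
    have away: "\<bar>?p t\<bar> \<ge> e" for t
    proof (rule ccontr)
      assume "\<not> ?thesis"
      then have "?p t \<in> ball 0 e" by (simp add: dist_real_def)
      then obtain z where z: "z \<in> component xstar" "score U1 U2 f z = ?p t" using e(2) by (metis imageE subsetD)
      have "Y t \<in> component y" using YQ(1) by (auto simp: bij_betw_def)
      moreover have "z = Y t"
        using score_inj z C(2) calculation component(3)[OF y] by (meson inj_onD subsetD)
      ultimately show False using z(1) \<open>component y \<inter> component xstar = {}\<close> by blast
    qed
    \<comment> \<open>The score on the other component is a derivative, so by Darboux it cannot jump
      across the omitted values around \<open>0\<close>.\<close>
    have "(\<forall>t. ?p t \<ge> e) \<or> (\<forall>t. ?p t \<le> - e)"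
    proof (rule ccontr)
      assume "\<not> ?thesis"
      then obtain a b where ab: "?p a < e" "?p b > - e" by (auto simp: not_le)
      then have "?p a < 0" "?p b > 0" using away[of a] away[of b] e(1) by auto
      then have "\<exists>c. ?p c = 0"
        using darboux[of a b Q ?p 0, OF _ YQ(2)] darboux[of b a Q ?p 0, OF _ YQ(2)]
        by (cases a b rule: linorder_cases) auto
      then show False using away e(1) by (metis abs_zero not_less)
    qed
    then show False
    proof
      assume ge: "\<forall>t. ?p t \<ge> e"
      \<comment> \<open>Climbing at slope at least \<open>e\<close> over the length \<open>b\<close>
        lifts \<open>Q\<close> one unit above its upper bound.\<close>
      define b where "b = (ln (f xstar) - Q 0 + 1) / e"
      have "b > 0" using YQ(3)[of 0] e(1) by (simp add: b_def)
      then obtain z where "Q b - Q 0 = b * ?p z" using MVT2[of 0 b Q ?p] YQ(2) by auto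
      moreover have "b * e \<le> b * ?p z" using ge \<open>b > 0\<close> by (intro mult_left_mono) auto
      moreover have "b * e = ln (f xstar) - Q 0 + 1" using e(1) by (simp add: b_def)
      ultimately show False using YQ(3)[of b] by linarith
    next
      assume le: "\<forall>t. ?p t \<le> - e"
      define b where "b = (ln (f xstar) - Q 0 + 1) / e"
      have "b > 0" using YQ(3)[of 0] e(1) by (simp add: b_def)
      then obtain z where "Q 0 - Q (- b) = b * ?p z" using MVT2[of "- b" 0 Q ?p] YQ(2) by auto
      moreover have "b * ?p z \<le> b * - e" using le \<open>b > 0\<close> by (intro mult_left_mono) auto
      moreover have "b * e = ln (f xstar) - Q 0 + 1" using e(1) by (simp add: b_def)
      ultimately show False using YQ(3)[of "- b"] by (simp add: algebra_simps)
    qed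
  qed
  then have "S = component xstar" using C(2) by blast
  then show ?thesis using component(2)[OF xstar] by simp
qed

end

subsection \<open>Functions preserving vanishing sums\<close>

text \<open>At a point \<open>x\<close> maximising the defect \<open>\<bar>F x - (F r / r) x\<bar>\<close>, doubling \<open>x\<close> (after a
  shift by the period \<open>r\<close> if necessary) doubles the defect, which must therefore vanish.\<close>

lemma additive_on_interval_linear:
  fixes F :: "real \<Rightarrow> real"
  assumes r: "r > 0" and cont: "continuous_on {-r..r} F"
    and add: "\<And>a b. \<lbrakk>\<bar>a\<bar> \<le> r; \<bar>b\<bar> \<le> r; \<bar>a + b\<bar> \<le> r\<rbrakk> \<Longrightarrow> F (a + b) = F a + F b"
    and a: "\<bar>a\<bar> \<le> r"
  shows "F a = F r / r * a"
proof -
  define E where "E x = F x - F r / r * x" for x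
  have Eadd: "E (a + b) = E a + E b" if "\<bar>a\<bar> \<le> r" "\<bar>b\<bar> \<le> r" "\<bar>a + b\<bar> \<le> r" for a b
    using add[OF that] by (simp add: E_def distrib_left)
  have E0: "E 0 = 0" using Eadd[of 0 0] r by simp
  have Er: "E r = 0" using r by (simp add: E_def)
  have Eneg: "E (- x) = - E x" if "\<bar>x\<bar> \<le> r" for x
    using Eadd[of x "- x"] E0 that r by simp
  have "continuous_on {-r..r} (\<lambda>x. \<bar>E x\<bar>)"
    unfolding E_def by (intro continuous_intros cont)
  then obtain z where z: "z \<in> {-r..r}" "\<And>x. x \<in> {-r..r} \<Longrightarrow> \<bar>E x\<bar> \<le> \<bar>E z\<bar>"
    using continuous_attains_sup[of "{-r..r}" "\<lambda>x. \<bar>E x\<bar>"] r by auto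
  define x where "x = \<bar>z\<bar>"
  have x: "0 \<le> x" "x \<le> r" "\<bar>E x\<bar> = \<bar>E z\<bar>"
    using z(1) Eneg[of z] by (auto simp: x_def abs_real_def)
  have half: "E y = 0" if y: "\<bar>E y\<bar> = \<bar>E z\<bar>" "\<bar>2 * y\<bar> \<le> r" for y
  proof -
    have "E (y + y) = E y + E y" by (rule Eadd) (use y in auto)
    moreover have "\<bar>E (y + y)\<bar> \<le> \<bar>E z\<bar>" by (rule z(2)) (use y in auto)
    ultimately show ?thesis using y(1) by auto
  qed
  have "E z = 0"
  proof (cases "2 * x \<le> r")
    case True
    then show ?thesis using half[of x] x by auto
  next
    case False
    \<comment> \<open>Since \<open>r < 2 * x\<close>, the point \<open>x - r\<close> has absolute
      value below \<open>r / 2\<close>, and it has the same defect because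
      \<open>E r = 0\<close>.\<close>
    have "E (x - r + r) = E (x - r) + E r" by (rule Eadd) (use x r in auto)
    then have "E (x - r) = E x" using Er by simp
    then show ?thesis using half[of "x - r"] x False by auto
  qed
  moreover have "a \<in> {-r..r}" using a by auto
  ultimately have "E a = 0" using z(2)[of a] by simp
  then show ?thesis by (simp add: E_def)
qed

text \<open>Padding with zeros gives a condition on three terms, which makes \<open>F\<close> odd
  and additive on symmetric intervals. A value \<open>a\<close> outside them is balanced by
  \<open>n - 1\<close> equal terms that do lie in such an interval.\<close>

lemma zero_sum_preserving_linear:
  fixes F :: "real \<Rightarrow> real"
  assumes n: "n \<ge> 3" and J: "connected J" and r: "r > 0" "{-r..r} \<subseteq> J"
    and cont: "continuous_on J F"
    and zero: "\<And>a. \<lbrakk>\<And>i. i < n \<Longrightarrow> a i \<in> J; (\<Sum>i<n. a i) = 0\<rbrakk> \<Longrightarrow> (\<Sum>i<n. F (a i)) = 0"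
    and a: "a \<in> J" "- a / real (n - 1) \<in> J"
  shows "F a = F r / r * a"
proof -
  have zeroJ: "0 \<in> J" using r by auto
  have spread: "(\<Sum>i<n. if i = 0 then u else v) = u + real (n - 1) * v" for u v :: real
  proof -
    have "{..<n} = insert 0 {1..<n}" using n by auto
    then have "(\<Sum>i<n. if i = 0 then u else v) = u + (\<Sum>i\<in>{1..<n}. if i = 0 then u else v)" by simp
    also have "(\<Sum>i\<in>{1..<n}. if i = 0 then u else v) = (\<Sum>i\<in>{1..<n}. v)" by (rule sum.cong) auto
    finally show ?thesis by simp
  qed
  have F0: "F 0 = 0" using zero[of "\<lambda>_. 0"] zeroJ n by simp
  have three: "F u + F v + F w = 0" if "u \<in> J" "v \<in> J" "w \<in> J" "u + v + w = 0" for u v w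
  proof -
    let ?a = "\<lambda>i::nat. if i = 0 then u else if i = 1 then v else if i = 2 then w else 0"
    have sum: "(\<Sum>i<n. G (?a i)) = G u + G v + G w" if "G 0 = 0" for G :: "real \<Rightarrow> real"
    proof -
      have "(\<Sum>i<n. G (?a i)) = (\<Sum>i\<in>{0,1,2}. G (?a i))"
        by (rule sum.mono_neutral_right) (use n that in auto)
      then show ?thesis by simp
    qed
    have "(\<Sum>i<n. F (?a i)) = 0"
      by (rule zero) (use that zeroJ sum[of "\<lambda>x. x"] in auto)
    then show ?thesis using sum[of F] F0 by simp
  qed
  have lin: "F b = F \<rho> / \<rho> * b" if \<rho>: "\<rho> > 0" "{-\<rho>..\<rho>} \<subseteq> J" and b: "\<bar>b\<bar> \<le> \<rho>" for \<rho> b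
  proof (rule additive_on_interval_linear[OF \<rho>(1) continuous_on_subset[OF cont \<rho>(2)] _ b])
    fix a b assume ab: "\<bar>a\<bar> \<le> \<rho>" "\<bar>b\<bar> \<le> \<rho>" "\<bar>a + b\<bar> \<le> \<rho>"
    have "x \<in> J" if "\<bar>x\<bar> \<le> \<rho>" for x using \<rho>(2) that by (auto simp: subset_iff abs_le_iff)
    then have mem: "a \<in> J" "b \<in> J" "- (a + b) \<in> J" "a + b \<in> J" using ab by auto
    show "F (a + b) = F a + F b"
      using three[of a b "- (a + b)"] three[of "a + b" "- (a + b)" 0] mem zeroJ F0 by simp
  qed
  define c where "c = - a / real (n - 1)"
  have n1: "real (n - 1) \<ge> 2" using n by simp
  have ac: "a + real (n - 1) * c = 0" using n by (simp add: c_def)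
  have "(\<Sum>i<n. F (if i = 0 then a else c)) = 0"
    by (rule zero) (use a c_def spread[of a c] ac in auto)
  then have Fa: "F a + real (n - 1) * F c = 0"
    using spread[of "F a" "F c"] by (simp add: if_distrib cong: if_cong)
  \<comment> \<open>Large enough for \<open>r\<close> and \<open>c\<close> to lie in one symmetric
    interval, so that both get the same slope.\<close>
  define \<rho> where "\<rho> = max r \<bar>c\<bar>"
  have "\<bar>c\<bar> = \<bar>a\<bar> / real (n - 1)" by (simp add: c_def abs_divide)
  also have "\<dots> \<le> \<bar>a\<bar> / 1" using n1 by (intro divide_left_mono) auto
  finally have abs_c: "\<bar>c\<bar> \<le> \<bar>a\<bar>" by simp
  have seg: "{min x y..max x y} \<subseteq> J" if "x \<in> J" "y \<in> J" for x y
    by (rule connected_contains_Icc[OF J]) (use that in \<open>auto simp: min_def max_def\<close>)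
  have cJ: "c \<in> J" using a(2) by (simp only: c_def)
  \<comment> \<open>\<open>c\<close> has the sign opposite to \<open>a\<close> and is no larger in
    absolute value, so \<open>- c\<close> lies between \<open>0\<close> and
    \<open>a\<close>.\<close>
  have "\<bar>c\<bar> \<in> J \<and> - \<bar>c\<bar> \<in> J"
  proof (cases "a \<ge> 0")
    case True
    then have "c \<le> 0" using n by (simp add: c_def)
    then show ?thesis using abs_c True cJ seg[OF zeroJ a(1)] by (auto simp: subset_iff)
  next
    case False
    then have "c \<ge> 0" using n by (simp add: c_def divide_nonpos_nonneg)
    then show ?thesis using abs_c False cJ seg[OF zeroJ a(1)] by (auto simp: subset_iff)
  qed
  then have \<rho>: "\<rho> > 0" "{-\<rho>..\<rho>} \<subseteq> J"
    using r seg[of "- \<bar>c\<bar>" "\<bar>c\<bar>"] by (auto simp: \<rho>_def max_def)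
  have "F c = F \<rho> / \<rho> * c" "F r = F \<rho> / \<rho> * r"
    by (rule lin[OF \<rho>]; use r in \<open>simp add: \<rho>_def\<close>)+
  then have "F c = F r / r * c" using r(1) by simp
  then have "F a = F r / r * - (real (n - 1) * c)" using Fa by (simp add: algebra_simps)
  also have "- (real (n - 1) * c) = a" using ac by simp
  finally show ?thesis .
qed

subsection \<open>Reduction to a location family\<close>

text \<open>\<open>shift\<close> and \<open>all_shifts\<close> identify the members of the family
  with all translations of the line, so that maximising over \<open>\<Theta>0\<close> becomes
  maximising over a real \<open>c\<close>.\<close>

locale location_coordinates = regular_family +
  fixes s X :: "real \<Rightarrow> real"
  assumes X_s: "x \<in> S \<Longrightarrow> X (s x) = x"
    and X_mem: "X t \<in> S"
    and s_X: "s (X t) = t"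
    and DERIV_s: "x \<in> S \<Longrightarrow> (s has_real_derivative 1 / U1 x) (at x)"
    and DERIV_X: "(X has_real_derivative U1 (X t)) (at t)"
    and U1_nz: "x \<in> S \<Longrightarrow> U1 x \<noteq> 0"
    and shift: "\<theta> \<in> \<Theta>0 \<Longrightarrow> \<exists>c. \<forall>x\<in>S. s (H \<theta> x) = s x + c"
    and all_shifts: "\<exists>\<theta>\<in>\<Theta>0. \<forall>x\<in>S. s (H \<theta> x) = s x + c"
    and U1_cont: "continuous_on S U1"
    and inv_density_U1: "\<exists>c. \<forall>x\<in>S. inv_density x = c / U1 x"

lemma (in regular_family) ex_location_coordinates:
  "\<exists>s X. location_coordinates \<Theta>0 D S H T U1 U2 f s X"
proof -
  note x0 = xstar
  have C: "component xstar = S"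
    using component_def[OF x0] connected_S xstar by (metis connected_component_eq_self)
  have maps_eq: "component_maps xstar = maps"
    using component_maps_maps[OF x0] component_mapsI[OF x0] maps_into C xstar by blast
  obtain s X where sX: "\<And>x. x \<in> S \<Longrightarrow> X (s x) = x" "\<And>t. X t \<in> S" "\<And>t. s (X t) = t"
    "\<And>x. x \<in> S \<Longrightarrow> (s has_real_derivative 1 / U1 x) (at x)"
    "\<And>t. (X has_real_derivative U1 (X t)) (at t)"
    "\<And>h. h \<in> maps \<Longrightarrow> \<exists>c. \<forall>x\<in>S. s (h x) = s x + c"
    using coordinate[OF x0] unfolding C maps_eq by metis
  have nz: "U1 x \<noteq> 0" if "x \<in> S" for x using U1_nonzero[OF x0] C that by blast
  have shifts: "\<exists>\<theta>\<in>\<Theta>0. \<forall>x\<in>S. s (H \<theta> x) = s x + c" for c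
  proof -
    obtain h where h: "h \<in> maps" "h (X 0) = X c" using transitive sX(2) by blast
    obtain \<theta> where t: "\<theta> \<in> \<Theta>0" "\<And>x. x \<in> S \<Longrightarrow> h x = H \<theta> x" using h(1) by (auto simp: maps_def)
    obtain c' where c': "\<And>x. x \<in> S \<Longrightarrow> s (h x) = s x + c'" using sX(6)[OF h(1)] by blast
    have "c' = c" using c'[OF sX(2), of 0] h(2) sX(3) by simp
    then show ?thesis using t c' by auto
  qed
  have "inv_density x = inv_density xstar * U1 xstar / U1 x" if "x \<in> S" for x
    using U1_inv_density_const[OF x0, of x] nz that C by (simp add: field_simps)
  then have w: "\<exists>c. \<forall>x\<in>S. inv_density x = c / U1 x" by blast
  have "location_coordinates \<Theta>0 D S H T U1 U2 f s X"
  proof unfold_locales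
    show "continuous_on S U1"
      using cont_U1[OF x0] C by (intro continuous_at_imp_continuous_on) blast
  qed (use sX nz shifts w H_mem in \<open>blast+\<close>)
  then show ?thesis by blast
qed

definition C1_density :: "real set \<Rightarrow> (real \<Rightarrow> real) \<Rightarrow> bool" where
  "C1_density S h \<longleftrightarrow> density_with_support S h \<and> h C1_differentiable_on S"

lemma C1_densityD:
  assumes "C1_density S h"
  shows "x \<in> S \<Longrightarrow> 0 < h x" "x \<in> S \<Longrightarrow> (h has_real_derivative deriv h x) (at x)" "continuous_on S (deriv h)"
proof -
  obtain d where d: "\<And>x. x \<in> S \<Longrightarrow> (h has_real_derivative d x) (at x)" "continuous_on S d"
    using assms unfolding C1_density_def C1_differentiable_on_def has_real_derivative_iff_has_vector_derivative by blast
  then show "x \<in> S \<Longrightarrow> (h has_real_derivative deriv h x) (at x)"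
    using DERIV_imp_deriv by metis
  show "continuous_on S (deriv h)"
    using d(2) by (rule continuous_on_eq) (metis d(1) DERIV_imp_deriv)
  show "x \<in> S \<Longrightarrow> 0 < h x" using assms by (simp add: C1_density_def density_with_support_def)
qed

section \<open>The likelihood in the location coordinate\<close>

context location_coordinates
begin

definition \<psi> :: "(real \<Rightarrow> real) \<Rightarrow> real \<Rightarrow> real" where
  "\<psi> h t = score U1 U2 h (X t)"

text \<open>Up to an additive constant the log-density of \<open>s x\<close> for \<open>x\<close>
  distributed by \<open>h\<close>, because \<open>inv_density\<close> is proportional to
  \<open>1 / U1\<close>, the derivative of \<open>s\<close>.\<close>

definition P :: "(real \<Rightarrow> real) \<Rightarrow> real \<Rightarrow> real" where
  "P h t = ln (h (X t)) - ln (inv_density (X t))"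

lemma C1_density_f: "C1_density S f"
  using f_density f_C1 by (simp add: C1_density_def)

lemma DERIV_P:
  assumes "C1_density S h" shows "(P h has_real_derivative \<psi> h t) (at t)"
proof -
  note h = C1_densityD[OF assms]
  have "((\<lambda>t. ln (h (X t)) - ln (inv_density (X t))) has_real_derivative
     (1 / h (X t)) * (deriv h (X t) * U1 (X t)) - (- U2 (X t) / U1 (X t)) * U1 (X t)) (at t)"
    by (intro DERIV_diff DERIV_chain2[OF DERIV_ln_divide] DERIV_chain2[OF h(2)] DERIV_X
        DERIV_chain2[OF DERIV_ln_inv_density] h(1) X_mem U1_nz)
  moreover have "(1 / h (X t)) * (deriv h (X t) * U1 (X t)) - (- U2 (X t) / U1 (X t)) * U1 (X t) = \<psi> h t"
    using U1_nz[OF X_mem] by (simp add: score_def \<psi>_def field_simps)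
  ultimately show ?thesis unfolding P_def[abs_def] by metis
qed

lemma inj_\<psi>_f: "inj (\<psi> f)"
  unfolding \<psi>_def by (rule profile_inj[of _ S]) (use X_s X_mem s_X in \<open>auto intro!: bij_betwI[where g = s]\<close>)

lemma continuous_\<psi>_f: "continuous_on UNIV (\<psi> f)" and open_range_\<psi>_f: "open (range (\<psi> f))"
  using inj_derivative_range_open[OF DERIV_P[OF C1_density_f] inj_\<psi>_f] by auto

lemma X_range: "X ` UNIV = S"
  using X_s X_mem by (metis image_iff subsetI subset_antisym image_subset_iff UNIV_I)

lemma range_\<psi>: "range (\<psi> h) = score U1 U2 h ` S"
  by (simp add: \<psi>_def[abs_def] X_range[symmetric] image_image)

lemma continuous_X: "continuous_on UNIV X"
  using DERIV_X DERIV_isCont by (intro continuous_at_imp_continuous_on) blast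

lemma continuous_s: "continuous_on S s"
  using DERIV_s DERIV_isCont by (intro continuous_at_imp_continuous_on) blast

text \<open>\<open>U2\<close> inherits continuity from the score of \<open>f\<close>, which is
  continuous by the Darboux argument. This in turn makes the score of every competitor
  continuous.\<close>

lemma continuous_U2: "continuous_on S U2"
proof -
  note h = C1_densityD[OF C1_density_f]
  have cf: "continuous_on S f" using h(2) DERIV_isCont by (intro continuous_at_imp_continuous_on) blast
  have "continuous_on S (\<lambda>x. \<psi> f (s x) - U1 x * deriv f x / f x)"
    by (intro continuous_intros continuous_on_compose2[OF continuous_\<psi>_f continuous_s] U1_cont h(3) cf)
      (use h(1) in force)+
  then show ?thesis
    by (rule continuous_on_eq) (simp add: \<psi>_def score_def X_s)
qed

lemma continuous_\<psi>:
  assumes "C1_density S h" shows "continuous_on UNIV (\<psi> h)"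
proof -
  note h = C1_densityD[OF assms]
  have ch: "continuous_on S h" using h(2) DERIV_isCont by (intro continuous_at_imp_continuous_on) blast
  have "continuous_on S (score U1 U2 h)"
    unfolding score_def[abs_def]
    by (intro continuous_intros continuous_U2 U1_cont h(3) ch) (use h(1) in force)
  then show ?thesis
    unfolding \<psi>_def[abs_def] by (rule continuous_on_compose2[OF _ continuous_X]) (use X_mem in auto)
qed

definition tstar :: real where "tstar = s xstar"

lemma \<psi>_tstar: "\<psi> f tstar = 0"
  using xstar score_zero_at_max ex_max_to_xstar X_s unfolding \<psi>_def tstar_def by metis

lemma P_le_P_tstar: "P f t \<le> P f tstar"
proof -
  have "inv_density xstar = 1" using inv_density_eq[OF id_mem _ xstar] by simp
  then have "P f tstar = ln (f xstar)" using X_s[OF xstar] by (simp add: P_def tstar_def)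
  moreover have "ln (f (X t)) \<le> ln (f xstar * inv_density (X t))"
    using f_le_inv_density[OF X_mem] f_pos[OF X_mem] by (subst ln_le_cancel_iff) (auto intro: less_le_trans)
  ultimately show ?thesis
    using f_pos[OF xstar] inv_density_pos[OF X_mem[of t]] by (simp add: P_def ln_mult)
qed

text \<open>The alternative is a strictly increasing score, which would make \<open>P f\<close> grow
  to the right of its maximum \<open>tstar\<close>.\<close>

lemma \<psi>_f_decreasing: "x < y \<Longrightarrow> \<psi> f y < \<psi> f x"
proof -
  have "\<not> strict_mono (\<psi> f)"
  proof
    assume mono: "strict_mono (\<psi> f)"
    obtain z where z: "tstar < z" "P f (tstar + 1) - P f tstar = \<psi> f z"
      using MVT2[of tstar "tstar + 1" "P f" "\<psi> f"] DERIV_P[OF C1_density_f] by auto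
    then have "\<psi> f z > 0" using strict_monoD[OF mono z(1)] \<psi>_tstar by simp
    then show False using z(2) P_le_P_tstar[of "tstar + 1"] by simp
  qed
  then show "x < y \<Longrightarrow> \<psi> f y < \<psi> f x"
    using inj_derivative_strict_mono[OF DERIV_P[OF C1_density_f] inj_\<psi>_f] by blast
qed

lemma family_density_coordinates:
  assumes \<theta>: "\<theta> \<in> \<Theta>0" and x: "x \<in> S" and c: "\<forall>x\<in>S. s (H \<theta> x) = s x + c" and h: "\<And>x. x \<in> S \<Longrightarrow> 0 < h x"
  shows "family_density D H h \<theta> x = inv_density x * exp (P h (s x + c))"
proof -
  have Hx: "H \<theta> x \<in> S" using maps_into[OF H_mem[OF \<theta>] x] .
  have X: "X (s x + c) = H \<theta> x" using c x X_s[OF Hx] by simp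
  have "exp (P h (s x + c)) = h (H \<theta> x) / inv_density (H \<theta> x)"
    using h[OF Hx] inv_density_pos[OF Hx] by (simp add: P_def X exp_diff)
  moreover have "deriv (H \<theta>) x = inv_density x / inv_density (H \<theta> x)"
    using inv_density_invariant[OF H_mem[OF \<theta>] x] inv_density_pos[OF Hx] by (simp add: field_simps)
  ultimately show ?thesis using x D_eq_S by (simp add: family_density_def)
qed

lemma ln_likelihood_coordinates:
  fixes x :: "nat \<Rightarrow> real"
  assumes \<theta>: "\<theta> \<in> \<Theta>0" and x: "\<forall>i<n. x i \<in> S" and c: "\<forall>x\<in>S. s (H \<theta> x) = s x + c"
    and h: "\<forall>x\<in>S. 0 < h x"
  shows "(\<Sum>i<n. ln (family_density D H h \<theta> (x i))) = (\<Sum>i<n. ln (inv_density (x i))) + (\<Sum>i<n. P h (s (x i) + c))"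
    and "(\<Prod>i<n. family_density D H h \<theta> (x i)) = (\<Prod>i<n. inv_density (x i)) * exp (\<Sum>i<n. P h (s (x i) + c))"
proof -
  have eq: "family_density D H h \<theta> (x i) = inv_density (x i) * exp (P h (s (x i) + c))" if "i < n" for i
    using family_density_coordinates[OF \<theta> _ c] x h that by blast
  then have "(\<Sum>i<n. ln (family_density D H h \<theta> (x i))) = (\<Sum>i<n. ln (inv_density (x i)) + P h (s (x i) + c))"
    using inv_density_pos x by (intro sum.cong refl) (force simp: ln_mult)
  then show "(\<Sum>i<n. ln (family_density D H h \<theta> (x i))) = (\<Sum>i<n. ln (inv_density (x i))) + (\<Sum>i<n. P h (s (x i) + c))"
    by (simp add: sum.distrib)
  show "(\<Prod>i<n. family_density D H h \<theta> (x i)) = (\<Prod>i<n. inv_density (x i)) * exp (\<Sum>i<n. P h (s (x i) + c))"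
    using eq by (simp add: prod.distrib exp_sum)
qed

lemma DERIV_sum_P:
  assumes "C1_density S h"
  shows "((\<lambda>t. \<Sum>i<n. P h (y i + t)) has_real_derivative (\<Sum>i<n. \<psi> h (y i + t))) (at t)"
proof -
  have "((\<lambda>t. P h (y i + t)) has_real_derivative \<psi> h (y i + t) * 1) (at t)" for i
    by (rule DERIV_chain2[OF DERIV_P[OF assms]]) (auto intro!: derivative_eq_intros)
  then show ?thesis by (auto intro!: DERIV_sum)
qed

lemma stationary_at_max:
  assumes "C1_density S h" "\<And>t. (\<Sum>i<n. P h (y i + t)) \<le> (\<Sum>i<n. P h (y i + c))"
  shows "(\<Sum>i<n. \<psi> h (y i + c)) = 0"
  by (rule DERIV_local_max[OF DERIV_sum_P[OF assms(1)], of 1]) (use assms(2) in auto)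

lemma mle_coordinates:
  assumes est: "is_mle \<Theta>0 D H n f est" and x: "x \<in> {..<n} \<rightarrow>\<^sub>E D"
  obtains c where "est x \<in> \<Theta>0" "\<forall>z\<in>S. s (H (est x) z) = s z + c" "(\<Sum>i<n. \<psi> f (s (x i) + c)) = 0"
proof -
  have "x \<in> space (Pi\<^sub>M {..<n} (\<lambda>_. restrict_space borel D))"
    using x by (simp add: space_PiM space_restrict_space)
  then have e: "est x \<in> \<Theta>0"
    using est measurable_space[of est] by (fastforce simp: is_mle_def space_restrict_space)
  obtain c where c: "\<forall>z\<in>S. s (H (est x) z) = s z + c" using shift[OF e] by blast
  have xS: "\<forall>i<n. x i \<in> S" using x D_eq_S by auto
  have f_pos': "\<forall>x\<in>S. 0 < f x" using f_pos by blast
  have "(\<Sum>i<n. P f (s (x i) + t)) \<le> (\<Sum>i<n. P f (s (x i) + c))" for t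
  proof -
    obtain \<theta> where t: "\<theta> \<in> \<Theta>0" "\<forall>x\<in>S. s (H \<theta> x) = s x + t" using all_shifts by blast
    have "(\<Prod>i<n. family_density D H f \<theta> (x i)) \<le> (\<Prod>i<n. family_density D H f (est x) (x i))"
      using est x t(1) by (auto simp: is_mle_def)
    moreover have "(\<Prod>i<n. inv_density (x i)) > 0" using inv_density_pos xS by (intro prod_pos) auto
    ultimately show ?thesis
      unfolding ln_likelihood_coordinates(2)[OF t(1) xS t(2) f_pos'] ln_likelihood_coordinates(2)[OF e xS c f_pos']
      by simp
  qed
  then have "(\<Sum>i<n. \<psi> f (s (x i) + c)) = 0" by (rule stationary_at_max[OF C1_density_f])
  then show ?thesis using that e c by blast
qed

text \<open>Translating a sample by its estimate makes its scores sum to zero, so only such samples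
  have to be compared, each with all its translates.\<close>

lemma mle_coincide_iff:
  assumes n: "n \<ge> 1" and ex: "\<exists>est. is_mle \<Theta>0 D H n f est" and h: "C1_density S h"
  shows "mle_coincide \<Theta>0 D H n f h \<longleftrightarrow>
    (\<forall>y. (\<Sum>i<n. \<psi> f (y i)) = 0 \<longrightarrow> (\<forall>t. (\<Sum>i<n. P h (y i + t)) \<le> (\<Sum>i<n. P h (y i))))"
    (is "_ \<longleftrightarrow> ?R")
proof
  have h_pos: "\<forall>x\<in>S. 0 < h x" using C1_densityD(1)[OF h] by blast
  assume R: ?R
  show "mle_coincide \<Theta>0 D H n f h"
    unfolding mle_coincide_def
  proof (intro allI impI ballI)
    fix est x \<theta> assume est: "is_mle \<Theta>0 D H n f est" and x: "x \<in> {..<n} \<rightarrow>\<^sub>E D" and \<theta>: "\<theta> \<in> \<Theta>0"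
    have xS: "\<forall>i<n. x i \<in> S" using x D_eq_S by auto
    obtain c where c: "est x \<in> \<Theta>0" "\<forall>z\<in>S. s (H (est x) z) = s z + c" "(\<Sum>i<n. \<psi> f (s (x i) + c)) = 0"
      using mle_coordinates[OF est x] by blast
    obtain c' where c': "\<forall>x\<in>S. s (H \<theta> x) = s x + c'" using shift[OF \<theta>] by blast
    have "(\<Sum>i<n. P h (s (x i) + c + (c' - c))) \<le> (\<Sum>i<n. P h (s (x i) + c))"
      using R[rule_format, of "\<lambda>i. s (x i) + c"] c(3) by blast
    then show "(\<Sum>i<n. ln (family_density D H h \<theta> (x i))) \<le> (\<Sum>i<n. ln (family_density D H h (est x) (x i)))"
      unfolding ln_likelihood_coordinates(1)[OF \<theta> xS c' h_pos]
        ln_likelihood_coordinates(1)[OF c(1) xS c(2) h_pos]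
      by (simp add: add.assoc)
  qed
next
  have h_pos: "\<forall>x\<in>S. 0 < h x" using C1_densityD(1)[OF h] by blast
  assume co: "mle_coincide \<Theta>0 D H n f h"
  show ?R
  proof (intro allI impI)
    fix y t assume y: "(\<Sum>i<n. \<psi> f (y i)) = 0"
    define x where "x = (\<lambda>i\<in>{..<n}. X (y i))"
    have x: "x \<in> {..<n} \<rightarrow>\<^sub>E D" using X_mem D_eq_S by (auto simp: x_def)
    have xS: "\<forall>i<n. x i \<in> S" and sx: "\<And>i. i < n \<Longrightarrow> s (x i) = y i" using X_mem s_X by (auto simp: x_def)
    \<comment> \<open>Here existence enters: without an estimator \<open>mle_coincide\<close> would
      hold vacuously.\<close>
    obtain est where est: "is_mle \<Theta>0 D H n f est" using ex by blast
    obtain c where c: "est x \<in> \<Theta>0" "\<forall>z\<in>S. s (H (est x) z) = s z + c" "(\<Sum>i<n. \<psi> f (s (x i) + c)) = 0"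
      using mle_coordinates[OF est x] by blast
    have c3: "(\<Sum>i<n. \<psi> f (y i + c)) = 0" using c(3) sx by simp
    \<comment> \<open>The score sum strictly decreases under translation, so a sample with sum zero
      is not moved by its estimate.\<close>
    have "c = 0"
    proof (rule ccontr)
      assume "c \<noteq> 0"
      then consider "c > 0" | "c < 0" by linarith
      then show False
      proof cases
        case 1
        then have "(\<Sum>i<n. \<psi> f (y i + c)) < (\<Sum>i<n. \<psi> f (y i))"
          using n by (intro sum_strict_mono) (auto intro: \<psi>_f_decreasing simp: lessThan_empty_iff)
        then show ?thesis using c3 y by simp
      next
        case 2
        then have "(\<Sum>i<n. \<psi> f (y i)) < (\<Sum>i<n. \<psi> f (y i + c))"
          using n by (intro sum_strict_mono) (auto intro: \<psi>_f_decreasing simp: lessThan_empty_iff)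
        then show ?thesis using c3 y by simp
      qed
    qed
    obtain \<theta> where t: "\<theta> \<in> \<Theta>0" "\<forall>x\<in>S. s (H \<theta> x) = s x + t" using all_shifts by blast
    have "(\<Sum>i<n. ln (family_density D H h \<theta> (x i))) \<le> (\<Sum>i<n. ln (family_density D H h (est x) (x i)))"
      using co est x t(1) unfolding mle_coincide_def by blast
    then have "(\<Sum>i<n. P h (s (x i) + t)) \<le> (\<Sum>i<n. P h (s (x i) + c))"
      unfolding ln_likelihood_coordinates(1)[OF t(1) xS t(2) h_pos]
        ln_likelihood_coordinates(1)[OF c(1) xS c(2) h_pos] by simp
    then show "(\<Sum>i<n. P h (y i + t)) \<le> (\<Sum>i<n. P h (y i))" using \<open>c = 0\<close> sx by simp
  qed
qed

text \<open>\<open>- ln (inv_density x)\<close> is an antiderivative of \<open>U2 / U1\<close>, and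
  on the connected set \<open>S\<close> any other differs by a constant. The exponential factor is
  thus a multiple of a power of \<open>inv_density\<close>, and dividing both densities by
  \<open>inv_density\<close> absorbs it.\<close>

lemma H_related_iff_P:
  assumes f1: "\<And>x. x \<in> S \<Longrightarrow> 0 < f1 x" and f2: "\<And>x. x \<in> S \<Longrightarrow> 0 < f2 x"
  shows "H_related S U1 U2 f1 f2 \<longleftrightarrow> (\<exists>d>0. \<exists>k. \<forall>t. P f2 t = d * P f1 t + k)"
proof
  have dw: "((\<lambda>x. - ln (inv_density x)) has_real_derivative U2 x / U1 x) (at x)" if "x \<in> S" for x
    using DERIV_minus[OF DERIV_ln_inv_density[OF that U1_nz[OF that]]] by simp
  {
    assume "H_related S U1 U2 f1 f2"
    then obtain c d A where A: "c > 0" "d > 0" "\<forall>x\<in>S. (A has_real_derivative U2 x / U1 x) (at x)"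
      "\<forall>x\<in>S. f2 x = c * exp ((d - 1) * A x) * f1 x powr d"
      unfolding H_related_def using U1_nz by (auto split: if_splits)
    have cvx: "convex S" using connected_S by (simp flip: is_interval_convex_1 add: is_interval_connected_1)
    have "\<exists>k. \<forall>x\<in>S. A x - - ln (inv_density x) = k"
    proof (rule has_field_derivative_zero_constant[OF cvx])
      fix x assume "x \<in> S"
      show "((\<lambda>x. A x - - ln (inv_density x)) has_real_derivative 0) (at x within S)"
        using DERIV_diff[OF bspec[OF A(3)] dw, OF \<open>x \<in> S\<close> \<open>x \<in> S\<close>] by (simp add: has_field_derivative_at_within)
    qed
    then obtain k where k: "\<And>x. x \<in> S \<Longrightarrow> A x = k - ln (inv_density x)" by (metis add.commute diff_minus_eq_add diff_eq_eq eq_diff_eq)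
    have "P f2 t = d * P f1 t + (ln c + (d - 1) * k)" for t
    proof -
      have "ln (f2 (X t)) = ln c + (d - 1) * A (X t) + d * ln (f1 (X t))"
        using A(1) f1[OF X_mem[of t]] by (simp add: bspec[OF A(4) X_mem] ln_mult ln_powr)
      then show ?thesis using k[OF X_mem[of t]] by (simp add: P_def algebra_simps)
    qed
    then show "\<exists>d>0. \<exists>k. \<forall>t. P f2 t = d * P f1 t + k" using A(2) by blast
  next
    assume "\<exists>d>0. \<exists>k. \<forall>t. P f2 t = d * P f1 t + k"
    then obtain d k where d: "d > 0" "\<And>t. P f2 t = d * P f1 t + k" by blast
    have "f2 x = exp k * exp ((d - 1) * - ln (inv_density x)) * f1 x powr d" if x: "x \<in> S" for x
    proof -
      have "ln (f2 x) = k + (d - 1) * - ln (inv_density x) + d * ln (f1 x)"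
        using d(2)[of "s x"] X_s[OF x] by (simp add: P_def algebra_simps)
      then have "f2 x = exp (k + (d - 1) * - ln (inv_density x) + d * ln (f1 x))"
        using f2[OF x] by (metis exp_ln)
      then show ?thesis using f1[OF x] by (simp add: powr_def flip: exp_add)
    qed
    then show "H_related S U1 U2 f1 f2"
      unfolding H_related_def using U1_nz d(1) dw
      by (intro exI[of _ "exp k"] exI[of _ d] exI[of _ "\<lambda>x. - ln (inv_density x)"] conjI) auto
  }
qed

end

subsection \<open>Samples on which the estimators can differ\<close>

context location_coordinates
begin

definition stationary_max :: "nat \<Rightarrow> (real \<Rightarrow> real) \<Rightarrow> bool" where
  "stationary_max n h \<longleftrightarrow>
    (\<forall>y. (\<Sum>i<n. \<psi> f (y i)) = 0 \<longrightarrow> (\<forall>t. (\<Sum>i<n. P h (y i + t)) \<le> (\<Sum>i<n. P h (y i))))"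

lemma stationary_maxD:
  assumes "stationary_max n h" "C1_density S h" "(\<Sum>i<n. \<psi> f (y i)) = 0"
  shows "(\<Sum>i<n. \<psi> h (y i)) = 0"
  using stationary_at_max[OF assms(2), where n = n and y = y and c = 0] assms(1,3) by (simp add: stationary_max_def)

text \<open>As a function of the translation \<open>t\<close>, the sum has a nonincreasing
  derivative that vanishes at \<open>0\<close>.\<close>

lemma concave_max:
  assumes h: "C1_density S h" and anti: "\<And>x y. x \<le> y \<Longrightarrow> \<psi> h y \<le> \<psi> h x"
    and zero: "(\<Sum>i<n. \<psi> h (y i)) = 0"
  shows "(\<Sum>i<n. P h (y i + t)) \<le> (\<Sum>i<n. P h (y i))"
proof -
  consider "t = 0" | "t > 0" | "t < 0" by linarith
  then show ?thesis
  proof cases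
    case 2
    obtain z where z: "0 < z" "(\<Sum>i<n. P h (y i + t)) - (\<Sum>i<n. P h (y i + 0)) = (t - 0) * (\<Sum>i<n. \<psi> h (y i + z))"
      using MVT2[OF 2, of "\<lambda>t. \<Sum>i<n. P h (y i + t)" "\<lambda>t. \<Sum>i<n. \<psi> h (y i + t)"] DERIV_sum_P[OF h] by blast
    have "(\<Sum>i<n. \<psi> h (y i + z)) \<le> (\<Sum>i<n. \<psi> h (y i))" using z(1) by (intro sum_mono anti) auto
    then have "t * (\<Sum>i<n. \<psi> h (y i + z)) \<le> 0" using zero 2 by (simp add: mult_nonneg_nonpos)
    then show ?thesis using z(2) by simp
  next
    case 3
    obtain z where z: "z < 0" "(\<Sum>i<n. P h (y i + 0)) - (\<Sum>i<n. P h (y i + t)) = (0 - t) * (\<Sum>i<n. \<psi> h (y i + z))"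
      using MVT2[OF 3, of "\<lambda>t. \<Sum>i<n. P h (y i + t)" "\<lambda>t. \<Sum>i<n. \<psi> h (y i + t)"] DERIV_sum_P[OF h] by blast
    have "(\<Sum>i<n. \<psi> h (y i)) \<le> (\<Sum>i<n. \<psi> h (y i + z))" using z(1) by (intro sum_mono anti) auto
    then have "- t * (\<Sum>i<n. \<psi> h (y i + z)) \<ge> 0" using zero 3 by (simp add: mult_nonpos_nonneg)
    then show ?thesis using z(2) by simp
  qed simp
qed

lemma \<psi>_f_antimono: "x \<le> y \<Longrightarrow> \<psi> f y \<le> \<psi> f x"
  using \<psi>_f_decreasing[of x y] by (cases "x = y") auto

lemma H_related_iff_\<psi>:
  assumes h: "C1_density S h"
  shows "H_related S U1 U2 f h \<longleftrightarrow> (\<exists>d>0. \<forall>t. \<psi> h t = d * \<psi> f t)"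
proof -
  have "H_related S U1 U2 f h \<longleftrightarrow> (\<exists>d>0. \<exists>k. \<forall>t. P h t = d * P f t + k)"
    by (rule H_related_iff_P) (use f_pos C1_densityD(1)[OF h] in blast)+
  also have "\<dots> \<longleftrightarrow> (\<exists>d>0. \<forall>t. \<psi> h t = d * \<psi> f t)"
  proof
    assume "\<exists>d>0. \<exists>k. \<forall>t. P h t = d * P f t + k"
    then obtain d k where d: "d > 0" "\<forall>t. P h t = d * P f t + k" by blast
    have "((\<lambda>t. d * P f t + k) has_real_derivative d * \<psi> f t) (at t)" for t
      by (auto intro!: derivative_eq_intros DERIV_P[OF C1_density_f])
    moreover have "P h = (\<lambda>t. d * P f t + k)" using d(2) by auto
    ultimately show "\<exists>d>0. \<forall>t. \<psi> h t = d * \<psi> f t"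
      using DERIV_P[OF h] DERIV_unique d(1) by metis
  next
    assume "\<exists>d>0. \<forall>t. \<psi> h t = d * \<psi> f t"
    then obtain d where d: "d > 0" "\<forall>t. \<psi> h t = d * \<psi> f t" by blast
    have "((\<lambda>t. P h t - d * P f t) has_real_derivative 0) (at t)" for t
      using d(2) by (auto intro!: derivative_eq_intros DERIV_P[OF C1_density_f] DERIV_P[OF h])
    then have "P h t - d * P f t = P h 0 - d * P f 0" for t
      using DERIV_isconst_all[of "\<lambda>t. P h t - d * P f t" t 0] by blast
    then have "P h t = d * P f t + (P h 0 - d * P f 0)" for t by (simp add: algebra_simps)
    then show "\<exists>d>0. \<exists>k. \<forall>t. P h t = d * P f t + k" using d(1) by blast
  qed
  finally show ?thesis .
qed

lemma related_imp_stationary_max: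
  assumes h: "C1_density S h" and rel: "H_related S U1 U2 f h"
  shows "stationary_max n h"
  unfolding stationary_max_def
proof (intro allI impI)
  fix y t assume y: "(\<Sum>i<n. \<psi> f (y i)) = 0"
  obtain d where d: "d > 0" "\<And>t. \<psi> h t = d * \<psi> f t" using rel H_related_iff_\<psi>[OF h] by blast
  show "(\<Sum>i<n. P h (y i + t)) \<le> (\<Sum>i<n. P h (y i))"
    by (rule concave_max[OF h]) (use d y \<psi>_f_antimono in \<open>auto simp flip: sum_distrib_left\<close>)
qed

text \<open>A constant profile would mean that \<open>h\<close> is a multiple of the invariant density, whose total mass is infinite.\<close>

lemma P_not_constant:
  assumes h: "C1_density S h" shows "\<not> (\<forall>t. P h t = k)"
proof
  assume const: "\<forall>t. P h t = k"
  obtain c where c: "\<And>x. x \<in> S \<Longrightarrow> inv_density x = c / U1 x" using inv_density_U1 by blast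
  have hx: "h x = exp k * c * (1 / U1 x)" if x: "x \<in> S" for x
  proof -
    have "ln (h x) = k + ln (inv_density x)" using const[rule_format, of "s x"] X_s[OF x] by (simp add: P_def)
    then have "h x = exp k * inv_density x"
      using C1_densityD(1)[OF h x] inv_density_pos[OF x] by (metis exp_add exp_ln)
    then show ?thesis using c[OF x] by simp
  qed
  let ?G = "\<lambda>x. exp k * c * s x"
  have dG: "(?G has_real_derivative h x) (at x)" if "x \<in> S" for x
    unfolding hx[OF that] by (intro DERIV_cmult DERIV_s that)
  have "c \<noteq> 0" using c[OF xstar] inv_density_pos[OF xstar] by auto
  \<comment> \<open>Chosen so that the stretch between \<open>X 0\<close> and \<open>X N\<close>
    alone would carry mass 2.\<close>
  define N where "N = 2 / (exp k * \<bar>c\<bar>)"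
  have N: "exp k * \<bar>c\<bar> * N = 2" "N > 0" using \<open>c \<noteq> 0\<close> by (auto simp: N_def)
  define l where "l = min (X 0) (X N)"
  define u where "u = max (X 0) (X N)"
  have lu: "l \<le> u" "l \<in> S" "u \<in> S" using X_mem by (auto simp: l_def u_def min_def max_def)
  have sub: "x \<in> S" if "l \<le> x" "x \<le> u" for x
    using connected_contains_Icc[OF connected_S lu(2,3)] that by (auto simp: subset_iff)
  have bm: "h \<in> borel_measurable borel" and int: "(\<integral>\<^sup>+x. ennreal (h x) \<partial>lborel) = 1"
    using h by (auto simp: C1_density_def density_with_support_def)
  have "(\<integral>\<^sup>+x. ennreal (h x) * indicator {l..u} x \<partial>lborel) = ennreal (?G u - ?G l)"
    by (rule nn_integral_FTC_Icc[OF bm]) (use dG sub C1_densityD(1)[OF h] lu in \<open>auto simp: less_imp_le\<close>)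
  moreover have "(\<integral>\<^sup>+x. ennreal (h x) * indicator {l..u} x \<partial>lborel) \<le> (\<integral>\<^sup>+x. ennreal (h x) \<partial>lborel)"
    by (intro nn_integral_mono) (auto split: split_indicator)
  ultimately have "ennreal (?G u - ?G l) \<le> 1" using int by simp
  then have le1: "?G u - ?G l \<le> 1" by (simp add: ennreal_le_1)
  have "?G l \<le> ?G u"
    using DERIV_nonneg_imp_nondecreasing[OF lu(1), of ?G] dG sub C1_densityD(1)[OF h] by (metis less_imp_le)
  moreover have "\<bar>?G u - ?G l\<bar> = 2"
  proof -
    have "\<bar>s u - s l\<bar> = N" using s_X N(2) by (auto simp: l_def u_def min_def max_def)
    then show ?thesis using N(1) by (simp add: abs_mult flip: right_diff_distrib)
  qed
  ultimately show False using le1 by linarith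
qed

text \<open>The maximum property at the constant sample \<open>tstar\<close> decides the sign of
  \<open>d\<close>, and \<open>d = 0\<close> would make the profile of \<open>h\<close>
  constant.\<close>

lemma proportional_imp_related:
  assumes h: "C1_density S h" and max: "stationary_max n h" and n: "n \<ge> 1"
    and d: "\<And>t. \<psi> h t = d * \<psi> f t"
  shows "H_related S U1 U2 f h"
proof -
  have "((\<lambda>t. P h t - d * P f t) has_real_derivative 0) (at t)" for t
    using d by (auto intro!: derivative_eq_intros DERIV_P[OF C1_density_f] DERIV_P[OF h])
  then have "P h t - d * P f t = P h 0 - d * P f 0" for t
    using DERIV_isconst_all[of "\<lambda>t. P h t - d * P f t" t 0] by blast
  then have eq: "P h t = d * P f t + (P h 0 - d * P f 0)" for t by (simp add: algebra_simps)
  have "(\<Sum>i<n. P h (tstar + 1)) \<le> (\<Sum>i<n. P h tstar)"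
    using max[unfolded stationary_max_def, rule_format, of "\<lambda>_. tstar" 1] \<psi>_tstar by simp
  then have "P h (tstar + 1) \<le> P h tstar" using n by simp
  then have le: "d * P f (tstar + 1) \<le> d * P f tstar" using eq by (metis add_le_cancel_right)
  obtain z where "tstar < z" "P f (tstar + 1) - P f tstar = \<psi> f z"
    using MVT2[of tstar "tstar + 1" "P f" "\<psi> f"] DERIV_P[OF C1_density_f] by auto
  then have "P f (tstar + 1) < P f tstar" using \<psi>_f_decreasing[of tstar z] \<psi>_tstar by simp
  then have "d \<ge> 0" using le by (meson mult_less_cancel_left not_less)
  moreover have "d \<noteq> 0"
  proof
    assume "d = 0"
    then have "P h t = P h 0" for t using eq[of t] by simp
    then show False using P_not_constant[OF h] by blast
  qed
  ultimately show ?thesis using d H_related_iff_\<psi>[OF h] by (metis less_le)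
qed

definition J :: "real set" where "J = range (\<psi> f)"

lemma open_J: "open J" and zero_J: "0 \<in> J" and connected_J: "connected J" and convex_J: "convex J"
proof -
  show "open J" by (simp add: J_def open_range_\<psi>_f)
  show "0 \<in> J" unfolding J_def using \<psi>_tstar by (metis rangeI)
  show "connected J" unfolding J_def by (rule connected_continuous_image[OF continuous_\<psi>_f]) simp
  then show "convex J" by (simp flip: is_interval_convex_1 add: is_interval_connected_1)
qed

lemma ex_symmetric_J: "\<exists>r>0. {-r..r} \<subseteq> J"
proof -
  obtain r where "r > 0" "cball 0 r \<subseteq> J" using open_J zero_J open_contains_cball by blast
  then show ?thesis by (intro exI[of _ r]) (auto simp: subset_iff dist_real_def)
qed

definition \<psi>_inv :: "real \<Rightarrow> real" where "\<psi>_inv = inv_into UNIV (\<psi> f)"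

lemma inv_\<psi>: "\<psi>_inv (\<psi> f t) = t" "a \<in> J \<Longrightarrow> \<psi> f (\<psi>_inv a) = a"
  using inj_\<psi>_f by (auto simp: J_def \<psi>_inv_def f_inv_into_f)

lemma continuous_inv_\<psi>: "continuous_on J \<psi>_inv"
proof -
  have "continuous_on J (\<lambda>a. - \<psi>_inv a)"
  proof (rule continuous_onI_mono)
    have "t \<in> (\<lambda>a. - \<psi>_inv a) ` J" for t
      by (intro image_eqI[of _ _ "\<psi> f (- t)"]) (auto simp: inv_\<psi> J_def)
    then have "(\<lambda>a. - \<psi>_inv a) ` J = UNIV" by blast
    then show "open ((\<lambda>a. - \<psi>_inv a) ` J)" by simp
    fix a b assume ab: "a \<in> J" "b \<in> J" "a \<le> b"
    show "- \<psi>_inv a \<le> - \<psi>_inv b"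
    proof (rule ccontr)
      assume "\<not> ?thesis"
      then have "\<psi>_inv a < \<psi>_inv b" by simp
      from \<psi>_f_decreasing[OF this] show False using ab inv_\<psi> by simp
    qed
  qed
  then have "continuous_on J (\<lambda>a. - (- \<psi>_inv a))" by (rule continuous_on_minus)
  then show ?thesis by simp
qed

lemma stationary_max_linear:
  assumes n: "n \<ge> 3" and h: "C1_density S h" and max: "stationary_max n h"
    and r: "r > 0" "{-r..r} \<subseteq> J" and t: "- \<psi> f t / real (n - 1) \<in> J"
  shows "\<psi> h t = \<psi> h (\<psi>_inv r) / r * \<psi> f t"
proof -
  let ?F = "\<lambda>a. \<psi> h (\<psi>_inv a)"
  have "?F (\<psi> f t) = ?F r / r * \<psi> f t"
  proof (rule zero_sum_preserving_linear[OF n connected_J r])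
    show "continuous_on J ?F"
      by (rule continuous_on_compose2[OF continuous_\<psi>[OF h] continuous_inv_\<psi>]) simp
    show "(\<Sum>i<n. ?F (a i)) = 0" if "\<And>i. i < n \<Longrightarrow> a i \<in> J" "(\<Sum>i<n. a i) = 0" for a
      by (rule stationary_maxD[OF max h]) (use that inv_\<psi>(2) in simp)
    show "\<psi> f t \<in> J" by (simp add: J_def)
  qed (rule t)
  then show ?thesis by (simp add: inv_\<psi>)
qed

text \<open>Every score can be balanced by \<open>n - 1\<close> equal ones. For
  \<open>n \<ge> 3\<close> this says that \<open>n\<close> has reached the MCSS, see
  \<open>mcss_le_iff\<close>.\<close>

definition covering :: "nat \<Rightarrow> bool" where
  "covering n \<longleftrightarrow> (\<forall>a\<in>J. - a / real (n - 1) \<in> J)"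

lemma covering_imp_related:
  assumes n: "n \<ge> 3" and h: "C1_density S h" and max: "stationary_max n h" and cov: "covering n"
  shows "H_related S U1 U2 f h"
proof -
  obtain r where r: "r > 0" "{-r..r} \<subseteq> J" using ex_symmetric_J by blast
  have lin: "\<psi> h t = \<psi> h (\<psi>_inv r) / r * \<psi> f t" for t
  proof (rule stationary_max_linear[OF n h max r])
    have "\<psi> f t \<in> J" by (simp add: J_def)
    then show "- \<psi> f t / real (n - 1) \<in> J" using cov unfolding covering_def by blast
  qed
  show ?thesis by (rule proportional_imp_related[OF h max _ lin]) (use n in simp)
qed

text \<open>For each \<open>t\<close> a large enough \<open>n\<close> brings
  \<open>- \<psi> f t / (n - 1)\<close> into the symmetric interval, and the resulting slope does
  not depend on \<open>n\<close> or \<open>t\<close>. Coincidence at arbitrarily large sizes thus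
  suffices even when the MCSS is infinite.\<close>

lemma unbounded_imp_related:
  assumes h: "C1_density S h" and max: "\<And>N. \<exists>n\<ge>N. stationary_max n h"
  shows "H_related S U1 U2 f h"
proof -
  obtain r where r: "r > 0" "{-r..r} \<subseteq> J" using ex_symmetric_J by blast
  have "\<psi> h t = \<psi> h (\<psi>_inv r) / r * \<psi> f t" for t
  proof -
    obtain m where m: "\<bar>\<psi> f t\<bar> / r < real m" using reals_Archimedean2 by blast
    obtain n where n: "n \<ge> max 3 (m + 1)" "stationary_max n h" using max by blast
    have "real m \<le> real (n - 1)" "real (n - 1) > 0" using n(1) by auto
    moreover have "\<bar>\<psi> f t\<bar> < real m * r" using m r(1) by (simp add: divide_less_eq)
    ultimately have "\<bar>\<psi> f t\<bar> \<le> real (n - 1) * r" using mult_right_mono[of "real m" "real (n - 1)" r] r(1) by linarith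
    then have "\<bar>\<psi> f t\<bar> / real (n - 1) \<le> r" using \<open>real (n - 1) > 0\<close> by (simp add: divide_le_eq mult.commute)
    then have "\<bar>- \<psi> f t / real (n - 1)\<bar> \<le> r" by (simp add: abs_divide)
    then have "- \<psi> f t / real (n - 1) \<in> {-r..r}" unfolding abs_le_iff by (simp add: minus_le_iff)
    moreover have "n \<ge> 3" using n(1) by simp
    ultimately show ?thesis using stationary_max_linear[OF _ h n(2) r, of t] r(2) by blast
  qed
  moreover obtain n where "n \<ge> 1" "stationary_max n h" using max by blast
  ultimately show ?thesis using proportional_imp_related[OF h] by metis
qed

text \<open>The score is prescribed and the density solved for: on \<open>S\<close>,
  \<open>h\<close> is \<open>f x * exp (B (s x))\<close> normalised, with \<open>B\<close> an
  antiderivative of \<open>b \<circ> \<psi> f\<close>. As \<open>l\<close> and \<open>u\<close> are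
  scores, that function lives on a compact interval, so \<open>B\<close> is bounded and the mass is
  finite and positive.\<close>

lemma perturbed_density:
  assumes b: "continuous_on UNIV b" and supp: "\<And>a. b a \<noteq> 0 \<Longrightarrow> l \<le> a \<and> a \<le> u" and lu: "l \<in> J" "u \<in> J" "l \<le> u"
  obtains h where "C1_density S h" "\<And>t. \<psi> h t = \<psi> f t + b (\<psi> f t)"
proof -
  define \<beta> where "\<beta> t = b (\<psi> f t)" for t
  have c\<beta>: "continuous_on UNIV \<beta>"
    unfolding \<beta>_def by (rule continuous_on_compose2[OF b continuous_\<psi>_f]) simp
  obtain B where B: "\<And>t. (B has_real_derivative \<beta> t) (at t)"
    using interval_antiderivative[OF open_UNIV connected_UNIV c\<beta>] by blast
  \<comment> \<open>The left end \<open>p\<close> belongs to \<open>u\<close> and the right end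
    \<open>q\<close> to \<open>l\<close>, because the score decreases.\<close>
  obtain p q where pq: "\<psi> f p = u" "\<psi> f q = l" using lu by (auto simp: J_def)
  have "p \<le> q" using \<psi>_f_decreasing[of q p] pq lu(3) by (meson not_less)
  have \<beta>0: "\<beta> t = 0" if "t < p \<or> q < t" for t
    using supp[of "\<psi> f t"] \<psi>_f_decreasing[of t p] \<psi>_f_decreasing[of q t] pq that by (force simp: \<beta>_def)
  have cB: "continuous_on {p..q} B" using B DERIV_isCont by (intro continuous_at_imp_continuous_on) blast
  obtain M where "\<forall>x\<in>B ` {p..q}. norm x \<le> M"
    using compact_imp_bounded[OF compact_continuous_image[OF cB compact_Icc]] unfolding bounded_iff by blast
  then have M: "\<bar>B t\<bar> \<le> M" if "p \<le> t" "t \<le> q" for t using that by auto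
  have bnd: "\<bar>B t\<bar> \<le> M" for t
  proof -
    consider "t < p" | "p \<le> t \<and> t \<le> q" | "q < t" by linarith
    then show ?thesis
    proof cases
      case 1
      obtain z where "t < z" "z < p" "B p - B t = (p - t) * \<beta> z" using MVT2[OF 1] B by blast
      then show ?thesis using \<beta>0 M[of p] \<open>p \<le> q\<close> by simp
    next
      case 3
      obtain z where "q < z" "z < t" "B t - B q = (t - q) * \<beta> z" using MVT2[OF 3] B by blast
      then show ?thesis using \<beta>0 M[of q] \<open>p \<le> q\<close> by simp
    qed (use M in auto)
  qed
  note fD = C1_densityD[OF C1_density_f]
  define h0 where "h0 x = f x * exp (B (s x))" for x
  define h1 where "h1 x = indicator S x * h0 x" for x
  have dBs: "((\<lambda>x. exp (B (s x))) has_real_derivative exp (B (s x)) * (\<beta> (s x) * (1 / U1 x))) (at x)"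
    if "x \<in> S" for x
    by (rule DERIV_fun_exp) (intro DERIV_chain2[OF B] DERIV_s that)
  have dh0: "(h0 has_real_derivative deriv f x * exp (B (s x)) + exp (B (s x)) * (\<beta> (s x) * (1 / U1 x)) * f x) (at x)"
    (is "(_ has_real_derivative ?D x) _") if "x \<in> S" for x
    unfolding h0_def by (rule DERIV_mult[OF fD(2)[OF that] dBs[OF that]])
  have ch0: "continuous_on S h0" using dh0 DERIV_isCont by (intro continuous_at_imp_continuous_on) blast
  have "(\<lambda>x. indicator S x *\<^sub>R h0 x) \<in> borel_measurable borel"
    by (rule borel_measurable_continuous_on_indicator) (use ch0 open_support in auto)
  then have bm: "h1 \<in> borel_measurable borel" by (simp add: h1_def[abs_def])
  have fm: "f \<in> borel_measurable borel" and fint: "(\<integral>\<^sup>+x. ennreal (f x) \<partial>lborel) = 1"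
    and f0: "x \<notin> S \<Longrightarrow> f x = 0" for x
    using f_density by (auto simp: density_with_support_def)
  define I where "I = (\<integral>\<^sup>+x. ennreal (h1 x) \<partial>lborel)"
  have f_nonneg: "f x \<ge> 0" for x using f_pos f0 by (metis less_imp_le order_refl)
  have scaled: "(\<integral>\<^sup>+x. ennreal (exp r * f x) \<partial>lborel) = ennreal (exp r)" for r
    using fint fm f_nonneg by (simp add: ennreal_mult nn_integral_cmult)
  have "I \<le> ennreal (exp M)"
    unfolding I_def scaled[symmetric]
  proof (intro nn_integral_mono ennreal_leI)
    fix x show "h1 x \<le> exp M * f x"
      using bnd[of "s x"] f_nonneg[of x] f0[of x]
      by (auto simp: h1_def h0_def mult.commute[of "f x"] split: split_indicator intro!: mult_right_mono)
  qed
  moreover have "ennreal (exp (- M)) \<le> I"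
    unfolding I_def scaled[symmetric]
  proof (intro nn_integral_mono ennreal_leI)
    fix x show "exp (- M) * f x \<le> h1 x"
      using bnd[of "s x"] f_nonneg[of x] f0[of x]
      by (auto simp: h1_def h0_def mult.commute[of "f x"] split: split_indicator intro!: mult_right_mono)
  qed
  ultimately obtain z where z1: "I = ennreal z" "exp (- M) \<le> z"
    by (cases I) (auto simp: top_unique)
  then have z: "I = ennreal z" "z > 0" using less_le_trans[OF exp_gt_zero] by blast+
  define h where "h x = h1 x / z" for x
  have h_on: "h x = h0 x / z" if "x \<in> S" for x using that by (simp add: h_def h1_def)
  have dh: "(h has_real_derivative ?D x / z) (at x)" if x: "x \<in> S" for x
  proof -
    have "((\<lambda>x. h0 x / z) has_real_derivative ?D x / z) (at x)" by (rule DERIV_cdivide[OF dh0[OF x]])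
    then show ?thesis
      using eventually_in_S[OF x] h_on
      by (subst DERIV_cong_ev[OF refl _ refl, where g = "\<lambda>x. h0 x / z"]) (auto elim: eventually_mono)
  qed
  have h_pos: "0 < h x" if "x \<in> S" for x using h_on[OF that] f_pos[OF that] z(2) by (simp add: h0_def)
  have "density_with_support S h"
    unfolding density_with_support_def
  proof (intro conjI)
    show "h \<in> borel_measurable borel" unfolding h_def[abs_def] using bm by measurable
    have h1nn: "h1 x \<ge> 0" for x using f_nonneg by (auto simp: h1_def h0_def)
    have "(\<integral>\<^sup>+x. ennreal (h x) \<partial>lborel) = (\<integral>\<^sup>+x. ennreal (1 / z) * ennreal (h1 x) \<partial>lborel)"
      using z(2) h1nn by (intro nn_integral_cong) (simp add: h_def flip: ennreal_mult)
    also have "\<dots> = ennreal (1 / z) * I" unfolding I_def using bm by (intro nn_integral_cmult) simp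
    also have "\<dots> = 1" using z by (simp flip: ennreal_mult)
    finally show "(\<integral>\<^sup>+x. ennreal (h x) \<partial>lborel) = 1" .
  qed (use h_pos in \<open>auto simp: h_def h1_def\<close>)
  moreover have "continuous_on S (\<lambda>x. ?D x / z)"
  proof -
    have cB: "continuous_on UNIV B" and cf: "continuous_on S f"
      using B fD(2) DERIV_isCont by (blast intro: continuous_at_imp_continuous_on)+
    show ?thesis
      by (intro continuous_intros fD(3) continuous_on_compose2[OF c\<beta> continuous_s] U1_cont
          continuous_on_compose2[OF cB continuous_s] cf) (use z(2) U1_nz in auto)
  qed
  then have "h C1_differentiable_on S"
    unfolding C1_differentiable_on_def has_real_derivative_iff_has_vector_derivative[symmetric]
    by (intro exI[of _ "\<lambda>x. ?D x / z"] conjI ballI dh)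
  ultimately have h: "C1_density S h" unfolding C1_density_def by blast
  have "\<psi> h t = \<psi> f t + b (\<psi> f t)" for t
  proof -
    have "deriv h (X t) = ?D (X t) / z" using dh[OF X_mem] by (rule DERIV_imp_deriv)
    moreover have "v * ((a * E + E * (\<beta>' * (1 / v)) * F) / z) / (F * E / z) = v * a / F + \<beta>'"
      if "v \<noteq> 0" "E \<noteq> 0" "F \<noteq> 0" for v a E \<beta>' F :: real
      using that z(2) by (simp add: field_simps)
    ultimately show ?thesis
      unfolding \<psi>_def score_def h_on[OF X_mem] h0_def s_X \<beta>_def
      using f_pos[OF X_mem[of t]] U1_nz[OF X_mem[of t]] by simp
  qed
  then show ?thesis using that h by blast
qed

text \<open>Lipschitz constant 1 keeps \<open>a + b a\<close> nondecreasing, so the new score is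
  still nonincreasing and its zero sums are maxima. Beyond \<open>u\<close> the score is unchanged,
  which would force the factor 1 on a related density, against
  \<open>b a \<noteq> 0\<close>.\<close>

lemma ex_unrelated_stationary_max:
  assumes lip: "\<And>a a'. \<bar>b a - b a'\<bar> \<le> \<bar>a - a'\<bar>" and supp: "\<And>a. b a \<noteq> 0 \<Longrightarrow> l \<le> a \<and> a \<le> u"
    and lu: "l \<in> J" "u \<in> J" "l \<le> u" and nz: "a \<in> J" "b a \<noteq> 0"
    and zero: "\<And>a. \<lbrakk>\<And>i. i < n \<Longrightarrow> a i \<in> J; (\<Sum>i<n. a i) = 0\<rbrakk> \<Longrightarrow> (\<Sum>i<n. b (a i)) = 0"
  shows "\<exists>h. C1_density S h \<and> stationary_max n h \<and> \<not> H_related S U1 U2 f h"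
proof -
  have "continuous_on UNIV b"
    unfolding continuous_on_iff using lip by (auto simp: dist_real_def intro: le_less_trans)
  then obtain h where h: "C1_density S h" "\<And>t. \<psi> h t = \<psi> f t + b (\<psi> f t)"
    using perturbed_density[OF _ supp lu] by blast
  have "stationary_max n h"
    unfolding stationary_max_def
  proof (intro allI impI)
    fix y t assume y: "(\<Sum>i<n. \<psi> f (y i)) = 0"
    show "(\<Sum>i<n. P h (y i + t)) \<le> (\<Sum>i<n. P h (y i))"
    proof (rule concave_max[OF h(1)])
      show "\<psi> h y' \<le> \<psi> h x" if "x \<le> y'" for x y'
        using lip[of "\<psi> f x" "\<psi> f y'"] \<psi>_f_antimono[OF that] by (simp add: h(2))
      show "(\<Sum>i<n. \<psi> h (y i)) = 0"
        using y zero[of "\<lambda>i. \<psi> f (y i)"] by (simp add: h(2) sum.distrib J_def)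
    qed
  qed
  moreover have "\<not> H_related S U1 U2 f h"
  proof
    assume "H_related S U1 U2 f h"
    then obtain d where "\<And>t. \<psi> h t = d * \<psi> f t" using H_related_iff_\<psi>[OF h(1)] by blast
    then have d: "x + b x = d * x" if "x \<in> J" for x using that h(2) by (auto simp: J_def)
    obtain e where e: "e > 0" "cball u e \<subseteq> J" using open_J lu(2) open_contains_cball by blast
    \<comment> \<open>A point of \<open>J\<close> beyond \<open>u\<close>, chosen nonzero so that it
      determines \<open>d\<close>.\<close>
    define x where "x = (if u + e = 0 then u + e / 2 else u + e)"
    have x: "x \<in> J" "x > u" "x \<noteq> 0" using e by (auto simp: x_def subset_iff dist_real_def)
    have "b x = 0" using supp[of x] x(2) by force
    then have "d = 1" using d[OF x(1)] x(3) by simp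
    then show False using d[OF nz(1)] nz(2) by simp
  qed
  ultimately show ?thesis using h(1) by blast
qed

definition tent :: "real \<Rightarrow> real \<Rightarrow> real \<Rightarrow> real" where
  "tent c \<delta> a = max 0 (\<delta> - \<bar>a - c\<bar>)"

lemma tent_lipschitz: "\<bar>tent c \<delta> a - tent c \<delta> a'\<bar> \<le> \<bar>a - a'\<bar>"
  unfolding tent_def max_def abs_real_def by auto

text \<open>Two scores with sum zero are opposite, so any odd \<open>b\<close> preserves zero sums;
  half the difference of a tent and its reflection is odd and keeps the Lipschitz constant
  1.\<close>

lemma unrelated_size_2: "\<exists>h. C1_density S h \<and> stationary_max 2 h \<and> \<not> H_related S U1 U2 f h"
proof -
  obtain r where r: "r > 0" "{-r..r} \<subseteq> J" using ex_symmetric_J by blast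
  let ?t = "tent (r / 2) (r / 2)"
  let ?b = "\<lambda>a. (?t a - ?t (- a)) / 2"
  have half_diff: "\<bar>(p - q) / 2 - (p' - q') / 2\<bar> \<le> D"
    if "\<bar>q - q'\<bar> \<le> D" "\<bar>p - p'\<bar> \<le> D" for p q p' q' D :: real
    using that by (auto simp: abs_le_iff field_simps)
  show ?thesis
  proof (rule ex_unrelated_stationary_max[where b = ?b and l = "- r" and u = r and a = "r / 2"])
    show "\<bar>?b a - ?b a'\<bar> \<le> \<bar>a - a'\<bar>" for a a'
    proof -
      have "\<bar>?t (- a) - ?t (- a')\<bar> \<le> \<bar>a - a'\<bar>"
        using tent_lipschitz[of "r / 2" "r / 2" "- a" "- a'"] by (simp add: abs_minus_commute)
      then show ?thesis using tent_lipschitz[of "r / 2" "r / 2" a a'] half_diff by blast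
    qed
    show "- r \<le> a \<and> a \<le> r" if "?b a \<noteq> 0" for a
      using that r(1) unfolding tent_def max_def abs_real_def by (auto split: if_splits)
    show "?b (r / 2) \<noteq> 0" using r(1) by (auto simp: tent_def max_def)
    show "(\<Sum>i<2. ?b (a i)) = 0" if "(\<Sum>i<2. a i) = 0" for a :: "nat \<Rightarrow> real"
    proof -
      have "a 1 = - a 0" using that by (simp add: numeral_2_eq_2)
      then show ?thesis by (simp add: numeral_2_eq_2 field_simps)
    qed
  qed (use r in auto)
qed

text \<open>If the other \<open>n - 1\<close> scores cannot balance \<open>a\<close>, then scores beyond \<open>a\<close> never occur in a
  vanishing sum, and the profile can be changed there.\<close>

lemma unrelated_not_covering:
  assumes n: "n \<ge> 3" and cov: "\<not> covering n"
  shows "\<exists>h. C1_density S h \<and> stationary_max n h \<and> \<not> H_related S U1 U2 f h"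
proof -
  obtain a0 where a0: "a0 \<in> J" "- a0 / real (n - 1) \<notin> J" using cov by (auto simp: covering_def)
  then have "a0 \<noteq> 0" using zero_J by auto
  obtain e where e: "e > 0" "cball a0 e \<subseteq> J" using open_J a0(1) open_contains_cball by blast
  \<comment> \<open>The tent around \<open>c\<close> has radius \<open>e / 2\<close>, so it lies
    beyond \<open>a0\<close> as seen from \<open>0\<close>, still inside \<open>J\<close>.\<close>
  define c where "c = a0 + sgn a0 * (e / 2)"
  have sgn: "sgn a0 = 1 \<and> a0 > 0 \<or> sgn a0 = -1 \<and> a0 < 0" using \<open>a0 \<noteq> 0\<close> by (auto simp: sgn_if)
  show ?thesis
  proof (rule ex_unrelated_stationary_max[where b = "tent c (e / 2)" and l = "c - e / 2" and u = "c + e / 2" and a = c])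
    show "\<bar>tent c (e / 2) a - tent c (e / 2) a'\<bar> \<le> \<bar>a - a'\<bar>" for a a' by (rule tent_lipschitz)
    show "c - e / 2 \<le> a \<and> a \<le> c + e / 2" if "tent c (e / 2) a \<noteq> 0" for a
      using that by (auto simp: tent_def max_def abs_real_def split: if_splits)
    show "c - e / 2 \<in> J" "c + e / 2 \<in> J" "c \<in> J"
      using sgn e by (auto simp: c_def subset_iff dist_real_def)
    show "tent c (e / 2) c \<noteq> 0" using e(1) by (simp add: tent_def)
    show "(\<Sum>i<n. tent c (e / 2) (a i)) = 0" if a: "\<And>i. i < n \<Longrightarrow> a i \<in> J" "(\<Sum>i<n. a i) = 0" for a
    proof (rule sum.neutral, rule ballI, rule ccontr)
      fix k assume k: "k \<in> {..<n}" "tent c (e / 2) (a k) \<noteq> 0"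
      then have "\<bar>a k - c\<bar> < e / 2" by (auto simp: tent_def max_def split: if_splits)
      then have "a k - c < e / 2" "c - a k < e / 2" unfolding abs_less_iff by simp_all
      then have beyond: "a0 > 0 \<and> a k > a0 \<or> a0 < 0 \<and> a k < a0" using sgn by (auto simp: c_def)
      let ?K = "{..<n} - {k}"
      have card: "card ?K = n - 1" using k(1) by simp
      \<comment> \<open>The mean of the other scores lies in the convex set \<open>J\<close>, and it
        equals \<open>- a k / (n - 1)\<close>.\<close>
      have "(\<Sum>i\<in>?K. (1 / real (n - 1)) *\<^sub>R a i) \<in> J"
        by (rule convex_sum[OF _ convex_J]) (use n a(1) card in auto)
      moreover have "(\<Sum>i\<in>?K. a i) = - a k" using a(2) k(1) by (simp add: sum_diff1)
      then have "(\<Sum>i\<in>?K. (1 / real (n - 1)) *\<^sub>R a i) = 1 / real (n - 1) * - a k"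
        by (simp only: real_scaleR_def flip: sum_distrib_left)
      ultimately have m: "- a k / real (n - 1) \<in> J" by simp
      \<comment> \<open>\<open>a0\<close> lies between \<open>0\<close> and \<open>a k\<close>, so
        \<open>- a0 / (n - 1)\<close> is a convex combination of \<open>0\<close> and that mean,
        against the choice of \<open>a0\<close>.\<close>
      have "0 \<le> a0 / a k" "a0 / a k \<le> 1" using beyond by (auto simp: field_simps zero_le_divide_iff)
      then have "(1 - a0 / a k) *\<^sub>R 0 + (a0 / a k) *\<^sub>R (- a k / real (n - 1)) \<in> J"
        by (intro convexD_alt[OF convex_J zero_J m])
      moreover have "(a0 / a k) * (- a k / real (n - 1)) = - a0 / real (n - 1)" using beyond by auto
      ultimately have "- a0 / real (n - 1) \<in> J" by (simp only: mult_zero_right add_0_left real_scaleR_def)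
      then show False using a0(2) by blast
    qed
  qed (use e in auto)
qed

section \<open>The image of the score and the minimal covering sample size\<close>

lemma mem_J_iff: "a \<in> J \<longleftrightarrow> - score_minus S U1 U2 f < ereal a \<and> ereal a < score_plus S U1 U2 f"
proof -
  have J: "J = score U1 U2 f ` S" by (simp add: J_def range_\<psi>)
  have plus: "score_plus S U1 U2 f = (SUP x\<in>J. ereal x)"
    and minus: "- score_minus S U1 U2 f = (INF x\<in>J. ereal x)"
    by (simp_all add: score_plus_def score_minus_def J image_image)
  show ?thesis
    unfolding plus minus
  proof
    assume a: "a \<in> J"
    obtain e where e: "e > 0" "cball a e \<subseteq> J" using open_J a open_contains_cball by blast
    then have "a + e \<in> J" "a - e \<in> J" by (auto simp: subset_iff dist_real_def)
    then have "ereal (a + e) \<le> (SUP x\<in>J. ereal x)" "(INF x\<in>J. ereal x) \<le> ereal (a - e)"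
      by (auto intro: SUP_upper INF_lower)
    moreover have "ereal a < ereal (a + e)" "ereal (a - e) < ereal a" using e(1) by auto
    ultimately show "(INF x\<in>J. ereal x) < ereal a \<and> ereal a < (SUP x\<in>J. ereal x)"
      by (meson less_le_trans le_less_trans)
  next
    assume "(INF x\<in>J. ereal x) < ereal a \<and> ereal a < (SUP x\<in>J. ereal x)"
    then obtain u v where "u \<in> J" "u < a" "v \<in> J" "a < v"
      unfolding INF_less_iff less_SUP_iff by auto
    then show "a \<in> J" using connected_contains_Icc[OF connected_J, of u v] by (auto simp: subset_iff)
  qed
qed

text \<open>The scores hardest to balance are those near the ends of \<open>J\<close>. For finite
  ends \<open>- m\<close> and \<open>p\<close>, covering means \<open>p \<le> (n - 1) * m\<close>
  and \<open>m \<le> (n - 1) * p\<close>, that is \<open>max p m / min p m + 1 \<le> n\<close>. An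
  infinite end is never balanced by a finite one.\<close>

lemma mcss_le_iff:
  assumes n: "n \<ge> 3"
  shows "mcss S U1 U2 f \<le> enat n \<longleftrightarrow> covering n"
proof -
  define p where "p = score_plus S U1 U2 f"
  define m where "m = score_minus S U1 U2 f"
  have mem: "a \<in> J \<longleftrightarrow> - m < ereal a \<and> ereal a < p" for a by (simp add: mem_J_iff p_def m_def)
  have "0 < p" "- m < 0" using mem[of 0] zero_J by (simp_all add: zero_ereal_def[symmetric])
  then have pos: "0 < p" "0 < m" by (simp, cases m, simp_all)
  have k: "real (n - 1) \<ge> 2" using n by simp
  have mc: "mcss S U1 U2 f = (if m = p then 2 else if m < \<infinity> \<and> p < \<infinity>
        then enat (nat \<lceil>real_of_ereal (max p m) / real_of_ereal (min p m) + 1\<rceil>) else \<infinity>)"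
    by (simp add: mcss_def p_def m_def Let_def)
  have shrink: "\<bar>a / real (n - 1)\<bar> \<le> \<bar>a\<bar>" for a
  proof -
    have "\<bar>a\<bar> / real (n - 1) \<le> \<bar>a\<bar> / 1" using k by (intro divide_left_mono) auto
    then show ?thesis by (simp add: abs_divide)
  qed
  consider (inf) "m = \<infinity>" "p = \<infinity>" | (fin) M Q where "m = ereal M" "p = ereal Q" "M > 0" "Q > 0"
    | (left) M where "m = ereal M" "M > 0" "p = \<infinity>" | (right) Q where "m = \<infinity>" "p = ereal Q" "Q > 0"
    using pos by (cases m; cases p) auto
  then show ?thesis
  proof cases
    case inf
    then show ?thesis using n mem by (auto simp: mc covering_def numeral_eq_enat)
  next
    case (left M)
    \<comment> \<open>Its balancing value is exactly the end point \<open>- M\<close>, which the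
      open interval omits.\<close>
    have "real (n - 1) * M \<in> J" using left k by (simp add: mem mult_nonneg_nonneg less_le_trans[of "- M" 0])
    moreover have "- (real (n - 1) * M) / real (n - 1) \<notin> J" using left k by (simp add: mem)
    ultimately have "\<not> covering n" unfolding covering_def by blast
    then show ?thesis using left by (simp add: mc)
  next
    case (right Q)
    have "- (real (n - 1) * Q) \<in> J" using right k by (simp add: mem less_le_trans[of _ 0 Q])
    moreover have "- (- (real (n - 1) * Q)) / real (n - 1) \<notin> J" using right k by (simp add: mem)
    ultimately have "\<not> covering n" unfolding covering_def by blast
    then show ?thesis using right by (simp add: mc)
  next
    case (fin M Q)
    have memr: "a \<in> J \<longleftrightarrow> - M < a \<and> a < Q" for a using fin by (simp add: mem)
    have cov: "covering n \<longleftrightarrow> Q \<le> real (n - 1) * M \<and> M \<le> real (n - 1) * Q"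
    proof
      assume c: "covering n"
      have "Q \<le> real (n - 1) * M"
      proof (rule ccontr)
        assume "\<not> ?thesis"
        then have "real (n - 1) * M \<in> J" using fin k by (simp add: memr less_le_trans[of "- M" 0])
        then have "- (real (n - 1) * M) / real (n - 1) \<in> J" using c by (auto simp: covering_def)
        then show False using k by (simp add: memr)
      qed
      moreover have "M \<le> real (n - 1) * Q"
      proof (rule ccontr)
        assume "\<not> ?thesis"
        then have "- (real (n - 1) * Q) \<in> J" using fin k by (simp add: memr less_le_trans[of _ 0 Q])
        then have "- (- (real (n - 1) * Q)) / real (n - 1) \<in> J" using c unfolding covering_def by blast
        then show False using k by (simp add: memr)
      qed
      ultimately show "Q \<le> real (n - 1) * M \<and> M \<le> real (n - 1) * Q" by blast
    next
      assume QM: "Q \<le> real (n - 1) * M \<and> M \<le> real (n - 1) * Q"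
      show "covering n"
        unfolding covering_def memr
      proof (intro ballI conjI)
        fix a assume "a \<in> J"
        then have "a < real (n - 1) * M" "- (real (n - 1) * Q) < a" using QM by (auto simp: memr)
        then show "- M < - a / real (n - 1)" "- a / real (n - 1) < Q"
          using k by (simp_all add: field_simps)
      qed
    qed
    show ?thesis
    proof (cases "M = Q")
      case True
      have "M \<le> real (n - 1) * M" using k fin mult_right_mono[of 1 "real (n - 1)" M] by simp
      then show ?thesis using fin True n cov by (simp add: mc numeral_eq_enat)
    next
      case False
      have "mcss S U1 U2 f \<le> enat n \<longleftrightarrow> nat \<lceil>max Q M / min Q M + 1\<rceil> \<le> n"
        using fin False by (simp add: mc max_def min_def)
      also have "\<dots> \<longleftrightarrow> max Q M / min Q M + 1 \<le> real n" unfolding nat_le_iff ceiling_le_iff by simp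
      also have "\<dots> \<longleftrightarrow> max Q M \<le> real (n - 1) * min Q M"
        using fin n by (simp add: field_simps of_nat_diff min_def)
      also have "\<dots> \<longleftrightarrow> Q \<le> real (n - 1) * M \<and> M \<le> real (n - 1) * Q"
      proof -
        have "M \<le> real (n - 1) * M" "Q \<le> real (n - 1) * Q"
          using k fin mult_right_mono[of 1 "real (n - 1)" M] mult_right_mono[of 1 "real (n - 1)" Q] by simp_all
        then show ?thesis by (auto simp: max_def min_def)
      qed
      finally show ?thesis using cov by simp
    qed
  qed
qed

end

subsection \<open>The minimal necessary sample size\<close>

context location_coordinates
begin

text \<open>In terms of \<open>P\<close>, relatedness is an affine relation with positive slope,
  hence an equivalence on densities.\<close>

lemma H_related_iff_class_eq:
  assumes g: "density_with_support S g"
  shows "H_related S U1 U2 f g \<longleftrightarrow> H_class S U1 U2 f = H_class S U1 U2 g"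
proof -
  have rel: "H_related S U1 U2 a b \<longleftrightarrow> (\<exists>d>0. \<exists>k. \<forall>t. P b t = d * P a t + k)"
    if "density_with_support S a" "density_with_support S b" for a b
    by (rule H_related_iff_P) (use that in \<open>auto simp: density_with_support_def\<close>)
  have refl: "H_related S U1 U2 a a" if "density_with_support S a" for a
    unfolding rel[OF that that] by (intro exI[of _ 1] conjI exI[of _ 0]) auto
  have sym: "H_related S U1 U2 b a"
    if ab: "density_with_support S a" "density_with_support S b" "H_related S U1 U2 a b" for a b
  proof -
    obtain d k where "d > 0" "\<forall>t. P b t = d * P a t + k" using ab(3) unfolding rel[OF ab(1,2)] by blast
    then show ?thesis
      unfolding rel[OF ab(2,1)] by (intro exI[of _ "1 / d"] conjI exI[of _ "- k / d"]) (auto simp: field_simps)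
  qed
  have trans: "H_related S U1 U2 a c"
    if abc: "density_with_support S a" "density_with_support S b" "density_with_support S c"
      "H_related S U1 U2 a b" "H_related S U1 U2 b c" for a b c
  proof -
    obtain d k where "d > 0" "\<forall>t. P b t = d * P a t + k" using abc(4) unfolding rel[OF abc(1,2)] by blast
    moreover obtain d' k' where "d' > 0" "\<forall>t. P c t = d' * P b t + k'"
      using abc(5) unfolding rel[OF abc(2,3)] by blast
    ultimately show ?thesis
      unfolding rel[OF abc(1,3)]
      by (intro exI[of _ "d' * d"] conjI exI[of _ "d' * k + k'"]) (auto simp: algebra_simps)
  qed
  show ?thesis
  proof
    assume r: "H_related S U1 U2 f g"
    show "H_class S U1 U2 f = H_class S U1 U2 g"
      unfolding H_class_def using trans[OF f_density g] trans[OF g f_density] sym[OF f_density g r] r by blast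
  next
    assume "H_class S U1 U2 f = H_class S U1 U2 g"
    then show "H_related S U1 U2 f g" using refl[OF g] g by (auto simp: H_class_def)
  qed
qed

context
  assumes mle_ex: "\<And>n. n \<ge> 1 \<Longrightarrow> \<exists>est. is_mle \<Theta>0 D H n f est"
begin

lemma mle_coincide_iff_stationary_max:
  "n \<ge> 1 \<Longrightarrow> C1_density S h \<Longrightarrow> mle_coincide \<Theta>0 D H n f h \<longleftrightarrow> stationary_max n h"
  using mle_coincide_iff[OF _ mle_ex] by (simp add: stationary_max_def)

text \<open>A related \<open>g\<close> coincides at every size, an unrelated one only at finitely
  many by \<open>unbounded_imp_related\<close>. The bound depends on \<open>g\<close>, unlike the
  one in \<open>mnss\<close>.\<close>

lemma ex_sufficient_size:
  assumes g: "C1_density S g"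
  shows "\<exists>N\<ge>1. \<forall>n\<ge>N. mle_coincide \<Theta>0 D H n f g \<longleftrightarrow> H_related S U1 U2 f g"
proof (cases "H_related S U1 U2 f g")
  case True
  then show ?thesis
    using mle_coincide_iff_stationary_max[OF _ g] related_imp_stationary_max[OF g] by blast
next
  case False
  then obtain N where "\<And>n. n \<ge> N \<Longrightarrow> \<not> stationary_max n g" using unbounded_imp_related[OF g] by blast
  then have "\<forall>n\<ge>max 1 N. \<not> mle_coincide \<Theta>0 D H n f g"
    using mle_coincide_iff_stationary_max[OF _ g] by simp
  then show ?thesis using False by (intro exI[of _ "max 1 N"]) auto
qed

lemma coincide_iff_related_uniformly_iff:
  assumes n: "n \<ge> 2"
  shows "(\<forall>h. C1_density S h \<longrightarrow> (mle_coincide \<Theta>0 D H n f h \<longleftrightarrow> H_related S U1 U2 f h)) \<longleftrightarrow>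
    n \<ge> 3 \<and> mcss S U1 U2 f \<le> enat n"
proof (cases "n \<ge> 3")
  case True
  show ?thesis
  proof (cases "covering n")
    case cov: True
    have "mle_coincide \<Theta>0 D H n f h \<longleftrightarrow> H_related S U1 U2 f h" if "C1_density S h" for h
      using mle_coincide_iff_stationary_max[OF _ that, of n] n covering_imp_related[OF True that _ cov]
        related_imp_stationary_max[OF that] by auto
    then show ?thesis using cov True mcss_le_iff[OF True] by blast
  next
    case False
    then show ?thesis
      using unrelated_not_covering[OF True False] mle_coincide_iff_stationary_max[of n] n mcss_le_iff[OF True] by auto
  qed
next
  case False
  then have "n = 2" using n by simp
  then show ?thesis using unrelated_size_2 mle_coincide_iff_stationary_max[of 2] by auto
qed

lemma mnss_eq: "mnss \<Theta>0 D S H U1 U2 f = max (mcss S U1 U2 f) 3"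
proof -
  define A where "A = {N. 1 \<le> N \<and>
       (\<forall>h. density_with_support S h \<and> h C1_differentiable_on S \<longrightarrow>
         (\<forall>n\<ge>N. mle_coincide \<Theta>0 D H n f h \<longleftrightarrow> H_related S U1 U2 f h))}"
  have A: "N \<in> A \<longleftrightarrow> max (mcss S U1 U2 f) 3 \<le> enat N" for N
  proof -
    have three: "max (mcss S U1 U2 f) 3 \<le> enat N \<longleftrightarrow> N \<ge> 3 \<and> mcss S U1 U2 f \<le> enat N" for N
      by (auto simp: numeral_eq_enat)
    have "N \<in> A \<longleftrightarrow> 1 \<le> N \<and> (\<forall>n\<ge>N. \<forall>h. C1_density S h \<longrightarrow>
        (mle_coincide \<Theta>0 D H n f h \<longleftrightarrow> H_related S U1 U2 f h))"
      unfolding A_def C1_density_def by blast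
    \<comment> \<open>Size 1 can be left out: a bound \<open>N = 1\<close> would also have to work
      at size 2, which already fails.\<close>
    also have "\<dots> \<longleftrightarrow> 1 \<le> N \<and> (\<forall>n\<ge>max N 2. max (mcss S U1 U2 f) 3 \<le> enat n)"
    proof (cases "N \<ge> 2")
      case True
      then show ?thesis using coincide_iff_related_uniformly_iff three by auto
    next
      case False
      have "\<not> (\<forall>h. C1_density S h \<longrightarrow> (mle_coincide \<Theta>0 D H 2 f h \<longleftrightarrow> H_related S U1 U2 f h))"
        using coincide_iff_related_uniformly_iff[of 2] by simp
      moreover have "\<not> max (mcss S U1 U2 f) 3 \<le> enat 2" using three[of 2] by simp
      ultimately show ?thesis using False by (metis max.cobounded2 max_def nat_le_linear)
    qed
    also have "\<dots> \<longleftrightarrow> max (mcss S U1 U2 f) 3 \<le> enat N"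
    proof
      assume "1 \<le> N \<and> (\<forall>n\<ge>max N 2. max (mcss S U1 U2 f) 3 \<le> enat n)"
      then have *: "1 \<le> N" "max (mcss S U1 U2 f) 3 \<le> enat (max N 2)" by auto
      then have "max N 2 \<ge> 3" using three by blast
      then show "max (mcss S U1 U2 f) 3 \<le> enat N" using * by (simp add: max_def split: if_splits)
    next
      assume "max (mcss S U1 U2 f) 3 \<le> enat N"
      then show "1 \<le> N \<and> (\<forall>n\<ge>max N 2. max (mcss S U1 U2 f) 3 \<le> enat n)"
        using three[of N] by (auto intro: order_trans[of _ "enat N"])
    qed
    finally show ?thesis .
  qed
  have "Inf (enat ` A) = max (mcss S U1 U2 f) 3"
  proof (cases "max (mcss S U1 U2 f) 3")
    case (enat m)
    show ?thesis
      by (rule Inf_eqI) (use A enat in \<open>auto intro: INF_lower2\<close>)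
  next
    case infinity
    then have "A = {}" using A by auto
    then show ?thesis using infinity by (simp add: top_enat_def)
  qed
  then show ?thesis by (simp add: mnss_def A_def)
qed

end

end

theorem theorem6p1:
  fixes \<Theta>0 D S :: "real set"
    and H :: "real \<Rightarrow> real \<Rightarrow> real"
    and T U1 U2 f g :: "real \<Rightarrow> real"
  assumes family: "group_family \<Theta>0 D S H T U1 U2"
    and f: "density_with_support S f" "f C1_differentiable_on S"
    and g: "density_with_support S g" "g C1_differentiable_on S"
    and ident: "identifiable \<Theta>0 D H f"
    and mle_exists: "\<And>n. n \<ge> 1 \<Longrightarrow> \<exists>est. is_mle \<Theta>0 D H n f est"
    and invertible: "inj_on (score U1 U2 f) S"
  shows "(\<exists>N\<ge>1. \<forall>n\<ge>N. mle_coincide \<Theta>0 D H n f g \<longleftrightarrow> H_related S U1 U2 f g)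
       \<and> (H_related S U1 U2 f g \<longleftrightarrow> H_class S U1 U2 f = H_class S U1 U2 g)
       \<and> mnss \<Theta>0 D S H U1 U2 f = max (mcss S U1 U2 f) 3"
proof -
  interpret group_family \<Theta>0 D S H T U1 U2 by (rule family)
  interpret R: regular_family \<Theta>0 D S H T U1 U2 f
    by unfold_locales (use f ident mle_exists[of 1] invertible in auto)
  obtain s X where "location_coordinates \<Theta>0 D S H T U1 U2 f s X"
    using R.ex_location_coordinates by blast
  then interpret L: location_coordinates \<Theta>0 D S H T U1 U2 f s X .
  have g1: "C1_density S g" using g by (simp add: C1_density_def)
  show ?thesis
    using L.ex_sufficient_size[OF mle_exists g1] L.H_related_iff_class_eq[OF g(1)] L.mnss_eq[OF mle_exists]
    by blast
qed

end
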